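(* Let $A \in \mathbb{R}_{\max}^{n\times n}$, let $\Lambda \subset \mathbb{R}_{\max}$ be the set of all algebraic eigenvalues of $A$, and for each $\lambda\in\Lambda$ let $\mathcal{B}_\lambda$ be a basis of the algebraic eigenspace $W(A,\lambda)$. Suppose that for every $\lambda \in \mathbb{R}$ and every $\lambda$-maximal multi-circuit $\mathcal{C}$ in $G(A)$, any two distinct elementary critical circuits in $G(B_{A,\lambda,\mathcal{C}})$ are disjoint (have no common vertex). Then $\bigcup_{\lambda\in\Lambda}\mathcal{B}_\lambda$ is a basis of the sum $\bigoplus_{\lambda\in\Lambda} W(A,\lambda)$ of all algebraic eigenspaces of $A$.
   Context: Max-plus algebra: $\mathbb{R}_{\max}=\mathbb{R}\cup\{\varepsilon\}$, $\varepsilon=-\infty$, $a\oplus b=\max\{a,b\}$, $a\otimes b=a+b$, $e=0$; operations extend to vectors and matrices as usual. $\mathcal{E}$ is the vector (or matrix) with all entries $\varepsilon$; $E_n$ is the max-plus unit matrix (diagonal $0$, off-diagonal $\varepsilon$). $\det A=\bigoplus_{\pi\in S_n}\bigotimes_i a_{i\pi(i)}$. The characteristic polynomial is $\chi_A(t)=\det(A\oplus t\otimes E_n)$; as a function on $\mathbb{R}_{\max}$ it factorizes as $\bigotimes_i (t\oplus r_i)^{\otimes p_i}$ with distinct $r_i\in\mathbb{R}_{\max}$ and $p_i\ge1$, $\sum p_i=n$; the $r_i$ are its roots, with multiplicities $p_i$, and are called the algebraic eigenvalues of $A$. Subspaces: a subset of $\mathbb{R}_{\max}^n$ closed under $\oplus$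 and scalar multiplication $\otimes$. A basis of a subspace is a minimal spanning set (with respect to max-plus linear combinations). The sum of subspaces is $\bigoplus_k U_k=\{\bigoplus_k \bm{x}_k : \bm{x}_k\in U_k\}$ (not a direct sum). Graphs: $G(A)$ is the weighted digraph on $\{1,\dots,n\}$ with an edge $(i,j)$ of weight $a_{ij}$ whenever $a_{ij}\ne\varepsilon$. A circuit is elementary if it does not repeat vertices (loops allowed); length $\ell$ = number of edges, weight $w$ = sum of edge weights, average weight $w/\ell$. A multi-circuit is a (possibly empty) union of disjoint elementary circuits, with length and weight the sums of those of its circuits; $V(\mathcal{C})$, $E(\mathcal{C})$ are its vertex and edge sets. The maximum eigenvalue of a matrix equals the maximum average weight of elementary circuits in its graph; a circuit is critical if its average weight equals this maximum. For $\lambda\in\mathbb{R}$, $\mathcal{C}$ is $\lambda$-maximal if $\chi_A(\lambda)=w(\mathcal{C})\otimes\lambda^{\otimes(n-\ell(\mathcal{C}))}$; it is $\varepsilon$-maximal if it is $\mu$-maximal for all sufficiently small (i.e. very negative) real $\mu$. For a multi-circuit $\mathcal{C}$: $A_{\mathcal{C}}$ has entry $a_{ij}$ if $(i,j)\in E(\mathcal{C})$ and $\varepsilon$ otherwise; $A_{\setminus\mathcal{C}}$ has entry $\varepsilon$ if $(i,j)\in E(\mathcal{C})$ and $a_{ij}$ otherwise; $E_{\mathcal{C}}$ (resp. $E_{\setminus\mathcal{C}}$) has $(i,i)$ entry $e$ for $i\in V(\mathcal{C})$ (resp. $i\notin V(\mathcal{C})$) and all other entries $\varepsilon$. For $\lambda\in\mathbb{R}$,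 $B_{A,\lambda,\mathcal{C}}:=(A_{\mathcal{C}}\oplus\lambda\otimes E_{\setminus\mathcal{C}})^{-1}\otimes(A_{\setminus\mathcal{C}}\oplus\lambda\otimes E_{\mathcal{C}})$ (the first factor is the inverse of a generalized permutation matrix). For $\lambda\in\mathbb{R}_{\max}$, $W(A,\lambda,\mathcal{C})$ is the set of $\bm{x}\in\mathbb{R}_{\max}^n$ with $(A_{\setminus\mathcal{C}}\oplus\lambda\otimes E_{\mathcal{C}})\otimes\bm{x}=(A_{\mathcal{C}}\oplus\lambda\otimes E_{\setminus\mathcal{C}})\otimes\bm{x}$. Algebraic eigenspace: a matrix satisfies $(\bigstar)$ if for each $\lambda\in\mathbb{R}_{\max}$ any two distinct $\lambda$-maximal multi-circuits in its graph have different lengths. For $\bm{\zeta}=(\zeta_{ij})\in[0,1]^{n\times n}$ and $\delta>0$ let $[A(\bm{\zeta};\delta)]_{ij}=a_{ij}-\zeta_{ij}\delta$. Let $Z$ be the (nonempty) set of $\bm{\zeta}\in[0,1]^{n\times n}$ for which there is $\delta'>0$ such that $A(\bm{\zeta};\delta)$ satisfies $(\bigstar)$ for all $0<\delta<\delta'$. Let $\mathcal{B}(\lambda,r)=[\lambda-r,\lambda+r]$ for $\lambda\in\mathbb{R}$ and $\mathcal{B}(\varepsilon,r)=\{\varepsilon\}$. Define $$W(A,\lambda)=\bigcap_{\bm{\zeta}\in Z}\lim_{\delta\to+0}\bigoplus_{\lambda'\in\mathcal{B}(\lambda,n\delta)}W(A(\bm{\zeta};\delta),\lambda',\mathcal{C}_{\lambda'}(\bm{\zeta};\delta)),$$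 where $\mathcal{C}_{\lambda'}(\bm{\zeta};\delta)$ is any $\lambda'$-maximal multi-circuit in $G(A(\bm{\zeta};\delta))$ (for small $\delta$ the space does not depend on this choice, and only finitely many $\lambda'$, the roots of $\chi_{A(\bm{\zeta};\delta)}$, give a space other than $\{\mathcal{E}\}$, so the sum is finite). Here $\lim_{\delta\to+0}S(\delta)$ is the set of $\bm{x}\in\mathbb{R}_{\max}^n$ for which there are $\bm{x}(\delta)\in S(\delta)$ with $\lim_{\delta\to+0}\bm{x}(\delta)=\bm{x}$ (usual topology of $\mathbb{R}\cup\{-\infty\}$). *)

theory Defs
  imports "HOL-Analysis.Analysis"
begin

text \<open>
  The max-plus semifield is the part of \<^typ>\<open>ereal\<close> different from \<open>\<infinity>\<close>, with
  \<open>\<epsilon> = -\<infinity>\<close>, \<open>\<oplus> = max\<close>, \<open>\<otimes> = +\<close> and unit \<open>0\<close>. Finite max-plus sums are suprema; the empty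
  one is \<open>-\<infinity>\<close>. The topology of \<^typ>\<open>ereal\<close> restricts to the usual one on \<open>[-\<infinity>, \<infinity>)\<close>.
\<close>

definition Rmax :: "ereal set" where
  "Rmax = {a. a \<noteq> \<infinity>}"

definition Rmax_vec :: "(ereal ^ 'n) set" where
  "Rmax_vec = {x. \<forall>i. x $ i \<in> Rmax}"

definition Rmax_mat :: "(ereal ^ 'n ^ 'm) set" where
  "Rmax_mat = {A. \<forall>i j. A $ i $ j \<in> Rmax}"


subsection \<open>Vectors and matrices\<close>

definition mp_scale :: "ereal \<Rightarrow> ereal ^ 'n \<Rightarrow> ereal ^ 'n" where
  "mp_scale c x = (\<chi> i. c + x $ i)"

definition mp_sum :: "'b set \<Rightarrow> ('b \<Rightarrow> ereal ^ 'n) \<Rightarrow> ereal ^ 'n" where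
  "mp_sum K f = (\<chi> i. SUP k\<in>K. f k $ i)"

definition mp_mat_add :: "ereal ^ 'n ^ 'm \<Rightarrow> ereal ^ 'n ^ 'm \<Rightarrow> ereal ^ 'n ^ 'm" where
  "mp_mat_add A B = (\<chi> i j. max (A $ i $ j) (B $ i $ j))"

definition mp_mat_scale :: "ereal \<Rightarrow> ereal ^ 'n ^ 'm \<Rightarrow> ereal ^ 'n ^ 'm" where
  "mp_mat_scale c A = (\<chi> i j. c + A $ i $ j)"

definition mp_mat_mult :: "ereal ^ 'n ^ 'm \<Rightarrow> ereal ^ 'p ^ 'n \<Rightarrow> ereal ^ 'p ^ 'm" where
  "mp_mat_mult A B = (\<chi> i j. SUP k. A $ i $ k + B $ k $ j)"

definition mp_mat_vec :: "ereal ^ 'n ^ 'm \<Rightarrow> ereal ^ 'n \<Rightarrow> ereal ^ 'm" where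
  "mp_mat_vec A x = (\<chi> i. SUP j. A $ i $ j + x $ j)"

definition mp_unit :: "ereal ^ 'n ^ 'n" where
  "mp_unit = (\<chi> i j. if i = j then 0 else -\<infinity>)"

definition mp_inverse :: "ereal ^ 'n ^ 'n \<Rightarrow> ereal ^ 'n ^ 'n" where
  "mp_inverse M =
     (THE N. N \<in> Rmax_mat \<and> mp_mat_mult M N = mp_unit \<and> mp_mat_mult N M = mp_unit)"

definition mp_det :: "ereal ^ 'n ^ 'n \<Rightarrow> ereal" where
  "mp_det A = (SUP p\<in>{p. p permutes UNIV}. \<Sum>i\<in>UNIV. A $ i $ p i)"

definition mp_charpoly :: "ereal ^ 'n ^ 'n \<Rightarrow> ereal \<Rightarrow> ereal" where
  "mp_charpoly A t = mp_det (mp_mat_add A (mp_mat_scale t mp_unit))"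

text \<open>
  The multiset \<open>R\<close> lists the roots with multiplicity, so the sum below is
  the factorization of \<open>\<chi>\<^sub>A\<close> into the max-plus factors \<open>t \<oplus> r\<close>, as a function on \<^const>\<open>Rmax\<close>.
\<close>
definition alg_eigenvalues :: "ereal ^ 'n ^ 'n \<Rightarrow> ereal set" where
  "alg_eigenvalues A =
     {r. \<exists>R. size R = CARD('n) \<and> set_mset R \<subseteq> Rmax \<and>
             (\<forall>t\<in>Rmax. mp_charpoly A t = (\<Sum>s\<in>#R. max t s)) \<and> r \<in># R}"


subsection \<open>Subspaces\<close>

definition mp_span :: "(ereal ^ 'n) set \<Rightarrow> (ereal ^ 'n) set" where
  "mp_span S =
     {mp_sum F (\<lambda>v. mp_scale (c v) v) |F c. finite F \<and> F \<subseteq> S \<and> (\<forall>v\<in>F. c v \<in> Rmax)}"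

definition mp_basis :: "(ereal ^ 'n) set \<Rightarrow> (ereal ^ 'n) set \<Rightarrow> bool" where
  "mp_basis B U \<longleftrightarrow> B \<subseteq> U \<and> mp_span B = U \<and> (\<forall>B'. B' \<subset> B \<longrightarrow> mp_span B' \<noteq> U)"

text \<open>
  The sum of a family of subspaces. For an infinite index set \<open>K\<close> its elements are the finite
  sums, so members of the family equal to \<open>{\<E>}\<close> contribute nothing.
\<close>
definition mp_space_sum :: "'b set \<Rightarrow> ('b \<Rightarrow> (ereal ^ 'n) set) \<Rightarrow> (ereal ^ 'n) set" where
  "mp_space_sum K U = {mp_sum F f |F f. finite F \<and> F \<subseteq> K \<and> (\<forall>k\<in>F. f k \<in> U k)}"


subsection \<open>Circuits\<close>

text \<open>
  Circuits and multi-circuits are represented by their sets of edges: this forgets the starting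
  vertex of a circuit, and the circuits of a multi-circuit can be recovered as its connected
  components. Hence \<^const>\<open>card\<close> is the length and \<^const>\<open>Field\<close> the set of vertices.
\<close>

definition graph_edges :: "ereal ^ 'n ^ 'n \<Rightarrow> ('n \<times> 'n) set" where
  "graph_edges A = {(i, j). A $ i $ j \<noteq> -\<infinity>}"

definition elementary_circuit :: "ereal ^ 'n ^ 'n \<Rightarrow> ('n \<times> 'n) set \<Rightarrow> bool" where
  "elementary_circuit A C \<longleftrightarrow>
     C \<subseteq> graph_edges A \<and>
     (\<exists>vs. vs \<noteq> [] \<and> distinct vs \<and> C = set (zip vs (rotate1 vs)))"

definition multi_circuit :: "ereal ^ 'n ^ 'n \<Rightarrow> ('n \<times> 'n) set \<Rightarrow> bool" where
  "multi_circuit A C \<longleftrightarrow>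
     (\<exists>\<F>. (\<forall>D\<in>\<F>. elementary_circuit A D) \<and>
          (\<forall>D\<in>\<F>. \<forall>D'\<in>\<F>. D \<noteq> D' \<longrightarrow> Field D \<inter> Field D' = {}) \<and>
          C = \<Union>\<F>)"

definition circuit_weight :: "ereal ^ 'n ^ 'n \<Rightarrow> ('n \<times> 'n) set \<Rightarrow> ereal" where
  "circuit_weight A C = (\<Sum>(i, j)\<in>C. A $ i $ j)"

definition average_weight :: "ereal ^ 'n ^ 'n \<Rightarrow> ('n \<times> 'n) set \<Rightarrow> ereal" where
  "average_weight A C = circuit_weight A C / ereal (real (card C))"

definition max_average_weight :: "ereal ^ 'n ^ 'n \<Rightarrow> ereal" where
  "max_average_weight A = (SUP C\<in>{C. elementary_circuit A C}. average_weight A C)"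

definition critical_circuit :: "ereal ^ 'n ^ 'n \<Rightarrow> ('n \<times> 'n) set \<Rightarrow> bool" where
  "critical_circuit A C \<longleftrightarrow>
     elementary_circuit A C \<and> average_weight A C = max_average_weight A"

definition real_maximal :: "ereal ^ 'n ^ 'n \<Rightarrow> real \<Rightarrow> ('n \<times> 'n) set \<Rightarrow> bool" where
  "real_maximal A \<mu> C \<longleftrightarrow>
     multi_circuit A C \<and>
     mp_charpoly A (ereal \<mu>) =
       circuit_weight A C + ereal ((real CARD('n) - real (card C)) * \<mu>)"

definition maximal_multi_circuit ::
    "ereal ^ 'n ^ 'n \<Rightarrow> ereal \<Rightarrow> ('n \<times> 'n) set \<Rightarrow> bool" where
  "maximal_multi_circuit A l C \<longleftrightarrow>
     (\<exists>\<mu>. l = ereal \<mu> \<and> real_maximal A \<mu> C) \<or>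
     (l = -\<infinity> \<and> (\<forall>\<^sub>F \<mu> in at_bot. real_maximal A \<mu> C))"

definition mat_on :: "ereal ^ 'n ^ 'n \<Rightarrow> ('n \<times> 'n) set \<Rightarrow> ereal ^ 'n ^ 'n" where
  "mat_on A C = (\<chi> i j. if (i, j) \<in> C then A $ i $ j else -\<infinity>)"

definition mat_off :: "ereal ^ 'n ^ 'n \<Rightarrow> ('n \<times> 'n) set \<Rightarrow> ereal ^ 'n ^ 'n" where
  "mat_off A C = (\<chi> i j. if (i, j) \<in> C then -\<infinity> else A $ i $ j)"

definition unit_on :: "('n \<times> 'n) set \<Rightarrow> ereal ^ 'n ^ 'n" where
  "unit_on C = (\<chi> i j. if i = j \<and> i \<in> Field C then 0 else -\<infinity>)"

definition unit_off :: "('n \<times> 'n) set \<Rightarrow> ereal ^ 'n ^ 'n" where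
  "unit_off C = (\<chi> i j. if i = j \<and> i \<notin> Field C then 0 else -\<infinity>)"

definition B_mat :: "ereal ^ 'n ^ 'n \<Rightarrow> ereal \<Rightarrow> ('n \<times> 'n) set \<Rightarrow> ereal ^ 'n ^ 'n" where
  "B_mat A l C =
     mp_mat_mult (mp_inverse (mp_mat_add (mat_on A C) (mp_mat_scale l (unit_off C))))
                 (mp_mat_add (mat_off A C) (mp_mat_scale l (unit_on C)))"

definition W_circuit :: "ereal ^ 'n ^ 'n \<Rightarrow> ereal \<Rightarrow> ('n \<times> 'n) set \<Rightarrow> (ereal ^ 'n) set" where
  "W_circuit A l C =
     {x\<in>Rmax_vec. mp_mat_vec (mp_mat_add (mat_off A C) (mp_mat_scale l (unit_on C))) x =
                  mp_mat_vec (mp_mat_add (mat_on A C) (mp_mat_scale l (unit_off C))) x}"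


subsection \<open>Algebraic eigenspaces\<close>

definition star_condition :: "ereal ^ 'n ^ 'n \<Rightarrow> bool" where
  "star_condition A \<longleftrightarrow>
     (\<forall>l\<in>Rmax. \<forall>C D. maximal_multi_circuit A l C \<and> maximal_multi_circuit A l D \<and> C \<noteq> D \<longrightarrow>
                     card C \<noteq> card D)"

definition perturb :: "ereal ^ 'n ^ 'n \<Rightarrow> real ^ 'n ^ 'n \<Rightarrow> real \<Rightarrow> ereal ^ 'n ^ 'n" where
  "perturb A \<zeta> \<delta> = (\<chi> i j. A $ i $ j - ereal (\<zeta> $ i $ j * \<delta>))"

definition generic_directions :: "ereal ^ 'n ^ 'n \<Rightarrow> (real ^ 'n ^ 'n) set" where
  "generic_directions A =
     {\<zeta>. (\<forall>i j. 0 \<le> \<zeta> $ i $ j \<and> \<zeta> $ i $ j \<le> 1) \<and>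
         (\<exists>\<delta>'>0. \<forall>\<delta>. 0 < \<delta> \<and> \<delta> < \<delta>' \<longrightarrow> star_condition (perturb A \<zeta> \<delta>))}"

text \<open>For \<open>l = -\<infinity>\<close> the interval below is \<open>{-\<infinity>}\<close>, because \<open>-\<infinity> \<plusminus> ereal r = -\<infinity>\<close>.\<close>
definition mp_ball :: "ereal \<Rightarrow> real \<Rightarrow> ereal set" where
  "mp_ball l r = {l - ereal r .. l + ereal r}"

text \<open>An arbitrary choice: the limit defining the eigenspace does not depend on it.\<close>
definition some_maximal :: "ereal ^ 'n ^ 'n \<Rightarrow> ereal \<Rightarrow> ('n \<times> 'n) set" where
  "some_maximal A l = (SOME C. maximal_multi_circuit A l C)"

definition limit_at_0 :: "(real \<Rightarrow> (ereal ^ 'n) set) \<Rightarrow> (ereal ^ 'n) set" where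
  "limit_at_0 S =
     {x\<in>Rmax_vec. \<exists>X. (\<forall>\<^sub>F \<delta> in at_right 0. X \<delta> \<in> S \<delta>) \<and> (X \<longlongrightarrow> x) (at_right 0)}"

definition alg_eigenspace :: "ereal ^ 'n ^ 'n \<Rightarrow> ereal \<Rightarrow> (ereal ^ 'n) set" where
  "alg_eigenspace A l =
     (\<Inter>\<zeta>\<in>generic_directions A.
        limit_at_0 (\<lambda>\<delta>.
          mp_space_sum (mp_ball l (real CARD('n) * \<delta>))
            (\<lambda>l'. W_circuit (perturb A \<zeta> \<delta>) l' (some_maximal (perturb A \<zeta> \<delta>) l'))))"

end

theory Submission
  imports Defs "HOL-Combinatorics.Cycles" "HOL-Library.Transitive_Closure_Table" "HOL-Library.Nat_Bijection"
begin

text \<open>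
  Row \<open>s\<close> of \<open>A \<oplus> l \<otimes> E\<close> has the terms \<open>l + x\<^sub>s\<close> and \<open>a\<^sub>s\<^sub>j + x\<^sub>j\<close>. A multi-circuit picks one term per
  row so that the columns are permuted, and its vectors are those whose row maximum is attained at the
  picked term and at another one. Edges between columns that jointly attain a row maximum of an
  eigenvector \<open>b\<close> form a digraph whose circuits are critical.
  By genericity of the perturbed matrices, every index in the support of \<open>b\<close> reaches in this digraph
  a circuit \<open>K\<close> that changes the length of the multi-circuit.

  Suppose \<open>b\<close> is a sum of eigenvectors \<open>x\<^sub>k\<close> for distinct eigenvalues and take \<open>K\<close> with minimal
  reachable set. Disjointness of critical circuits forces the row maxima along \<open>K\<close> to be attained at
  exactly two terms. If no index of \<open>K\<close> is covered by the summand for the eigenvalue \<open>l\<close> of \<open>b\<close> itself,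
  let \<open>G\<close> be the set of indices of \<open>K\<close> covered by summands for eigenvalues below \<open>l\<close>. The steps of
  \<open>K\<close> that remove, respectively insert, a diagonal term \<open>l + x\<^sub>s\<close> are exactly the steps leaving,
  respectively entering, \<open>G\<close>; there are equally many of both, so \<open>K\<close> does not change the length, a
  contradiction. Hence \<open>x\<^sub>l\<close> agrees with \<open>b\<close> on \<open>K\<close>, and following the digraph backwards gives
  \<open>x\<^sub>l = b\<close>. For \<open>l = \<epsilon>\<close> the circuits \<open>K\<close> are replaced by vertices outside the multi-circuit.
\<close>


subsection \<open>Selections of terms\<close>

text \<open>An eigenvector is known only through limits of sums over nearby values of
  \<open>l\<close>. On a subsequence each coordinate is carried by one summand with one fixed
  multi-circuit. So each index \<open>i\<close> comes with a limit \<open>y\<close> below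
  \<open>x\<close> that satisfies \<open>y $ i = x $ i\<close>, and different indices may come with
  different multi-circuits. Statements about \<open>x\<close> must therefore not depend on the
  multi-circuit. For real \<open>l\<close> this is achieved by showing that all optimal selections
  agree on domination and on reachability along tight edges. For \<open>l = -\<infinity>\<close> a
  selection using \<open>None\<close> is not even supported; there the ball is a point, and one
  multi-circuit can serve all vectors.

  Limits keep row maxima and their being attained twice, but they may create new ties. The star
  condition holds only before the limit. Its effect survives because it is expressed by finitely
  many choice functions \<open>\<kappa>\<close>, one of which recurs infinitely often.

  The equality of \<open>b\<close> with its own component gives the basis property: if
  \<open>b\<close> were redundant in the union, sorting its representation by eigenvalue would make
  it redundant in its own basis.\<close>

text \<open>Term \<^term>\<open>None\<close> of a row is the diagonal term \<open>l + x\<^sub>s\<close>, term \<^term>\<open>Some j\<close> is \<open>a\<^sub>s\<^sub>j + x\<^sub>j\<close>.\<close>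
definition target :: "'n \<Rightarrow> 'n option \<Rightarrow> 'n" where
  "target s c = (case c of None \<Rightarrow> s | Some j \<Rightarrow> j)"

definition coef :: "ereal ^ 'n ^ 'n \<Rightarrow> ereal \<Rightarrow> 'n \<Rightarrow> 'n option \<Rightarrow> ereal" where
  "coef A l s c = (case c of None \<Rightarrow> l | Some j \<Rightarrow> A $ s $ j)"

definition val :: "ereal ^ 'n ^ 'n \<Rightarrow> ereal \<Rightarrow> ereal ^ 'n \<Rightarrow> 'n \<Rightarrow> 'n option \<Rightarrow> ereal" where
  "val A l x s c = coef A l s c + x $ target s c"

text \<open>A selection is a permutation together with a choice, at each fixed point
  \<open>s\<close>, between the loop \<open>Some s\<close> and the diagonal term
  \<open>None\<close>. It encodes a multi-circuit: rows with \<open>Some\<close> are its vertices,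
  rows with \<open>None\<close> are the vertices it misses.\<close>

definition selection :: "('n \<Rightarrow> 'n option) \<Rightarrow> bool" where
  "selection \<tau> \<longleftrightarrow> bij (\<lambda>s. target s (\<tau> s))"

definition row_of :: "('n \<Rightarrow> 'n option) \<Rightarrow> 'n \<Rightarrow> 'n" where
  "row_of \<tau> j = inv (\<lambda>s. target s (\<tau> s)) j"

definition supported :: "ereal ^ 'n ^ 'n \<Rightarrow> ereal \<Rightarrow> ('n \<Rightarrow> 'n option) \<Rightarrow> bool" where
  "supported A l \<tau> \<longleftrightarrow> (\<forall>s. coef A l s (\<tau> s) \<noteq> -\<infinity>)"

text \<open>For a supported selection this is the weight of the multi-circuit plus \<open>l\<close>
  times the number of vertices it misses. Infinite coefficients are turned into 0 by
  \<open>real_of_ereal\<close>, so the value is meaningful for supported selections only.\<close>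

definition weight :: "ereal ^ 'n ^ 'n \<Rightarrow> ereal \<Rightarrow> ('n \<Rightarrow> 'n option) \<Rightarrow> real" where
  "weight A l \<tau> = (\<Sum>s\<in>UNIV. real_of_ereal (coef A l s (\<tau> s)))"

definition optimal :: "ereal ^ 'n ^ 'n \<Rightarrow> ereal \<Rightarrow> ('n \<Rightarrow> 'n option) \<Rightarrow> bool" where
  "optimal A l \<tau> \<longleftrightarrow> selection \<tau> \<and> supported A l \<tau> \<and>
     (\<forall>\<rho>. selection \<rho> \<and> supported A l \<rho> \<longrightarrow> weight A l \<rho> \<le> weight A l \<tau>)"

definition dominates ::
    "ereal ^ 'n ^ 'n \<Rightarrow> ereal \<Rightarrow> ('n \<Rightarrow> 'n option) \<Rightarrow> ereal ^ 'n \<Rightarrow> bool" where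
  "dominates A l \<tau> x \<longleftrightarrow> (\<forall>s c. val A l x s c \<le> val A l x s (\<tau> s))"

text \<open>Rows are addressed by the column that \<open>\<tau>\<close> picks in them, because
  \<open>B_mat\<close> is indexed by columns on both sides. The choice functions
  \<open>\<kappa>\<close> follow the same convention.\<close>

definition tight_at ::
    "ereal ^ 'n ^ 'n \<Rightarrow> ereal \<Rightarrow> ('n \<Rightarrow> 'n option) \<Rightarrow> ereal ^ 'n \<Rightarrow> 'n \<Rightarrow> 'n option \<Rightarrow> bool" where
  "tight_at A l \<tau> x j c \<longleftrightarrow> c \<noteq> \<tau> (row_of \<tau> j) \<and>
     val A l x (row_of \<tau> j) c = val A l x (row_of \<tau> j) (\<tau> (row_of \<tau> j)) \<and> val A l x (row_of \<tau> j) c \<noteq> -\<infinity>"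

definition succ :: "('n \<Rightarrow> 'n option) \<Rightarrow> ('n \<Rightarrow> 'n option) \<Rightarrow> 'n \<Rightarrow> 'n" where
  "succ \<tau> \<kappa> j = target (row_of \<tau> j) (\<kappa> j)"

text \<open>For real \<open>l\<close>, optimal \<open>\<tau>\<close> and dominated \<open>x\<close>
  these are edges of the graph of \<open>B_mat\<close>, of weight \<open>x $ j - x $ m\<close>; the
  vector acts as a potential.\<close>

definition tight ::
    "ereal ^ 'n ^ 'n \<Rightarrow> ereal \<Rightarrow> ('n \<Rightarrow> 'n option) \<Rightarrow> ereal ^ 'n \<Rightarrow> ('n \<times> 'n) set" where
  "tight A l \<tau> x = {(j, target (row_of \<tau> j) c) |j c. tight_at A l \<tau> x j c}"

text \<open>For a cycle \<open>K\<close> of \<open>succ\<close> this is the alternating-cycle move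
  of the assignment problem.\<close>

definition exchange ::
    "('n \<Rightarrow> 'n option) \<Rightarrow> ('n \<Rightarrow> 'n option) \<Rightarrow> 'n set \<Rightarrow> 'n \<Rightarrow> 'n option" where
  "exchange \<tau> \<kappa> K s = (if target s (\<tau> s) \<in> K then \<kappa> (target s (\<tau> s)) else \<tau> s)"

lemma target_simps [simp]: "target s None = s" "target s (Some j) = j"
  by (simp_all add: target_def)

lemma coef_simps [simp]: "coef A l s None = l" "coef A l s (Some j) = A $ s $ j"
  by (simp_all add: coef_def)

lemma target_row [simp]: "selection \<tau> \<Longrightarrow> target (row_of \<tau> j) (\<tau> (row_of \<tau> j)) = j"
  unfolding selection_def row_of_def by (metis bij_inv_eq_iff)

lemma row_target [simp]: "selection \<tau> \<Longrightarrow> row_of \<tau> (target s (\<tau> s)) = s"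
  unfolding selection_def row_of_def by (metis bij_inv_eq_iff)

lemma bij_row: "selection \<tau> \<Longrightarrow> bij (row_of \<tau>)"
  unfolding selection_def row_of_def by (simp add: bij_imp_bij_inv)

lemma row_None: "selection \<tau> \<Longrightarrow> \<tau> j = None \<Longrightarrow> row_of \<tau> j = j"
  by (metis row_target target_simps(1))

lemma row_None': "selection \<tau> \<Longrightarrow> \<tau> (row_of \<tau> j) = None \<Longrightarrow> row_of \<tau> j = j"
  by (metis target_row target_simps(1))

lemma coef_not_PInf: "A \<in> Rmax_mat \<Longrightarrow> l \<noteq> \<infinity> \<Longrightarrow> coef A l s c \<noteq> \<infinity>"
  by (cases c) (auto simp: Rmax_mat_def Rmax_def)

lemma Rmax_vec_not_PInf: "x \<in> Rmax_vec \<Longrightarrow> x $ i \<noteq> \<infinity>"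
  by (auto simp: Rmax_vec_def Rmax_def)

lemma ereal_finite: "y \<noteq> -\<infinity> \<Longrightarrow> y \<noteq> \<infinity> \<Longrightarrow> y = ereal (real_of_ereal y)"
  by (cases y) auto

lemma coef_real:
  assumes "A \<in> Rmax_mat" "l \<noteq> \<infinity>" "coef A l s c \<noteq> -\<infinity>"
  shows "coef A l s c = ereal (real_of_ereal (coef A l s c))"
  by (rule ereal_finite[OF assms(3) coef_not_PInf[OF assms(1,2)]])

lemma val_not_PInf: "A \<in> Rmax_mat \<Longrightarrow> l \<noteq> \<infinity> \<Longrightarrow> x \<in> Rmax_vec \<Longrightarrow> val A l x s c \<noteq> \<infinity>"
  by (simp add: val_def coef_not_PInf Rmax_vec_not_PInf)

lemma val_finite_iff:
  assumes "A \<in> Rmax_mat" "l \<noteq> \<infinity>" "x \<in> Rmax_vec"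
  shows "val A l x s c \<noteq> -\<infinity> \<longleftrightarrow> coef A l s c \<noteq> -\<infinity> \<and> x $ target s c \<noteq> -\<infinity>"
  using coef_not_PInf[OF assms(1,2), of s c] Rmax_vec_not_PInf[OF assms(3), of "target s c"]
  unfolding val_def by (cases "coef A l s c"; cases "x $ target s c") auto

lemma exchange_target:
  assumes "selection \<tau>" 
  shows "target s (exchange \<tau> \<kappa> K s) =
    (if target s (\<tau> s) \<in> K then succ \<tau> \<kappa> (target s (\<tau> s)) else target s (\<tau> s))"
  using assms by (auto simp: exchange_def succ_def)

lemma selection_exchange:
  fixes \<tau> :: "'n::finite \<Rightarrow> 'n option"
  assumes "selection \<tau>" "bij_betw (succ \<tau> \<kappa>) K K"
  shows "selection (exchange \<tau> \<kappa> K)"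
proof -
  define g where "g j = (if j \<in> K then succ \<tau> \<kappa> j else j)" for j
  have "inj g"
    using assms(2) unfolding inj_def g_def bij_betw_def inj_on_def by (metis image_eqI)
  hence "bij g" by (simp add: finite_UNIV_inj_surj bij_def)
  moreover have "(\<lambda>s. target s (exchange \<tau> \<kappa> K s)) = g \<circ> (\<lambda>s. target s (\<tau> s))"
    using exchange_target[OF assms(1)] by (auto simp: g_def)
  ultimately show ?thesis using assms(1) unfolding selection_def by (metis bij_comp)
qed

lemma sum_over_columns:
  fixes \<tau> :: "'n::finite \<Rightarrow> 'n option" and g :: "'n \<Rightarrow> 'a::comm_monoid_add"
  assumes "selection \<tau>"
  shows "(\<Sum>s\<in>UNIV. g s) = (\<Sum>j\<in>UNIV. g (row_of \<tau> j))"
  using sum.reindex_bij_betw[OF bij_row[OF assms], of g] by simp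

lemma exchange_row:
  "selection \<tau> \<Longrightarrow> exchange \<tau> \<kappa> K (row_of \<tau> j) = (if j \<in> K then \<kappa> j else \<tau> (row_of \<tau> j))"
  by (simp add: exchange_def)

lemma weight_exchange:
  fixes A :: "ereal ^ 'n ^ 'n"
  assumes "selection \<tau>"
  shows "weight A l (exchange \<tau> \<kappa> K) = weight A l \<tau> +
    (\<Sum>j\<in>K. real_of_ereal (coef A l (row_of \<tau> j) (\<kappa> j)) -
             real_of_ereal (coef A l (row_of \<tau> j) (\<tau> (row_of \<tau> j))))"
proof -
  have "weight A l (exchange \<tau> \<kappa> K) = (\<Sum>j\<in>UNIV. real_of_ereal (coef A l (row_of \<tau> j) (\<tau> (row_of \<tau> j))) +
     (if j \<in> K then real_of_ereal (coef A l (row_of \<tau> j) (\<kappa> j)) -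
             real_of_ereal (coef A l (row_of \<tau> j) (\<tau> (row_of \<tau> j))) else 0))"
    unfolding weight_def by (subst sum_over_columns[OF assms], rule sum.cong) (auto simp: exchange_row[OF assms])
  also have "\<dots> = weight A l \<tau> + (\<Sum>j\<in>UNIV. if j \<in> K then real_of_ereal (coef A l (row_of \<tau> j) (\<kappa> j)) -
             real_of_ereal (coef A l (row_of \<tau> j) (\<tau> (row_of \<tau> j))) else 0)"
    unfolding sum.distrib weight_def by (subst (2) sum_over_columns[OF assms]) simp
  also have "(\<Sum>j\<in>UNIV. if j \<in> K then real_of_ereal (coef A l (row_of \<tau> j) (\<kappa> j)) -
             real_of_ereal (coef A l (row_of \<tau> j) (\<tau> (row_of \<tau> j))) else 0) = 
    (\<Sum>j\<in>K. real_of_ereal (coef A l (row_of \<tau> j) (\<kappa> j)) -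
             real_of_ereal (coef A l (row_of \<tau> j) (\<tau> (row_of \<tau> j))))"
    by (simp add: sum.If_cases)
  finally show ?thesis .
qed

lemma supported_exchange:
  assumes "selection \<tau>" "supported A l \<tau>" "\<And>j. j \<in> K \<Longrightarrow> coef A l (row_of \<tau> j) (\<kappa> j) \<noteq> -\<infinity>"
  shows "supported A l (exchange \<tau> \<kappa> K)"
  using assms unfolding supported_def exchange_def by (metis row_target)

text \<open>A finite tie makes all four numbers involved real. The last part then rewrites a
  difference of coefficients as a difference of potentials.\<close>

lemma tight_at_target:
  assumes "A \<in> Rmax_mat" "l \<noteq> \<infinity>" "x \<in> Rmax_vec" "selection \<tau>" "tight_at A l \<tau> x j c"
  shows "coef A l (row_of \<tau> j) c \<noteq> -\<infinity>" "coef A l (row_of \<tau> j) (\<tau> (row_of \<tau> j)) \<noteq> -\<infinity>"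
    "x $ j \<noteq> -\<infinity>" "x $ target (row_of \<tau> j) c \<noteq> -\<infinity>"
    "real_of_ereal (coef A l (row_of \<tau> j) c) - real_of_ereal (coef A l (row_of \<tau> j) (\<tau> (row_of \<tau> j))) =
     real_of_ereal (x $ j) - real_of_ereal (x $ target (row_of \<tau> j) c)"
proof -
  have v: "val A l x (row_of \<tau> j) c \<noteq> -\<infinity>" "val A l x (row_of \<tau> j) (\<tau> (row_of \<tau> j)) \<noteq> -\<infinity>"
    and e: "val A l x (row_of \<tau> j) c = val A l x (row_of \<tau> j) (\<tau> (row_of \<tau> j))"
    using assms(5) unfolding tight_at_def by auto
  show c: "coef A l (row_of \<tau> j) c \<noteq> -\<infinity>" "coef A l (row_of \<tau> j) (\<tau> (row_of \<tau> j)) \<noteq> -\<infinity>"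
    "x $ j \<noteq> -\<infinity>" "x $ target (row_of \<tau> j) c \<noteq> -\<infinity>"
    using v val_finite_iff[OF assms(1-3)] target_row[OF assms(4)] by metis+
  note q = coef_real[OF assms(1,2) c(1)] coef_real[OF assms(1,2) c(2)]
  note r = ereal_finite[OF c(3) Rmax_vec_not_PInf[OF assms(3)]] ereal_finite[OF c(4) Rmax_vec_not_PInf[OF assms(3)]]
  have "ereal (real_of_ereal (coef A l (row_of \<tau> j) c) + real_of_ereal (x $ target (row_of \<tau> j) c)) =
        ereal (real_of_ereal (coef A l (row_of \<tau> j) (\<tau> (row_of \<tau> j))) + real_of_ereal (x $ j))"
    using e q r target_row[OF assms(4), of j] unfolding val_def by (metis plus_ereal.simps(1))
  thus "real_of_ereal (coef A l (row_of \<tau> j) c) - real_of_ereal (coef A l (row_of \<tau> j) (\<tau> (row_of \<tau> j))) =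
     real_of_ereal (x $ j) - real_of_ereal (x $ target (row_of \<tau> j) c)" by simp
qed

text \<open>In potential form the sum runs over \<open>x $ j\<close> minus \<open>x\<close> at the
  successor of \<open>j\<close>; it cancels because \<open>succ\<close> permutes
  \<open>K\<close>.\<close>

lemma exchange_tight:
  fixes A :: "ereal ^ 'n ^ 'n"
  assumes "A \<in> Rmax_mat" "l \<noteq> \<infinity>" "x \<in> Rmax_vec" "selection \<tau>"
    "\<And>j. j \<in> K \<Longrightarrow> tight_at A l \<tau> x j (\<kappa> j)" "bij_betw (succ \<tau> \<kappa>) K K"
  shows "(\<Sum>j\<in>K. real_of_ereal (coef A l (row_of \<tau> j) (\<kappa> j)) -
             real_of_ereal (coef A l (row_of \<tau> j) (\<tau> (row_of \<tau> j)))) = 0"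
    "weight A l (exchange \<tau> \<kappa> K) = weight A l \<tau>"
proof -
  have "(\<Sum>j\<in>K. real_of_ereal (coef A l (row_of \<tau> j) (\<kappa> j)) -
             real_of_ereal (coef A l (row_of \<tau> j) (\<tau> (row_of \<tau> j)))) =
        (\<Sum>j\<in>K. real_of_ereal (x $ j) - real_of_ereal (x $ succ \<tau> \<kappa> j))"
    by (rule sum.cong) (auto simp: succ_def tight_at_target(5)[OF assms(1-4) assms(5)])
  also have "\<dots> = 0"
    using sum.reindex_bij_betw[OF assms(6), of "\<lambda>j. real_of_ereal (x $ j)"]
    by (simp add: sum_subtractf)
  finally show *: "(\<Sum>j\<in>K. real_of_ereal (coef A l (row_of \<tau> j) (\<kappa> j)) -
             real_of_ereal (coef A l (row_of \<tau> j) (\<tau> (row_of \<tau> j)))) = 0" .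
  show "weight A l (exchange \<tau> \<kappa> K) = weight A l \<tau>"
    using weight_exchange[OF assms(4), of A l \<kappa> K] * by simp
qed

lemma optimal_exchange:
  fixes A :: "ereal ^ 'n ^ 'n"
  assumes "A \<in> Rmax_mat" "l \<noteq> \<infinity>" "x \<in> Rmax_vec" "optimal A l \<tau>"
    "\<And>j. j \<in> K \<Longrightarrow> tight_at A l \<tau> x j (\<kappa> j)" "bij_betw (succ \<tau> \<kappa>) K K"
  shows "optimal A l (exchange \<tau> \<kappa> K)"
proof -
  have sel: "selection \<tau>" and sup: "supported A l \<tau>" using assms(4) by (auto simp: optimal_def)
  have "supported A l (exchange \<tau> \<kappa> K)"
    by (rule supported_exchange[OF sel sup tight_at_target(1)[OF assms(1-3) sel assms(5)]])
  thus ?thesis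
    using selection_exchange[OF sel assms(6)] exchange_tight(2)[OF assms(1-3) sel assms(5,6)] assms(4)
    unfolding optimal_def by simp
qed

subsection \<open>Independence of the optimal selection\<close>

text \<open>
  \<open>\<tau>\<close> and \<open>\<rho>\<close> match the same rows with the support of \<open>x\<close>, so replacing \<open>\<tau>\<close> by \<open>\<rho>\<close> on these rows gives
  a selection; optimality of \<open>\<tau>\<close> then forces equality of all row maxima.
\<close>
lemma dominates_optimal:
  fixes A :: "ereal ^ 'n ^ 'n"
  assumes A: "A \<in> Rmax_mat" and l: "l \<noteq> \<infinity>" and x: "x \<in> Rmax_vec"
    and opt: "optimal A l \<tau>" and sel: "selection \<rho>" "supported A l \<rho>"
    and dom: "dominates A l \<rho> x"
  shows "dominates A l \<tau> x"
proof -
  have selt: "selection \<tau>" "supported A l \<tau>" using opt by (auto simp: optimal_def)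
  define \<sigma> where "\<sigma> s = target s (\<tau> s)" for s
  define \<sigma>' where "\<sigma>' s = target s (\<rho> s)" for s
  have bij: "bij \<sigma>" "bij \<sigma>'"
    using selt(1) sel(1) unfolding selection_def \<sigma>_def \<sigma>'_def by simp_all
  define S where "S = {j. x $ j \<noteq> -\<infinity>}"
  define R where "R = \<sigma>' -` S"
  have cardeq: "card (\<sigma> -` S) = card S" "card R = card S"
    unfolding R_def using bij by (auto intro!: card_vimage_inj simp: bij_def)
  have le: "val A l x s (\<tau> s) \<le> val A l x s (\<rho> s)" for s
    using dom by (simp add: dominates_def)
  have out: "val A l x s (\<rho> s) = -\<infinity>" if "s \<notin> R" for s
    using that val_finite_iff[OF A l x, of s "\<rho> s"] by (auto simp: R_def S_def \<sigma>'_def)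
  have "\<sigma> -` S \<subseteq> R"
  proof
    fix s assume s: "s \<in> \<sigma> -` S"
    show "s \<in> R"
    proof (rule ccontr)
      assume "s \<notin> R"
      hence "val A l x s (\<tau> s) = -\<infinity>" using out le[of s] by simp
      thus False using s selt(2) val_finite_iff[OF A l x, of s "\<tau> s"]
        by (auto simp: S_def \<sigma>_def supported_def)
    qed
  qed
  hence RS: "\<sigma> -` S = R" using cardeq by (metis card_subset_eq finite)
  define \<mu> where "\<mu> s = (if s \<in> R then \<rho> s else \<tau> s)" for s
  have "inj (\<lambda>s. target s (\<mu> s))"
  proof (rule injI)
    fix s t assume eq: "target s (\<mu> s) = target t (\<mu> t)"
    have in1: "\<sigma> u \<in> S \<longleftrightarrow> u \<in> R" "\<sigma>' u \<in> S \<longleftrightarrow> u \<in> R" for u using RS R_def by auto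
    have m: "target u (\<mu> u) = (if u \<in> R then \<sigma>' u else \<sigma> u)" for u
      by (simp add: \<mu>_def \<sigma>_def \<sigma>'_def)
    show "s = t"
      using eq in1[of s] in1[of t] bij unfolding m bij_def inj_def by (metis (full_types))
  qed
  hence "selection \<mu>" unfolding selection_def by (simp add: bij_def finite_UNIV_inj_surj)
  moreover have "supported A l \<mu>" using sel(2) selt(2) by (auto simp: supported_def \<mu>_def)
  ultimately have wle: "weight A l \<mu> \<le> weight A l \<tau>" using opt by (auto simp: optimal_def)
  define w where "w \<phi> s = real_of_ereal (coef A l s (\<phi> s))" for \<phi> s
  have split: "(\<Sum>s\<in>UNIV. g s) = (\<Sum>s\<in>R. g s) + (\<Sum>s\<in>-R. g s)" for g :: "'n \<Rightarrow> real"
    using sum.union_disjoint[of R "-R" g] by (simp add: Compl_partition)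
  have "weight A l \<mu> = (\<Sum>s\<in>R. w \<rho> s) + (\<Sum>s\<in>-R. w \<tau> s)"
    unfolding weight_def split by (auto simp: w_def \<mu>_def intro!: arg_cong2[where f="(+)"] sum.cong)
  moreover have "weight A l \<tau> = (\<Sum>s\<in>R. w \<tau> s) + (\<Sum>s\<in>-R. w \<tau> s)"
    unfolding weight_def split by (simp add: w_def)
  ultimately have wR: "(\<Sum>s\<in>R. w \<rho> s) \<le> (\<Sum>s\<in>R. w \<tau> s)" using wle by simp
  define u where "u j = real_of_ereal (x $ j)" for j
  have "bij_betw g (g -` S) S" if "bij g" for g :: "'n \<Rightarrow> 'n"
    using that unfolding bij_betw_def by (metis inj_on_subset subset_UNIV surj_image_vimage_eq)
  from this[OF bij(1)] this[OF bij(2)] have "bij_betw \<sigma> R S" "bij_betw \<sigma>' R S"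
    using RS R_def by simp_all
  hence uR: "(\<Sum>s\<in>R. u (\<sigma> s)) = (\<Sum>s\<in>R. u (\<sigma>' s))"
    using sum.reindex_bij_betw[of \<sigma> R S u] sum.reindex_bij_betw[of \<sigma>' R S u] by simp
  have fin: "val A l x s (\<phi> s) = ereal (w \<phi> s + u (target s (\<phi> s)))"
    if "supported A l \<phi>" "x $ target s (\<phi> s) \<noteq> -\<infinity>" for \<phi> s
  proof -
    have "coef A l s (\<phi> s) = ereal (w \<phi> s)" unfolding w_def
      by (rule coef_real[OF A l]) (use that in \<open>auto simp: supported_def\<close>)
    moreover have "x $ target s (\<phi> s) = ereal (u (target s (\<phi> s)))"
      unfolding u_def by (rule ereal_finite[OF that(2) Rmax_vec_not_PInf[OF x]])
    ultimately show ?thesis by (simp add: val_def)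
  qed
  have fins: "val A l x s (\<tau> s) = ereal (w \<tau> s + u (\<sigma> s))"
     "val A l x s (\<rho> s) = ereal (w \<rho> s + u (\<sigma>' s))" if "s \<in> R" for s
    using fin[OF selt(2), of s] fin[OF sel(2), of s] that RS
    by (auto simp: R_def S_def \<sigma>_def \<sigma>'_def)
  have nonneg: "0 \<le> (w \<rho> s + u (\<sigma>' s)) - (w \<tau> s + u (\<sigma> s))" if "s \<in> R" for s
    using le[of s] fins[OF that] by simp
  \<comment> \<open>Both selections map \<open>R\<close> bijectively onto the support, so the
    potentials cancel and only the comparison of weights on \<open>R\<close> remains. Nonnegative
    terms with nonpositive sum vanish.\<close>
  have "(\<Sum>s\<in>R. (w \<rho> s + u (\<sigma>' s)) - (w \<tau> s + u (\<sigma> s))) \<le> 0"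
    using wR uR by (simp add: sum.distrib sum_subtractf)
  hence "(\<Sum>s\<in>R. (w \<rho> s + u (\<sigma>' s)) - (w \<tau> s + u (\<sigma> s))) = 0"
    using nonneg by (simp add: sum_nonneg antisym)
  hence "\<forall>s\<in>R. (w \<rho> s + u (\<sigma>' s)) - (w \<tau> s + u (\<sigma> s)) = 0"
    using nonneg by (subst (asm) sum_nonneg_eq_0_iff) auto
  hence eq: "val A l x s (\<tau> s) = val A l x s (\<rho> s)" for s
  proof (cases "s \<in> R")
    case True
    thus ?thesis using \<open>\<forall>s\<in>R. _ = 0\<close> fins[OF True] by simp
  next
    case False
    thus ?thesis using out[OF False] le[of s] by simp
  qed
  show ?thesis using dom by (simp add: dominates_def eq)
qed

section \<open>Orbits of self-maps of a finite type\<close>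

definition orbit_from :: "('a \<Rightarrow> 'a) \<Rightarrow> 'a \<Rightarrow> 'a set" where
  "orbit_from f k = range (\<lambda>n. (f ^^ n) k)"

lemma eventually_periodic:
  fixes f :: "'a::finite \<Rightarrow> 'a"
  obtains m p where "p > 0" "(f ^^ p) ((f ^^ m) i) = (f ^^ m) i"
proof -
  have "\<not> inj (\<lambda>n::nat. (f ^^ n) i)"
    using finite_imageD[of "\<lambda>n::nat. (f ^^ n) i" UNIV] by auto
  then obtain a b :: nat where ab: "a \<noteq> b" "(f ^^ a) i = (f ^^ b) i" by (auto simp: inj_def)
  have "\<exists>m p. p > 0 \<and> (f ^^ (p + m)) i = (f ^^ m) i"
  proof (cases "a < b")
    case True
    thus ?thesis using ab by (intro exI[of _ a] exI[of _ "b - a"]) simp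
  next
    case False
    thus ?thesis using ab by (intro exI[of _ b] exI[of _ "a - b"]) simp
  qed
  thus thesis using that by (auto simp: funpow_add)
qed

lemma orbit_from_self: "k \<in> orbit_from f k"
  unfolding orbit_from_def by (metis funpow_0 rangeI)

lemma orbit_from_step: "j \<in> orbit_from f k \<Longrightarrow> f j \<in> orbit_from f k"
  unfolding orbit_from_def by (auto simp flip: funpow.simps(2) comp_apply[of f] intro: rangeI)

lemma orbit_from_bij:
  fixes f :: "'a::finite \<Rightarrow> 'a"
  assumes "p > 0" "(f ^^ p) k = k"
  shows "bij_betw f (orbit_from f k) (orbit_from f k)"
proof -
  have "orbit_from f k \<subseteq> f ` orbit_from f k"
  proof
    fix j assume "j \<in> orbit_from f k"
    then obtain m where m: "j = (f ^^ m) k" by (auto simp: orbit_from_def)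
    have "(f ^^ (m + p)) k = j" using assms(2) m by (simp add: funpow_add)
    moreover have "m + p = Suc (m + p - 1)" using assms(1) by simp
    ultimately have "f ((f ^^ (m + p - 1)) k) = j" by (metis comp_apply funpow.simps(2))
    thus "j \<in> f ` orbit_from f k" unfolding orbit_from_def by blast
  qed
  moreover have "f ` orbit_from f k \<subseteq> orbit_from f k" using orbit_from_step by auto
  ultimately have "f ` orbit_from f k = orbit_from f k" by auto
  thus ?thesis unfolding bij_betw_def by (metis eq_card_imp_inj_on finite)
qed

lemma tight_finite:
  assumes "A \<in> Rmax_mat" "l \<noteq> \<infinity>" "x \<in> Rmax_vec" "selection \<tau>" "(j, m) \<in> tight A l \<tau> x"
  shows "x $ j \<noteq> -\<infinity>" "x $ m \<noteq> -\<infinity>"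
  using assms(5) tight_at_target(3,4)[OF assms(1-4)] unfolding tight_def by auto

text \<open>
  Both selections take their terms at row maxima, so the permutation \<open>\<pi>\<close> leading from one to the other
  runs along tight edges and can be undone because it has finite order.
\<close>
lemma tight_rtrancl_subset:
  fixes A :: "ereal ^ 'n ^ 'n"
  assumes A: "A \<in> Rmax_mat" and l: "l \<noteq> \<infinity>" and x: "x \<in> Rmax_vec"
    and sel: "selection \<tau>" "supported A l \<tau>" "selection \<rho>" 
    and dom: "dominates A l \<tau> x" "dominates A l \<rho> x"
  shows "(tight A l \<rho> x)\<^sup>* \<subseteq> (tight A l \<tau> x)\<^sup>*"
proof -
  have eq: "val A l x s (\<rho> s) = val A l x s (\<tau> s)" for s
    using dom unfolding dominates_def by (meson antisym)
  define \<pi> where "\<pi> k = target (row_of \<tau> k) (\<rho> (row_of \<tau> k))" for k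
  have "\<pi> = (\<lambda>s. target s (\<rho> s)) \<circ> row_of \<tau>" by (auto simp: \<pi>_def)
  hence "bij \<pi>" using bij_row[OF sel(1)] sel(3) unfolding selection_def by (simp add: bij_comp)
  have step: "(k, \<pi> k) \<in> (tight A l \<tau> x)\<^sup>* \<and> x $ \<pi> k \<noteq> -\<infinity>" if k: "x $ k \<noteq> -\<infinity>" for k
  proof (cases "\<rho> (row_of \<tau> k) = \<tau> (row_of \<tau> k)")
    case True
    thus ?thesis using k target_row[OF sel(1), of k] by (simp add: \<pi>_def)
  next
    case False
    have "coef A l (row_of \<tau> k) (\<tau> (row_of \<tau> k)) \<noteq> -\<infinity>" using sel(2) by (simp add: supported_def)
    hence "val A l x (row_of \<tau> k) (\<tau> (row_of \<tau> k)) \<noteq> -\<infinity>"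
      using k val_finite_iff[OF A l x] target_row[OF sel(1), of k] by simp
    hence "tight_at A l \<tau> x k (\<rho> (row_of \<tau> k))" using False eq by (simp add: tight_at_def)
    hence "(k, \<pi> k) \<in> tight A l \<tau> x" unfolding tight_def \<pi>_def by blast
    thus ?thesis using tight_finite(2)[OF A l x sel(1)] by blast
  qed
  have iter: "(k, (\<pi> ^^ n) k) \<in> (tight A l \<tau> x)\<^sup>* \<and> x $ (\<pi> ^^ n) k \<noteq> -\<infinity>" if k: "x $ k \<noteq> -\<infinity>" for k n
    using k by (induction n) (auto dest: step)
  have rev_step: "(\<pi> k, k) \<in> (tight A l \<tau> x)\<^sup>*" if k: "x $ k \<noteq> -\<infinity>" for k
  proof -
    obtain m p where p: "p > 0" "(\<pi> ^^ p) ((\<pi> ^^ m) k) = (\<pi> ^^ m) k" by (rule eventually_periodic)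
    hence "(\<pi> ^^ m) ((\<pi> ^^ p) k) = (\<pi> ^^ m) k" by (metis add.commute comp_apply funpow_add)
    hence "(\<pi> ^^ p) k = k" by (rule injD[OF inj_fn[OF bij_is_inj[OF \<open>bij \<pi>\<close>], of m]])
    hence "(\<pi> ^^ (p - 1)) (\<pi> k) = k" using p(1) by (metis Suc_diff_1 comp_apply funpow_Suc_right)
    thus ?thesis using iter[of "\<pi> k" "p - 1"] step[OF k] by auto
  qed
  have "(j, m) \<in> (tight A l \<tau> x)\<^sup>*" if jm: "(j, m) \<in> tight A l \<rho> x" for j m
  proof -
    define s where "s = row_of \<rho> j"
    obtain c where c: "tight_at A l \<rho> x j c" "target s c = m"
      using jm unfolding tight_def s_def by auto
    \<comment> \<open>The row of the edge has column \<open>j\<close> under \<open>\<rho>\<close>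
      and column \<open>j'\<close> under \<open>\<tau>\<close>, so \<open>\<pi>\<close> sends
      \<open>j'\<close> to \<open>j\<close>. The edge is replaced by the way back from
      \<open>j\<close> to \<open>j'\<close>, followed by the term \<open>c\<close> of the same
      row.\<close>
    define j' where "j' = target s (\<tau> s)"
    have s': "row_of \<tau> j' = s" using sel(1) by (simp add: j'_def)
    have v: "val A l x s c = val A l x s (\<tau> s)" "val A l x s c \<noteq> -\<infinity>" 
      using c(1) eq unfolding tight_at_def s_def by auto
    have "\<pi> j' = j" unfolding \<pi>_def s' using sel(3) by (simp add: s_def)
    moreover have "x $ j' \<noteq> -\<infinity>"
      using v val_finite_iff[OF A l x, of s "\<tau> s"] by (simp add: j'_def)
    ultimately have "(j, j') \<in> (tight A l \<tau> x)\<^sup>*" using rev_step by blast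
    moreover have "(j', m) \<in> (tight A l \<tau> x)\<^sup>*"
    proof (cases "c = \<tau> s")
      case True
      thus ?thesis using c(2) by (simp add: j'_def)
    next
      case False
      hence "tight_at A l \<tau> x j' c" using v s' by (simp add: tight_at_def)
      thus ?thesis using c(2) s' unfolding tight_def by (intro r_into_rtrancl) auto
    qed
    ultimately show ?thesis by (rule rtrancl_trans)
  qed
  thus ?thesis by (intro rtrancl_subset_rtrancl) auto
qed

subsection \<open>Sums of eigenvectors for distinct eigenvalues\<close>

text \<open>No multi-circuit occurs here: every finite row maximum is attained at least twice. This
  is all that the argument uses about the summands for the other eigenvalues.\<close>

definition tropical :: "ereal ^ 'n ^ 'n \<Rightarrow> ereal \<Rightarrow> ereal ^ 'n \<Rightarrow> bool" where
  "tropical A l z \<longleftrightarrow> (\<forall>s c. (\<forall>d. val A l z s d \<le> val A l z s c) \<longrightarrow> val A l z s c \<noteq> -\<infinity> \<longrightarrow>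
     (\<exists>d. d \<noteq> c \<and> val A l z s d = val A l z s c))"

text \<open>Disjointness of the circuits of the tight digraph in local form: a vertex has at most
  one outgoing edge that lies on a circuit.\<close>

definition unique_circuits ::
    "ereal ^ 'n ^ 'n \<Rightarrow> ereal \<Rightarrow> ('n \<Rightarrow> 'n option) \<Rightarrow> ereal ^ 'n \<Rightarrow> bool" where
  "unique_circuits A l \<tau> x \<longleftrightarrow> (\<forall>j m m'. (j, m) \<in> tight A l \<tau> x \<longrightarrow> (j, m') \<in> tight A l \<tau> x \<longrightarrow>
     (m, j) \<in> (tight A l \<tau> x)\<^sup>* \<longrightarrow> (m', j) \<in> (tight A l \<tau> x)\<^sup>* \<longrightarrow> m = m')"

text \<open>The length of a multi-circuit is the dimension minus the number of \<open>None\<close>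
  terms. The two cardinalities count the \<open>None\<close> terms gained and lost by the exchange
  along the orbit.\<close>

definition length_changing_cycle ::
    "ereal ^ 'n ^ 'n \<Rightarrow> ereal \<Rightarrow> ('n \<Rightarrow> 'n option) \<Rightarrow> ereal ^ 'n \<Rightarrow> ('n \<Rightarrow> 'n option) \<Rightarrow> 'n \<Rightarrow> bool" where
  "length_changing_cycle A l \<tau> x \<kappa> k \<longleftrightarrow>
     (\<exists>p>0. (succ \<tau> \<kappa> ^^ p) k = k) \<and>
     (\<forall>j\<in>orbit_from (succ \<tau> \<kappa>) k. tight_at A l \<tau> x j (\<kappa> j)) \<and>
     card {j\<in>orbit_from (succ \<tau> \<kappa>) k. \<kappa> j = None} \<noteq>
     card {j\<in>orbit_from (succ \<tau> \<kappa>) k. \<tau> (row_of \<tau> j) = None}"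

lemma val_mono: "x $ target s c \<le> y $ target s c \<Longrightarrow> val A l x s c \<le> val A l y s c"
  unfolding val_def by (rule add_left_mono)

lemma val_eqD:
  assumes "A \<in> Rmax_mat" "l \<noteq> \<infinity>" "val A l x s c = val A l y s c" "coef A l s c \<noteq> -\<infinity>"
  shows "x $ target s c = y $ target s c"
proof -
  obtain r where "coef A l s c = ereal r"
    using assms(4) coef_not_PInf[OF assms(1,2), of s c] by (cases "coef A l s c") auto
  thus ?thesis using assms(3) unfolding val_def
    by (cases "x $ target s c"; cases "y $ target s c") auto
qed

lemma maximal_term:
  fixes A :: "ereal ^ 'n ^ 'n"
  obtains c where "\<And>d. val A l z s d \<le> val A l z s c"
proof -
  have "finite (range (val A l z s))" by simp
  hence "Max (range (val A l z s)) \<in> range (val A l z s)" by (intro Max_in) auto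
  then obtain c where "val A l z s c = Max (range (val A l z s))" by force
  thus thesis using that Max_ge[OF \<open>finite (range (val A l z s))\<close>] by (metis rangeI)
qed

text \<open>If the diagonal term is a row maximum, a second term attains it, and that one is a
  matrix entry. Eigenvalues are compared through this bound, since the matrix entries do not involve
  \<open>l\<close>.\<close>

lemma tropical_row_bound:
  fixes A :: "ereal ^ 'n ^ 'n"
  assumes "tropical A l z" "l + z $ s \<noteq> -\<infinity>"
  obtains d where "l + z $ s \<le> A $ s $ d + z $ d"
proof -
  obtain c where c: "\<And>d. val A l z s d \<le> val A l z s c" using maximal_term[of A l z s] by blast
  have n: "val A l z s None = l + z $ s" by (simp add: val_def)
  hence fin: "val A l z s c \<noteq> -\<infinity>" using c[of None] assms(2) by auto
  have "\<exists>d. val A l z s None \<le> val A l z s (Some d)"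
  proof (cases c)
    case None
    then obtain d where "d \<noteq> None" "val A l z s d = val A l z s None"
      using assms(1) c fin unfolding tropical_def by metis
    thus ?thesis by (metis not_None_eq order_refl)
  next
    case (Some d)
    thus ?thesis using c by blast
  qed
  thus thesis using that by (auto simp: val_def)
qed

text \<open>Backward propagation of equality. If \<open>y\<close> meets \<open>b\<close> at the head
  of a tight edge, the term of that edge already lifts the row maximum of \<open>y\<close> to that
  of \<open>b\<close>, and \<open>\<tau>\<close> picks the row maximum of \<open>y\<close> as
  well.\<close>

lemma tight_tail:
  assumes "A \<in> Rmax_mat" "l \<noteq> \<infinity>" "selection \<tau>" and b: "b \<in> Rmax_vec"
    and dom: "dominates A l \<tau> y" and le: "\<And>i. y $ i \<le> b $ i"
    and im: "(i, m) \<in> (tight A l \<tau> b)\<^sup>*" and eq: "y $ m = b $ m"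
  shows "y $ i = b $ i"
  using im
proof (induction rule: converse_rtrancl_induct)
  case base
  show ?case by (rule eq)
next
  case (step i k)
  then obtain c where c: "tight_at A l \<tau> b i c" "k = target (row_of \<tau> i) c"
    by (auto simp: tight_def)
  let ?s = "row_of \<tau> i"
  have "val A l b ?s (\<tau> ?s) = val A l y ?s c"
    using c step.IH by (simp add: tight_at_def val_def)
  also have "\<dots> \<le> val A l y ?s (\<tau> ?s)" using dom by (simp add: dominates_def)
  finally have "val A l y ?s (\<tau> ?s) = val A l b ?s (\<tau> ?s)"
    using val_mono[OF le] by (metis antisym)
  from val_eqD[OF assms(1,2) this tight_at_target(2)[OF assms(1,2) b assms(3) c(1)]]
  show ?case unfolding target_row[OF assms(3)] .
qed

text \<open>Here \<open>y\<close> plays the summand for \<open>l\<close> itself. The vectors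
  \<open>z\<close> of the covering assumption may differ from index to index, which is all that
  coordinatewise limits provide.\<close>

lemma real_component:
  fixes A :: "ereal ^ 'n ^ 'n" and l :: real
  assumes A: "A \<in> Rmax_mat" and b: "b \<in> Rmax_vec" and opt0: "optimal A l \<tau>0"
    and dom: "\<And>\<tau>. optimal A l \<tau> \<Longrightarrow> dominates A l \<tau> b"
    and uniq: "\<And>\<tau>. optimal A l \<tau> \<Longrightarrow> unique_circuits A l \<tau> b"
    and chain: "\<And>i. b $ i \<noteq> -\<infinity> \<Longrightarrow> \<exists>\<tau> \<kappa> k. optimal A l \<tau> \<and> (i, k) \<in> (tight A l \<tau> b)\<^sup>* \<and>
                  length_changing_cycle A l \<tau> b \<kappa> k"
    and y: "\<And>\<tau>. optimal A l \<tau> \<Longrightarrow> dominates A l \<tau> y" "\<And>i. y $ i \<le> b $ i"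
    and cover: "\<And>j. b $ j \<noteq> -\<infinity> \<Longrightarrow> y $ j = b $ j \<or> (\<exists>l' z. l' \<noteq> ereal l \<and> l' \<noteq> \<infinity> \<and>
                  (\<forall>i. z $ i \<le> b $ i) \<and> tropical A l' z \<and> z $ j = b $ j)"
  shows "y = b"
proof (rule ccontr)
  assume "y \<noteq> b"
  define R where "R = (tight A l \<tau>0 b)\<^sup>*"
  have l: "ereal l \<noteq> \<infinity>" by simp
  have optD: "selection \<tau>" "supported A l \<tau>" if "optimal A l \<tau>" for \<tau>
    using that by (auto simp: optimal_def)
  have R: "(tight A l \<tau> b)\<^sup>* = R" if "optimal A l \<tau>" for \<tau>
    unfolding R_def
    using tight_rtrancl_subset[OF A l b optD[OF that] optD(1)[OF opt0] dom[OF that] dom[OF opt0]]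
      tight_rtrancl_subset[OF A l b optD[OF opt0] optD(1)[OF that] dom[OF opt0] dom[OF that]]
    by blast
  define J where "J = {i. y $ i \<noteq> b $ i}"
  have "J \<noteq> {}" using \<open>y \<noteq> b\<close> by (auto simp: J_def vec_eq_iff)
  then obtain i where iJ: "i \<in> J" and imin: "\<And>m. m \<in> J \<Longrightarrow> card (R `` {i}) \<le> card (R `` {m})"
    using ex_has_least_nat[of "\<lambda>i. i \<in> J" _ "\<lambda>i. card (R `` {i})"] by blast
  have bJ: "b $ m \<noteq> -\<infinity>" if "m \<in> J" for m using that y(2)[of m] by (auto simp: J_def)
  have closed: "m \<in> J" if "(k, m) \<in> R" "k \<in> J" for k m
    using tight_tail[OF A l optD(1)[OF opt0] b y(1)[OF opt0] y(2)] that unfolding R_def J_def by blast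
  obtain \<tau> \<kappa> k where opt: "optimal A l \<tau>" and ik: "(i, k) \<in> R"
    and cyc: "length_changing_cycle A l \<tau> b \<kappa> k"
    using chain[OF bJ[OF iJ]] R by metis
  note sel = optD(1)[OF opt]
  note R\<tau> = R[OF opt]
  have R_trans: "(a, c) \<in> R" if "(a, b') \<in> R" "(b', c) \<in> R" for a b' c
    using that unfolding R_def by (rule rtrancl_trans)
  have kJ: "k \<in> J" using closed ik iJ by blast
  \<comment> \<open>By minimality everything reachable from \<open>k\<close> reaches as much as
    \<open>i\<close> does, in particular \<open>k\<close> again. Beyond \<open>k\<close> the digraph
    is strongly connected, so every edge leaving a vertex of \<open>K\<close> lies on a circuit and
    the uniqueness assumption applies to it.\<close>
  have mutual: "(m, k) \<in> R" if km: "(k, m) \<in> R" for m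
  proof -
    have "R `` {m} \<subseteq> R `` {i}" using R_trans ik km by blast
    moreover have "card (R `` {i}) \<le> card (R `` {m})" using imin closed kJ km by blast
    ultimately have "R `` {m} = R `` {i}" by (meson card_seteq finite)
    thus ?thesis using ik by blast
  qed
  define f where "f = succ \<tau> \<kappa>"
  define K where "K = orbit_from f k"
  obtain p where p: "p > 0" "(f ^^ p) k = k"
    using cyc unfolding length_changing_cycle_def f_def by blast
  have tK: "tight_at A l \<tau> b j (\<kappa> j)" if "j \<in> K" for j
    using cyc that unfolding length_changing_cycle_def f_def K_def by blast
  have ne: "card {j\<in>K. \<kappa> j = None} \<noteq> card {j\<in>K. \<tau> (row_of \<tau> j) = None}"
    using cyc unfolding length_changing_cycle_def f_def K_def by blast
  have bijK: "bij_betw f K K" unfolding K_def by (rule orbit_from_bij[OF p])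
  have fK: "f j \<in> K" if "j \<in> K" for j using that bijK by (metis bij_betwE)
  have f_edge: "(j, f j) \<in> tight A l \<tau> b" if "j \<in> K" for j
    using tK[OF that] unfolding tight_def f_def succ_def by blast
  have kK: "(k, j) \<in> R" if "j \<in> K" for j
  proof -
    have "(k, (f ^^ n) k) \<in> R \<and> (f ^^ n) k \<in> K" for n
    proof (induction n)
      case 0
      show ?case using orbit_from_self[of k f] by (simp add: K_def R_def)
    next
      case (Suc n)
      thus ?case using f_edge[of "(f ^^ n) k"] fK R_trans R\<tau> by auto
    qed
    thus ?thesis using that by (auto simp: K_def orbit_from_def)
  qed
  have KJ: "j \<in> J" if "j \<in> K" for j using closed[OF kK[OF that] kJ] .
  \<comment> \<open>Uniqueness of circuits determines the target of a tight term but not the term: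
    \<open>None\<close> and the loop \<open>Some s\<close> have the same target and must be
    separated by another argument.\<close>
  have only: "c = \<kappa> j" if j: "j \<in> K" and c: "tight_at A l \<tau> b j c" for j c
  proof (rule ccontr)
    assume nc: "c \<noteq> \<kappa> j"
    define s where "s = row_of \<tau> j"
    have e1: "(j, target s c) \<in> tight A l \<tau> b" using c unfolding tight_def s_def by blast
    hence "(k, target s c) \<in> R" using R_trans[OF kK[OF j]] R\<tau> by blast
    hence "(target s c, j) \<in> R" using R_trans[OF mutual kK[OF j]] by blast
    moreover have "(f j, j) \<in> R" using R_trans[OF mutual[OF kK[OF fK[OF j]]] kK[OF j]] .
    ultimately have same: "target s c = f j"
      using uniq[OF opt] e1 f_edge[OF j] R\<tau> unfolding unique_circuits_def by blast
    hence same': "target s c = target s (\<kappa> j)" by (simp add: f_def succ_def s_def)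
    have ck: "(c = None \<and> \<kappa> j = Some s) \<or> (c = Some s \<and> \<kappa> j = None)"
      using same' nc by (cases c; cases "\<kappa> j") auto
    have \<tau>s: "target s (\<tau> s) = j" using sel by (simp add: s_def)
    have \<tau>n: "\<tau> s \<noteq> None" "\<tau> s \<noteq> Some s"
      using ck c tK[OF j] unfolding tight_at_def s_def by metis+
    \<comment> \<open>Both \<open>l\<close> and the equal entry \<open>a\<^sub>s\<^sub>s\<close> are attained, so after exchanging along \<open>K\<close> the loop
      at \<open>s\<close> and the reversal of \<open>K\<close> are distinct critical circuits through \<open>s\<close>.\<close>
    define \<kappa>' where "\<kappa>' = \<kappa>(j := None)"
    have succ_eq: "succ \<tau> \<kappa>' = f"
      using ck unfolding f_def succ_def \<kappa>'_def s_def by (auto simp: fun_eq_iff)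
    have vals: "val A l b s None = val A l b s (\<tau> s)" "val A l b s (Some s) = val A l b s (\<tau> s)"
      "val A l b s (\<tau> s) \<noteq> -\<infinity>"
      using ck c tK[OF j] unfolding tight_at_def s_def by metis+
    have t': "tight_at A l \<tau> b m (\<kappa>' m)" if "m \<in> K" for m
      using tK[OF that] vals \<tau>n unfolding \<kappa>'_def tight_at_def s_def by auto
    define \<tau>' where "\<tau>' = exchange \<tau> \<kappa>' K"
    have opt': "optimal A l \<tau>'"
      unfolding \<tau>'_def by (rule optimal_exchange[OF A l b opt t']) (use bijK succ_eq in auto)
    note sel' = optD(1)[OF opt']
    have "\<tau>' s = None" using exchange_row[OF sel, of \<kappa>' K j] j by (simp add: \<tau>'_def s_def \<kappa>'_def)
    hence r: "row_of \<tau>' s = s" by (rule row_None[OF sel'])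
    have "tight_at A l \<tau>' b s (Some s)" "tight_at A l \<tau>' b s (\<tau> s)"
      unfolding tight_at_def r \<open>\<tau>' s = None\<close> using vals \<tau>n by auto
    hence "(s, s) \<in> tight A l \<tau>' b" "(s, j) \<in> tight A l \<tau>' b"
      unfolding tight_def using r \<tau>s by force+
    moreover have "f j = s" using same' ck unfolding f_def succ_def s_def by auto
    hence "(j, s) \<in> (tight A l \<tau>' b)\<^sup>*" using f_edge[OF j] R[OF opt'] R\<tau> by auto
    ultimately have "s = j" using uniq[OF opt'] unfolding unique_circuits_def by blast
    thus False using \<tau>s \<tau>n by (cases "\<tau> s") auto
  qed
  define G where "G = {j\<in>K. \<exists>l' z. l' < ereal l \<and> (\<forall>i. z $ i \<le> b $ i) \<and> tropical A l' z \<and> z $ j = b $ j}"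
  \<comment> \<open>The diagonal term is a maximum of row \<open>j\<close> of \<open>b\<close>. A
    vector \<open>z\<close> for \<open>l'\<close> that meets \<open>b\<close> at \<open>j\<close>
    has a matrix term at least \<open>l' + z $ j\<close>, while no term of \<open>b\<close> exceeds
    \<open>l + b $ j\<close>; hence \<open>l' \<le> l\<close>.\<close>
  have base: "j \<in> G" if j: "j \<in> K" and top: "\<And>d. val A l b j d \<le> ereal l + b $ j" for j
  proof -
    obtain l' z where z: "l' \<noteq> ereal l" "l' \<noteq> \<infinity>" "\<And>i. z $ i \<le> b $ i" "tropical A l' z" "z $ j = b $ j"
      using cover[OF bJ[OF KJ[OF j]]] KJ[OF j] unfolding J_def by blast
    obtain r where r: "b $ j = ereal r"
      using bJ[OF KJ[OF j]] Rmax_vec_not_PInf[OF b, of j] by (cases "b $ j") auto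
    have "l' \<le> ereal l"
    proof (cases "l' = -\<infinity>")
      case False
      then obtain q where q: "l' = ereal q" using z(2) by (cases l') auto
      have "l' + z $ j \<noteq> -\<infinity>" using q r z(5) by simp
      then obtain d where "l' + z $ j \<le> A $ j $ d + z $ d" by (rule tropical_row_bound[OF z(4)])
      also have "\<dots> \<le> A $ j $ d + b $ d" by (intro add_left_mono z)
      also have "\<dots> \<le> ereal l + b $ j" using top[of "Some d"] by (simp add: val_def)
      finally show ?thesis using z(5) q r by simp
    qed simp
    thus ?thesis using z j unfolding G_def by (auto simp: order_less_le)
  qed
  \<comment> \<open>For \<open>l' < l\<close> the diagonal term of \<open>z\<close> stays strictly
    below the row maximum \<open>M\<close> of \<open>b\<close>. If \<open>z\<close> attains
    \<open>M\<close> at one of the two maximal terms, its second maximum is a non-diagonal maximal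
    term of \<open>b\<close>, so it can only be the other one.\<close>
  have spread: "c' \<noteq> None \<and> z $ target s c' = b $ target s c'"
    if j: "j \<in> K" and s: "s = row_of \<tau> j" and cc: "{c, c'} = {\<tau> s, \<kappa> j}" and cn: "c \<noteq> None"
      and z: "l' < ereal l" "\<And>i. z $ i \<le> b $ i" "tropical A l' z" and eq: "z $ target s c = b $ target s c"
    for j s c c' l' z
  proof -
    define M where "M = val A l b s (\<tau> s)"
    have Mfin: "M \<noteq> -\<infinity>" "M \<noteq> \<infinity>" and cM: "val A l b s c = M" "val A l b s c' = M"
      using tK[OF j] cc s val_not_PInf[OF A l b] unfolding M_def tight_at_def by (auto simp: doubleton_eq_iff)
    have below: "val A l b s d \<le> M" for d using dom[OF opt] by (simp add: dominates_def M_def)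
    have zb: "val A l' z s (Some d) \<le> val A l b s (Some d)" for d
      using z(2)[of d] by (simp add: val_def add_left_mono)
    have zn: "val A l' z s None < M"
    proof -
      have "l' + z $ s \<le> l' + b $ s" by (intro add_left_mono z)
      moreover have "ereal l + b $ s \<le> M" using below[of None] by (simp add: val_def)
      moreover have "l' + b $ s < ereal l + b $ s \<or> l' + b $ s = -\<infinity>"
        using z(1) Rmax_vec_not_PInf[OF b, of s] by (cases l'; cases "b $ s") auto
      ultimately have "l' + z $ s < M" using Mfin(1) less_ereal.simps(5) 
        by (metis ereal_MInfty_lessI ereal_infty_less_eq(2) order_le_less_trans order_less_le_trans)
      thus ?thesis by (simp add: val_def)
    qed
    have zc: "val A l' z s c = M" using cn eq cM(1) by (auto simp: val_def)
    have "val A l' z s d \<le> val A l' z s c" for d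
      using zn zb below unfolding zc by (cases d) (auto intro: order_trans)
    then obtain d where d: "d \<noteq> c" "val A l' z s d = M"
      using z(3) zc Mfin(1) unfolding tropical_def by metis
    have dn: "d \<noteq> None" using d(2) zn by (metis order_less_irrefl)
    then obtain e where e: "d = Some e" by blast
    have bd: "val A l b s d = M" using d zb[of e] below[of d] e by auto
    have "d = c'"
    proof (cases "d = \<tau> s")
      case True
      thus ?thesis using cc d(1) by (auto simp: doubleton_eq_iff)
    next
      case False
      hence "tight_at A l \<tau> b j d" using bd Mfin unfolding tight_at_def s M_def by simp
      hence "d = \<kappa> j" by (rule only[OF j])
      thus ?thesis using cc d(1) by (auto simp: doubleton_eq_iff)
    qed
    moreover have "z $ target s d = b $ target s d"
    proof (rule val_eqD[OF A l, of z s d b])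
      show "val A l z s d = val A l b s d" using d(2) bd e by (simp add: val_def)
      show "coef A l s d \<noteq> -\<infinity>" using bd Mfin val_finite_iff[OF A l b] by metis
    qed
    ultimately show ?thesis using dn by simp
  qed
  have in_G: "j \<in> G \<longleftrightarrow> f j \<in> G" if j: "j \<in> K" "\<tau> (row_of \<tau> j) \<noteq> None" "\<kappa> j \<noteq> None" for j
  proof
    assume "j \<in> G"
    then obtain l' z where z: "l' < ereal l" "\<And>i. z $ i \<le> b $ i" "tropical A l' z" "z $ j = b $ j"
      unfolding G_def by blast
    have "z $ f j = b $ f j"
      using spread[OF j(1) refl refl j(2) z(1-3)] z(4) sel by (simp add: f_def succ_def)
    thus "f j \<in> G" using z fK[OF j(1)] unfolding G_def by blast
  next
    assume "f j \<in> G"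
    then obtain l' z where z: "l' < ereal l" "\<And>i. z $ i \<le> b $ i" "tropical A l' z" "z $ f j = b $ f j"
      unfolding G_def by blast
    have "z $ j = b $ j"
      using spread[OF j(1) refl insert_commute j(3) z(1-3)] z(4) sel by (simp add: f_def succ_def)
    thus "j \<in> G" using z j(1) unfolding G_def by blast
  qed
  \<comment> \<open>With the diagonal picked, \<open>j\<close> is its own row and
    \<open>base\<close> applies. If \<open>f j\<close> were in \<open>G\<close>,
    \<open>spread\<close> would make the diagonal the second maximum of \<open>z\<close>.\<close>
  have tau_None: "j \<in> G \<and> f j \<notin> G" if j: "j \<in> K" "\<tau> (row_of \<tau> j) = None" for j
  proof
    have r: "row_of \<tau> j = j" by (rule row_None'[OF sel j(2)])
    show "j \<in> G"
      using base[OF j(1)] dom[OF opt] j(2) unfolding dominates_def r by (metis val_def coef_simps(1) target_simps(1))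
    have kn: "\<kappa> j \<noteq> None" using tK[OF j(1)] j(2) unfolding tight_at_def by metis
    show "f j \<notin> G"
    proof
      assume "f j \<in> G"
      then obtain l' z where z: "l' < ereal l" "\<And>i. z $ i \<le> b $ i" "tropical A l' z" "z $ f j = b $ f j"
        unfolding G_def by blast
      thus False using spread[OF j(1) refl insert_commute kn z(1-3)] j(2) by (simp add: f_def succ_def)
    qed
  qed
  \<comment> \<open>The mirror image: now \<open>f j\<close> is the row itself, so
    \<open>base\<close> applies to \<open>f j\<close> and \<open>spread\<close> excludes
    \<open>j\<close>.\<close>
  have kappa_None: "j \<notin> G \<and> f j \<in> G" if j: "j \<in> K" "\<kappa> j = None" for j
  proof
    define s where "s = row_of \<tau> j"
    have fs: "f j = s" using j(2) by (simp add: f_def succ_def s_def)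
    have "val A l b s None = val A l b s (\<tau> s)" using tK[OF j(1)] j(2) unfolding tight_at_def s_def by simp
    hence "val A l b s d \<le> ereal l + b $ s" for d
      using dom[OF opt] unfolding dominates_def by (metis val_def coef_simps(1) target_simps(1))
    thus "f j \<in> G" using base fK[OF j(1)] fs by simp
    have tn: "\<tau> (row_of \<tau> j) \<noteq> None" using tK[OF j(1)] j(2) unfolding tight_at_def by metis
    show "j \<notin> G"
    proof
      assume "j \<in> G"
      then obtain l' z where z: "l' < ereal l" "\<And>i. z $ i \<le> b $ i" "tropical A l' z" "z $ j = b $ j"
        unfolding G_def by blast
      thus False using spread[OF j(1) refl refl tn z(1-3)] j(2) sel by simp
    qed
  qed
  have "{j\<in>K. \<tau> (row_of \<tau> j) = None} = {j\<in>K. j \<in> G \<and> f j \<notin> G}"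
    "{j\<in>K. \<kappa> j = None} = {j\<in>K. j \<notin> G \<and> f j \<in> G}"
    using tau_None kappa_None in_G by blast+
  moreover have "card {j\<in>K. f j \<in> G} = card {j\<in>K. j \<in> G}"
  proof -
    have "f ` {j\<in>K. f j \<in> G} = {j\<in>f ` K. j \<in> G}" by auto
    hence "f ` {j\<in>K. f j \<in> G} = {j\<in>K. j \<in> G}"
      by (simp only: bij_betw_imp_surj_on[OF bijK])
    moreover have "inj_on f {j\<in>K. f j \<in> G}"
      by (rule inj_on_subset[OF bij_betw_imp_inj_on[OF bijK]]) auto
    ultimately show ?thesis by (metis card_image)
  qed
  moreover have "card {j\<in>K. f j \<in> G} = card {j\<in>K. j \<in> G \<and> f j \<in> G} + card {j\<in>K. j \<notin> G \<and> f j \<in> G}"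
    by (subst card_Un_disjoint[symmetric]) (auto intro: arg_cong[where f=card])
  moreover have "card {j\<in>K. j \<in> G} = card {j\<in>K. j \<in> G \<and> f j \<in> G} + card {j\<in>K. j \<in> G \<and> f j \<notin> G}"
    by (subst card_Un_disjoint[symmetric]) (auto intro: arg_cong[where f=card])
  ultimately show False using ne by simp
qed

subsection \<open>Multi-circuits as selections\<close>

text \<open>Turns the list form of a circuit into the graph of \<open>cycle_of_list\<close>, so that
  results about permutations apply.\<close>

lemma zip_rotate1:
  assumes "distinct vs"
  shows "set (zip vs (rotate1 vs)) = (\<lambda>j. (j, cycle_of_list vs j)) ` set vs"
proof -
  have "rotate1 vs = map (cycle_of_list vs) vs"
    using cyclic_rotation[OF assms, of 1] by simp
  thus ?thesis by (simp add: zip_map2 zip_same_conv_map)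
qed

definition permutation_graph :: "('a \<times> 'a) set \<Rightarrow> bool" where
  "permutation_graph C \<longleftrightarrow> (\<forall>i\<in>Field C. (\<exists>!j. (i, j) \<in> C) \<and> (\<exists>!j. (j, i) \<in> C))"

lemma Field_graph: "\<rho> permutes K \<Longrightarrow> Field ((\<lambda>j. (j, \<rho> j)) ` K) = K"
  unfolding Field_def by (auto simp: permutes_in_image Domain.simps Range.simps image_iff)

lemma permutation_graph_permutes:
  assumes "\<rho> permutes K"
  shows "permutation_graph ((\<lambda>j. (j, \<rho> j)) ` K)"
  unfolding permutation_graph_def Field_graph[OF assms]
proof (intro ballI conjI)
  fix i assume i: "i \<in> K"
  thus "\<exists>!j. (i, j) \<in> (\<lambda>j. (j, \<rho> j)) ` K" by auto
  have "i \<in> \<rho> ` K" using i permutes_image[OF assms] by simp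
  then obtain k where k: "k \<in> K" "\<rho> k = i" by blast
  show "\<exists>!j. (j, i) \<in> (\<lambda>j. (j, \<rho> j)) ` K"
  proof (rule ex1I[of _ k])
    show "(k, i) \<in> (\<lambda>j. (j, \<rho> j)) ` K" using k by blast
    fix j assume "(j, i) \<in> (\<lambda>j. (j, \<rho> j)) ` K"
    hence "\<rho> j = \<rho> k" using k by auto
    thus "j = k" by (rule injD[OF permutes_inj[OF assms]])
  qed
qed

lemma elementary_circuit_permutation:
  assumes "elementary_circuit A C"
  obtains \<rho> K where "\<rho> permutes K" "K \<noteq> {}" "C = (\<lambda>j. (j, \<rho> j)) ` K" "C \<subseteq> graph_edges A"
proof -
  obtain vs where vs: "vs \<noteq> []" "distinct vs" "C = set (zip vs (rotate1 vs))" "C \<subseteq> graph_edges A"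
    using assms unfolding elementary_circuit_def by blast
  show thesis
    by (rule that[OF cycle_permutes, of vs]) (use vs zip_rotate1[OF vs(2)] in simp_all)
qed

lemma multi_circuit_permutation_graph:
  assumes "multi_circuit A C"
  shows "permutation_graph C" "C \<subseteq> graph_edges A"
proof -
  obtain \<F> where F0: "\<forall>D\<in>\<F>. elementary_circuit A D"
    "\<forall>D\<in>\<F>. \<forall>D'\<in>\<F>. D \<noteq> D' \<longrightarrow> Field D \<inter> Field D' = {}" and C: "C = \<Union>\<F>"
    using assms unfolding multi_circuit_def by (elim exE conjE)
  note F = F0(1)[rule_format] and disj = F0(2)[rule_format]
  have "D \<subseteq> graph_edges A" if "D \<in> \<F>" for D
    using F[OF that] by (simp add: elementary_circuit_def)
  thus "C \<subseteq> graph_edges A" using C by blast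
  have perm: "permutation_graph D" if "D \<in> \<F>" for D
    using elementary_circuit_permutation[OF F[OF that]] permutation_graph_permutes by metis
  show "permutation_graph C"
    unfolding permutation_graph_def
  proof (intro ballI)
    fix i assume "i \<in> Field C"
    then obtain D where D: "D \<in> \<F>" "i \<in> Field D" unfolding C Field_def by blast
    have same: "D' = D" if "D' \<in> \<F>" "i \<in> Field D'" for D'
      using disj[OF that(1) D(1)] that(2) D(2) by (metis IntI empty_iff)
    have "(i, j) \<in> C \<longleftrightarrow> (i, j) \<in> D" "(j, i) \<in> C \<longleftrightarrow> (j, i) \<in> D" for j
      using same D(1) FieldI1[of i j] FieldI2[of j i] unfolding C by (metis UnionE UnionI)+
    thus "(\<exists>!j. (i, j) \<in> C) \<and> (\<exists>!j. (j, i) \<in> C)"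
      using perm[OF D(1)] D(2) unfolding permutation_graph_def by simp
  qed
qed

definition selection_of :: "('n \<times> 'n) set \<Rightarrow> 'n \<Rightarrow> 'n option" where
  "selection_of C s = (if s \<in> Field C then Some (THE j. (s, j) \<in> C) else None)"

definition edges_of :: "('n \<Rightarrow> 'n option) \<Rightarrow> ('n \<times> 'n) set" where
  "edges_of \<tau> = {(s, j). \<tau> s = Some j}"

lemma selection_of_Some:
  assumes "permutation_graph C"
  shows "selection_of C s = Some j \<longleftrightarrow> (s, j) \<in> C"
proof
  assume "selection_of C s = Some j"
  hence "s \<in> Field C" "j = (THE j. (s, j) \<in> C)" by (auto simp: selection_of_def split: if_splits)
  thus "(s, j) \<in> C" using assms unfolding permutation_graph_def by (metis theI')
next
  assume sj: "(s, j) \<in> C"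
  hence "s \<in> Field C" by (rule FieldI1)
  moreover have "(THE j. (s, j) \<in> C) = j"
    using assms \<open>s \<in> Field C\<close> unfolding permutation_graph_def by (intro the1_equality sj) blast
  ultimately show "selection_of C s = Some j" by (simp add: selection_of_def)
qed

lemma selection_of_None: "selection_of C s = None \<longleftrightarrow> s \<notin> Field C"
  by (simp add: selection_of_def)

lemma edges_of_selection_of: "permutation_graph C \<Longrightarrow> edges_of (selection_of C) = C"
  by (auto simp: edges_of_def selection_of_Some)

lemma selection_selection_of:
  fixes C :: "('n::finite \<times> 'n) set"
  assumes "permutation_graph C"
  shows "selection (selection_of C)"
proof -
  have "inj (\<lambda>s. target s (selection_of C s))"
  proof (rule injI)
    fix s t assume eq: "target s (selection_of C s) = target t (selection_of C t)"
    show "s = t"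
    proof (cases "selection_of C s"; cases "selection_of C t")
      fix i j assume "selection_of C s = Some i" "selection_of C t = Some j"
      moreover from this have "i = j" using eq by simp
      ultimately have "(s, i) \<in> C" "(t, i) \<in> C" using selection_of_Some[OF assms] by blast+
      moreover from this have "\<exists>!k. (k, i) \<in> C"
        using assms FieldI2 unfolding permutation_graph_def by fast
      ultimately show ?thesis by blast
    next
      fix j assume st: "selection_of C s = None" "selection_of C t = Some j"
      hence "(t, s) \<in> C" using eq selection_of_Some[OF assms, of t s] by simp
      thus ?thesis using st(1) FieldI2[of t s C] by (simp add: selection_of_None)
    next
      fix i assume st: "selection_of C s = Some i" "selection_of C t = None"
      hence "(s, t) \<in> C" using eq selection_of_Some[OF assms, of s t] by simp
      thus ?thesis using st(2) FieldI2[of s t C] by (simp add: selection_of_None)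
    qed (use eq in simp)
  qed
  thus ?thesis unfolding selection_def by (simp add: bij_def finite_UNIV_inj_surj)
qed

lemma card_selection_of:
  fixes C :: "('n::finite \<times> 'n) set"
  assumes "permutation_graph C"
  shows "card C = card {s. selection_of C s \<noteq> None}"
proof -
  have "C = (\<lambda>s. (s, the (selection_of C s))) ` {s. selection_of C s \<noteq> None}"
    (is "C = ?g ` ?S")
  proof (intro set_eqI)
    fix e :: "'n \<times> 'n"
    obtain s j where e: "e = (s, j)" by (cases e)
    have "e \<in> C \<longleftrightarrow> selection_of C s = Some j" using selection_of_Some[OF assms] e by simp
    also have "\<dots> \<longleftrightarrow> e \<in> ?g ` ?S" unfolding e by (auto simp: image_iff)
    finally show "e \<in> C \<longleftrightarrow> e \<in> ?g ` ?S" .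
  qed
  moreover have "inj_on (\<lambda>s. (s, the (selection_of C s))) {s. selection_of C s \<noteq> None}"
    by (auto simp: inj_on_def)
  ultimately show ?thesis by (metis card_image)
qed

text \<open>Induction over the cycle decomposition: each nonempty cycle adds one elementary circuit,
  disjoint from those already collected.\<close>

lemma multi_circuit_cycle_decomp:
  assumes "cycle_decomp I p" "\<And>i. i \<in> I \<Longrightarrow> A $ i $ p i \<noteq> -\<infinity>"
  shows "p permutes I \<and> multi_circuit A ((\<lambda>i. (i, p i)) ` I)"
  using assms
proof (induction rule: cycle_decomp.induct)
  case empty
  show ?case unfolding multi_circuit_def by (auto intro!: exI[of _ "{}"] simp: permutes_id)
next
  case (comp I p cs)
  define q where "q = cycle_of_list cs \<circ> p"
  have "A $ i $ p i \<noteq> -\<infinity>" if "i \<in> I" "p permutes I" for i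
  proof -
    have "p i \<notin> set cs" using that comp.hyps(3) permutes_in_image[OF that(2)] by blast
    thus ?thesis using comp.prems[of i] that(1) by (simp add: id_outside_supp)
  qed
  \<comment> \<open>This needs its own induction. The induction hypothesis would supply it only
    under the premise on the entries along \<open>p\<close>, and that premise is derived from
    \<open>p i \<in> I\<close>.\<close>
  moreover have "p permutes I"
  proof -
    have "cycle_decomp J r \<Longrightarrow> r permutes J" for J and r :: "'a \<Rightarrow> 'a"
    proof (induction rule: cycle_decomp.induct)
      case (comp J r cs')
      have "cycle_of_list cs' permutes (set cs' \<union> J)" "r permutes (set cs' \<union> J)"
        using cycle_permutes[of cs'] comp.IH by (auto intro: permutes_subset)
      thus ?case by (rule permutes_compose[rotated])
    qed (rule permutes_id)
    thus ?thesis using comp.hyps(1) .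
  qed
  ultimately have p: "p permutes I" and mc: "multi_circuit A ((\<lambda>i. (i, p i)) ` I)"
    using comp.IH by auto
  have qI: "q i = p i" if "i \<in> I" for i
    using that comp.hyps(3) permutes_in_image[OF p] unfolding q_def
    by (metis comp_apply disjoint_iff id_outside_supp)
  have qc: "q i = cycle_of_list cs i" if "i \<in> set cs" for i
    using that comp.hyps(3) permutes_not_in[OF p] unfolding q_def by (metis comp_apply disjoint_iff)
  have "cycle_of_list cs permutes (set cs \<union> I)" "p permutes (set cs \<union> I)"
    using cycle_permutes[of cs] p by (auto intro: permutes_subset)
  hence qperm: "q permutes (set cs \<union> I)" by (simp add: q_def permutes_compose)
  have split: "(\<lambda>i. (i, q i)) ` (set cs \<union> I) =
      (\<lambda>i. (i, cycle_of_list cs i)) ` set cs \<union> (\<lambda>i. (i, p i)) ` I"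
    using qI qc by (auto simp: image_Un)
  \<comment> \<open>The decomposition admits the empty cycle, which is no elementary circuit and
    adds nothing.\<close>
  show ?case
  proof (cases "cs = []")
    case True
    thus ?thesis using p mc by simp
  next
    case False
    let ?D = "(\<lambda>i. (i, cycle_of_list cs i)) ` set cs"
    have "?D \<subseteq> graph_edges A"
    proof
      fix e assume "e \<in> ?D"
      then obtain i where i: "i \<in> set cs" "e = (i, cycle_of_list cs i)" by blast
      thus "e \<in> graph_edges A"
        using comp.prems[of i] qc[OF i(1)] unfolding graph_edges_def q_def by simp
    qed
    hence el: "elementary_circuit A ?D"
      unfolding elementary_circuit_def using False comp.hyps(2) zip_rotate1 by blast
    obtain \<F> where F: "\<forall>D\<in>\<F>. elementary_circuit A D"
      "\<forall>D\<in>\<F>. \<forall>D'\<in>\<F>. D \<noteq> D' \<longrightarrow> Field D \<inter> Field D' = {}" "(\<lambda>i. (i, p i)) ` I = \<Union>\<F>"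
      using mc unfolding multi_circuit_def by (elim exE conjE)
    have FI: "Field D \<subseteq> I" if "D \<in> \<F>" for D
    proof -
      have "Field D \<subseteq> Field (\<Union>\<F>)" using that by (auto simp: Field_def)
      thus ?thesis using Field_graph[OF p] F(3) by metis
    qed
    have "Field ?D = set cs" by (rule Field_graph[OF cycle_permutes])
    hence disj: "Field ?D \<inter> Field D = {}" if "D \<in> \<F>" for D using FI[OF that] comp.hyps(3) by blast
    have "multi_circuit A (?D \<union> (\<lambda>i. (i, p i)) ` I)"
      unfolding multi_circuit_def
    proof (intro exI[of _ "insert ?D \<F>"] conjI)
      show "\<forall>D\<in>insert ?D \<F>. elementary_circuit A D" using el F(1) by simp
      show "\<forall>D\<in>insert ?D \<F>. \<forall>D'\<in>insert ?D \<F>. D \<noteq> D' \<longrightarrow> Field D \<inter> Field D' = {}"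
        using F(2) disj by (simp add: Int_commute)
      show "?D \<union> (\<lambda>i. (i, p i)) ` I = \<Union>(insert ?D \<F>)" using F(3) by simp
    qed
    thus ?thesis unfolding q_def[symmetric] split using qperm by simp
  qed
qed

lemma Field_edges_of:
  assumes "selection \<tau>"
  shows "Field (edges_of \<tau>) = {s. \<tau> s \<noteq> None}"
proof -
  have "\<tau> j \<noteq> None" if "\<tau> s = Some j" for s j
  proof
    assume "\<tau> j = None"
    hence "target j (\<tau> j) = target s (\<tau> s)" using that by simp
    hence "j = s" using assms unfolding selection_def bij_def by (meson injD)
    thus False using that \<open>\<tau> j = None\<close> by simp
  qed
  thus ?thesis unfolding edges_of_def Field_def by auto
qed

lemma edges_of_multi_circuit:
  fixes A :: "ereal ^ 'n ^ 'n"
  assumes "selection \<tau>" "\<And>s j. \<tau> s = Some j \<Longrightarrow> A $ s $ j \<noteq> -\<infinity>"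
  shows "multi_circuit A (edges_of \<tau>)" "selection_of (edges_of \<tau>) = \<tau>"
proof -
  define K where "K = {s. \<tau> s \<noteq> None}"
  define p where "p s = target s (\<tau> s)" for s
  have "p permutes K"
  proof -
    have "bij p" using assms(1) by (simp add: selection_def p_def[abs_def])
    moreover have "p s = s" if "s \<notin> K" for s using that by (simp add: K_def p_def)
    ultimately show ?thesis by (simp add: permutes_def bij_iff)
  qed
  moreover have "A $ i $ p i \<noteq> -\<infinity>" if "i \<in> K" for i
    using that assms(2) unfolding K_def p_def by force
  ultimately have mc: "multi_circuit A ((\<lambda>i. (i, p i)) ` K)"
    using multi_circuit_cycle_decomp cycle_decomposition finite by metis
  have "edges_of \<tau> = (\<lambda>i. (i, p i)) ` K"
    by (force simp: edges_of_def K_def p_def image_iff)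
  thus m: "multi_circuit A (edges_of \<tau>)" using mc by simp
  have pg: "permutation_graph (edges_of \<tau>)" by (rule multi_circuit_permutation_graph(1)[OF m])
  show "selection_of (edges_of \<tau>) = \<tau>"
  proof
    fix s
    show "selection_of (edges_of \<tau>) s = \<tau> s"
    proof (cases "\<tau> s")
      case None
      thus ?thesis using Field_edges_of[OF assms(1)] selection_of_None[of "edges_of \<tau>" s] by auto
    next
      case (Some j)
      thus ?thesis using selection_of_Some[OF pg, of s j] by (simp add: edges_of_def)
    qed
  qed
qed

lemma add_MInfty: "l \<noteq> \<infinity> \<Longrightarrow> l + -\<infinity> = (-\<infinity> :: ereal)" "l \<noteq> \<infinity> \<Longrightarrow> -\<infinity> + l = (-\<infinity> :: ereal)"
  by (cases l; simp)+

section \<open>The characteristic polynomial as the largest weight of a selection\<close>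

lemma sum_coef:
  assumes "A \<in> Rmax_mat" "l \<noteq> \<infinity>" "supported A l \<tau>"
  shows "(\<Sum>s\<in>UNIV. coef A l s (\<tau> s)) = ereal (weight A l \<tau>)"
proof -
  have "(\<Sum>s\<in>UNIV. coef A l s (\<tau> s)) = (\<Sum>s\<in>UNIV. ereal (real_of_ereal (coef A l s (\<tau> s))))"
    using coef_real[OF assms(1,2)] assms(3) unfolding supported_def by (intro sum.cong) auto
  thus ?thesis by (simp add: weight_def)
qed

lemma charpoly_entry:
  "mp_mat_add A (mp_mat_scale (ereal \<mu>) mp_unit) $ i $ j = (if i = j then max (A $ i $ i) (ereal \<mu>) else A $ i $ j)"
  by (simp add: mp_mat_add_def mp_mat_scale_def mp_unit_def)

lemma charpoly_ge:
  assumes "A \<in> Rmax_mat" "selection \<tau>" "supported A (ereal \<mu>) \<tau>"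
  shows "ereal (weight A (ereal \<mu>) \<tau>) \<le> mp_charpoly A (ereal \<mu>)"
proof -
  let ?M = "mp_mat_add A (mp_mat_scale (ereal \<mu>) mp_unit)"
  define p where "p s = target s (\<tau> s)" for s
  have "p permutes UNIV" using assms(2) by (simp add: selection_def p_def[abs_def] permutes_def bij_iff)
  have "ereal (weight A (ereal \<mu>) \<tau>) = (\<Sum>s\<in>UNIV. coef A (ereal \<mu>) s (\<tau> s))"
    using sum_coef[OF assms(1) _ assms(3)] by simp
  also have "\<dots> \<le> (\<Sum>s\<in>UNIV. ?M $ s $ p s)"
  proof (rule sum_mono)
    fix s
    show "coef A (ereal \<mu>) s (\<tau> s) \<le> ?M $ s $ p s"
      unfolding charpoly_entry p_def by (cases "\<tau> s") auto
  qed
  also have "\<dots> \<le> mp_charpoly A (ereal \<mu>)"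
    unfolding mp_charpoly_def mp_det_def
    by (rule SUP_upper2[of p]) (use \<open>p permutes UNIV\<close> in auto)
  finally show ?thesis .
qed

lemma supported_None: "supported A (ereal \<mu>) (\<lambda>s. None)" "selection (\<lambda>s. None)"
  by (simp_all add: supported_def selection_def bij_id[unfolded id_def])

text \<open>A maximizing permutation becomes a selection by deciding at each fixed point whether the
  matrix entry or \<open>\<mu>\<close> realizes the maximum; ties go to \<open>None\<close>.\<close>

lemma charpoly_attained:
  fixes A :: "ereal ^ 'n ^ 'n"
  assumes A: "A \<in> Rmax_mat"
  obtains \<tau> where "selection \<tau>" "supported A (ereal \<mu>) \<tau>"
    "mp_charpoly A (ereal \<mu>) = ereal (weight A (ereal \<mu>) \<tau>)"
proof -
  let ?M = "mp_mat_add A (mp_mat_scale (ereal \<mu>) mp_unit)"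
  let ?P = "{p. p permutes (UNIV :: 'n set)}"
  let ?g = "\<lambda>p. \<Sum>i\<in>UNIV. ?M $ i $ p i"
  have "id \<in> ?P" by (simp add: permutes_id)
  hence "finite (?g ` ?P)" "?g ` ?P \<noteq> {}" by (blast intro: finite_imageI finite_permutations finite)+
  from Max_in[OF this] Max_Sup[OF this] have "Sup (?g ` ?P) \<in> ?g ` ?P" by simp
  then obtain p where p: "p permutes UNIV" "mp_charpoly A (ereal \<mu>) = (\<Sum>i\<in>UNIV. ?M $ i $ p i)"
    unfolding mp_charpoly_def mp_det_def by auto
  have notP: "?M $ i $ j \<noteq> \<infinity>" for i j
    unfolding charpoly_entry using A by (auto simp: Rmax_mat_def Rmax_def max_def)
  \<comment> \<open>The selection with \<open>None\<close> everywhere bounds the value from below by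
    a real number, so no factor along the maximizing permutation is
    \<open>-\<infinity>\<close>.\<close>
  have fin: "?M $ i $ p i \<noteq> -\<infinity>" for i
  proof
    assume "?M $ i $ p i = -\<infinity>"
    hence "(\<Sum>i\<in>UNIV. ?M $ i $ p i) = -\<infinity>"
      using notP by (subst sum.remove[of _ i]) (auto simp: sum_Pinfty)
    thus False using charpoly_ge[OF A supported_None(2,1), of \<mu>] p(2) by simp
  qed
  define \<tau> where "\<tau> i = (if i = p i \<and> A $ i $ i \<le> ereal \<mu> then None else Some (p i))" for i
  have t: "target i (\<tau> i) = p i" for i by (simp add: \<tau>_def)
  have c: "coef A (ereal \<mu>) i (\<tau> i) = ?M $ i $ p i" for i
    unfolding charpoly_entry \<tau>_def by (auto simp: max_def)
  have "selection \<tau>" using p(1) unfolding selection_def t by (simp add: permutes_bij)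
  moreover have sup: "supported A (ereal \<mu>) \<tau>" using fin c by (simp add: supported_def)
  moreover have "mp_charpoly A (ereal \<mu>) = ereal (weight A (ereal \<mu>) \<tau>)"
    using sum_coef[OF A _ sup] c p(2) by simp
  ultimately show thesis by (rule that)
qed

text \<open>Shows the weight as an affine function of \<open>\<mu>\<close> whose slope is the number
  of \<open>None\<close> terms.\<close>

lemma weight_split:
  fixes A :: "ereal ^ 'n ^ 'n"
  shows "weight A (ereal \<mu>) \<tau> = (\<Sum>s\<in>{s. \<tau> s \<noteq> None}. real_of_ereal (A $ s $ target s (\<tau> s))) +
     (real CARD('n) - real (card {s. \<tau> s \<noteq> None})) * \<mu>"
proof -
  let ?S = "{s. \<tau> s \<noteq> None}"
  have "weight A (ereal \<mu>) \<tau> = (\<Sum>s\<in>?S. real_of_ereal (coef A (ereal \<mu>) s (\<tau> s))) +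
      (\<Sum>s\<in>-?S. real_of_ereal (coef A (ereal \<mu>) s (\<tau> s)))"
    unfolding weight_def by (subst sum.union_disjoint[symmetric]) (auto intro: sum.cong)
  also have "(\<Sum>s\<in>?S. real_of_ereal (coef A (ereal \<mu>) s (\<tau> s))) = (\<Sum>s\<in>?S. real_of_ereal (A $ s $ target s (\<tau> s)))"
    by (rule sum.cong) auto
  also have "(\<Sum>s\<in>-?S. real_of_ereal (coef A (ereal \<mu>) s (\<tau> s))) = (\<Sum>s\<in>-?S. \<mu>)"
    by (rule sum.cong) auto
  also have "\<dots> = (real CARD('n) - real (card ?S)) * \<mu>"
    by (simp add: Compl_eq_Diff_UNIV card_Diff_subset of_nat_diff card_mono)
  finally show ?thesis .
qed

lemma multi_circuit_supported:
  assumes "multi_circuit A C"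
  shows "supported A (ereal \<mu>) (selection_of C)"
proof -
  note C = multi_circuit_permutation_graph[OF assms]
  have "coef A (ereal \<mu>) s (selection_of C s) \<noteq> -\<infinity>" for s
  proof (cases "selection_of C s")
    case (Some j)
    thus ?thesis using C selection_of_Some[OF C(1), of s j] by (auto simp: graph_edges_def)
  qed simp
  thus ?thesis by (simp add: supported_def)
qed

lemma weight_selection_of:
  fixes A :: "ereal ^ 'n ^ 'n"
  assumes "A \<in> Rmax_mat" "multi_circuit A C"
  shows "circuit_weight A C + ereal ((real CARD('n) - real (card C)) * \<mu>) =
    ereal (weight A (ereal \<mu>) (selection_of C))"
proof -
  note C = multi_circuit_permutation_graph[OF assms(2)]
  let ?\<tau> = "selection_of C" and ?S = "{s. selection_of C s \<noteq> None}"
  have "C = (\<lambda>s. (s, target s (?\<tau> s))) ` ?S"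
  proof (intro set_eqI)
    fix e :: "'n \<times> 'n"
    obtain s j where e: "e = (s, j)" by (cases e)
    have "e \<in> C \<longleftrightarrow> ?\<tau> s = Some j" using selection_of_Some[OF C(1)] e by simp
    also have "\<dots> \<longleftrightarrow> e \<in> (\<lambda>s. (s, target s (?\<tau> s))) ` ?S" unfolding e by (auto simp: image_iff)
    finally show "e \<in> C \<longleftrightarrow> e \<in> (\<lambda>s. (s, target s (?\<tau> s))) ` ?S" .
  qed
  hence "circuit_weight A C = (\<Sum>(i, j)\<in>(\<lambda>s. (s, target s (?\<tau> s))) ` ?S. A $ i $ j)"
    by (simp add: circuit_weight_def)
  also have "\<dots> = (\<Sum>s\<in>?S. A $ s $ target s (?\<tau> s))"
    by (subst sum.reindex) (auto simp: inj_on_def)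
  also have "\<dots> = (\<Sum>s\<in>?S. ereal (real_of_ereal (A $ s $ target s (?\<tau> s))))"
  proof (rule sum.cong)
    fix s assume "s \<in> ?S"
    then obtain j where j: "?\<tau> s = Some j" by auto
    hence "A $ s $ j \<noteq> -\<infinity>" using C selection_of_Some[OF C(1), of s j] by (auto simp: graph_edges_def)
    thus "A $ s $ target s (?\<tau> s) = ereal (real_of_ereal (A $ s $ target s (?\<tau> s)))"
      using coef_real[OF assms(1), of 0 s "Some j"] j by simp
  qed simp
  finally show ?thesis using weight_split[of A \<mu> ?\<tau>] card_selection_of[OF C(1)] by simp
qed

text \<open>Both sides say that the weight of \<open>C\<close> reaches the value of the
  characteristic polynomial, which is the largest weight of a selection.\<close>

lemma real_maximal_iff:
  fixes A :: "ereal ^ 'n ^ 'n"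
  assumes A: "A \<in> Rmax_mat"
  shows "real_maximal A \<mu> C \<longleftrightarrow> multi_circuit A C \<and> optimal A (ereal \<mu>) (selection_of C)"
proof (cases "multi_circuit A C")
  case True
  let ?l = "ereal \<mu>"
  have sel: "selection (selection_of C)" "supported A ?l (selection_of C)"
    using selection_selection_of[OF multi_circuit_permutation_graph(1)[OF True]]
      multi_circuit_supported[OF True] by auto
  obtain \<tau> where \<tau>: "selection \<tau>" "supported A ?l \<tau>" "mp_charpoly A ?l = ereal (weight A ?l \<tau>)"
    by (rule charpoly_attained[OF A, of \<mu>])
  have "real_maximal A \<mu> C \<longleftrightarrow> weight A ?l \<tau> = weight A ?l (selection_of C)"
    using True weight_selection_of[OF A True, of \<mu>] \<tau>(3) unfolding real_maximal_def by simp
  also have "\<dots> \<longleftrightarrow> optimal A ?l (selection_of C)"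
  proof
    assume "weight A ?l \<tau> = weight A ?l (selection_of C)"
    thus "optimal A ?l (selection_of C)"
      using charpoly_ge[OF A] \<tau>(3) sel unfolding optimal_def by (metis ereal_less_eq(3))
  next
    assume "optimal A ?l (selection_of C)"
    hence "weight A ?l \<tau> \<le> weight A ?l (selection_of C)" using \<tau> unfolding optimal_def by blast
    moreover have "weight A ?l (selection_of C) \<le> weight A ?l \<tau>"
      using charpoly_ge[OF A sel] \<tau>(3) by simp
    ultimately show "weight A ?l \<tau> = weight A ?l (selection_of C)" by simp
  qed
  finally show ?thesis using True by simp
qed (simp add: real_maximal_def)

lemma optimal_exists:
  fixes A :: "ereal ^ 'n ^ 'n"
  assumes "A \<in> Rmax_mat"
  obtains \<tau> where "optimal A (ereal \<mu>) \<tau>"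
proof -
  obtain \<tau> where \<tau>: "selection \<tau>" "supported A (ereal \<mu>) \<tau>"
    "mp_charpoly A (ereal \<mu>) = ereal (weight A (ereal \<mu>) \<tau>)"
    by (rule charpoly_attained[OF assms, of \<mu>])
  hence "optimal A (ereal \<mu>) \<tau>"
    using charpoly_ge[OF assms] unfolding optimal_def by (metis ereal_less_eq(3))
  thus thesis by (rule that)
qed

lemma real_maximal_edges_of:
  fixes A :: "ereal ^ 'n ^ 'n"
  assumes "A \<in> Rmax_mat" "optimal A (ereal \<mu>) \<tau>"
  shows "real_maximal A \<mu> (edges_of \<tau>)" "selection_of (edges_of \<tau>) = \<tau>"
proof -
  have "selection \<tau>" "A $ s $ j \<noteq> -\<infinity>" if "\<tau> s = Some j" for s j
    using assms(2) that unfolding optimal_def supported_def by (auto dest: spec[of _ s])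
  hence "selection \<tau>" "\<And>s j. \<tau> s = Some j \<Longrightarrow> A $ s $ j \<noteq> -\<infinity>"
    using assms(2) unfolding optimal_def by auto
  note e = edges_of_multi_circuit[OF this]
  show "selection_of (edges_of \<tau>) = \<tau>" by (rule e(2))
  show "real_maximal A \<mu> (edges_of \<tau>)" using e assms real_maximal_iff by metis
qed

lemma SUP_single:
  fixes f :: "'a \<Rightarrow> ereal"
  assumes "\<And>k. k \<noteq> a \<Longrightarrow> f k = -\<infinity>"
  shows "(SUP k. f k) = f a"
  by (rule antisym) (use assms in \<open>auto intro!: SUP_least SUP_upper2[of a], metis ereal_infty_less_eq(2) linear\<close>)

subsection \<open>The equation of a multi-circuit and its critical circuits\<close>

definition on_part :: "ereal ^ 'n ^ 'n \<Rightarrow> ereal \<Rightarrow> ('n \<times> 'n) set \<Rightarrow> ereal ^ 'n ^ 'n" where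
  "on_part A l C = mp_mat_add (mat_on A C) (mp_mat_scale l (unit_off C))"

definition off_part :: "ereal ^ 'n ^ 'n \<Rightarrow> ereal \<Rightarrow> ('n \<times> 'n) set \<Rightarrow> ereal ^ 'n ^ 'n" where
  "off_part A l C = mp_mat_add (mat_off A C) (mp_mat_scale l (unit_on C))"

lemma on_part_entry:
  assumes "permutation_graph C" "l \<noteq> \<infinity>"
  shows "on_part A l C $ s $ j =
    (if j = target s (selection_of C s) then coef A l s (selection_of C s) else -\<infinity>)"
proof (cases "selection_of C s")
  case None
  hence s: "s \<notin> Field C" by (simp add: selection_of_None)
  hence "(s, j) \<notin> C" by (auto intro: FieldI1)
  thus ?thesis using s None assms(2)
    by (auto simp: on_part_def mp_mat_add_def mat_on_def mp_mat_scale_def unit_off_def)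
next
  case (Some k)
  hence s: "s \<in> Field C" using selection_of_None[of C s] by auto
  have "(s, j) \<in> C \<longleftrightarrow> j = k" using selection_of_Some[OF assms(1), of s j] Some by auto
  thus ?thesis using s Some assms(2)
    by (auto simp: add_MInfty on_part_def mp_mat_add_def mat_on_def mp_mat_scale_def unit_off_def)
qed

text \<open>Equality can fail: on the diagonal of a vertex of \<open>C\<close> whose loop is not in
  \<open>C\<close>, both \<open>None\<close> and \<open>Some s\<close> are left over, and the entry
  is the larger of their coefficients.\<close>

lemma off_part_ge:
  assumes "permutation_graph C" "c \<noteq> selection_of C s"
  shows "coef A l s c \<le> off_part A l C $ s $ target s c"
proof (cases c)
  case None
  hence "s \<in> Field C" using assms(2) selection_of_None[of C s] by auto
  thus ?thesis using None
    by (simp add: off_part_def mp_mat_add_def mat_off_def mp_mat_scale_def unit_on_def)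
next
  case (Some j)
  hence "(s, j) \<notin> C" using selection_of_Some[OF assms(1), of s j] assms(2) by auto
  thus ?thesis using Some
    by (simp add: off_part_def mp_mat_add_def mat_off_def mp_mat_scale_def unit_on_def)
qed

lemma off_part_cases:
  assumes "permutation_graph C" "l \<noteq> \<infinity>" "off_part A l C $ s $ j \<noteq> -\<infinity>"
  obtains c where "c \<noteq> selection_of C s" "target s c = j" "off_part A l C $ s $ j = coef A l s c"
proof -
  have e: "off_part A l C $ s $ j =
     max (if (s, j) \<in> C then -\<infinity> else A $ s $ j) (if s = j \<and> s \<in> Field C then l else -\<infinity>)"
    using assms(2) by (auto simp: add_MInfty off_part_def mp_mat_add_def mat_off_def mp_mat_scale_def unit_on_def)
  show thesis
  proof (cases "(s, j) \<notin> C \<and> off_part A l C $ s $ j = A $ s $ j")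
    case True
    hence "selection_of C s \<noteq> Some j" using selection_of_Some[OF assms(1), of s j] by simp
    thus ?thesis using that[of "Some j"] True by auto
  next
    case False
    hence "s = j \<and> s \<in> Field C \<and> off_part A l C $ s $ j = l"
      using e assms(3) by (auto simp: max_def split: if_splits)
    thus ?thesis using that[of None] selection_of_None[of C s] by auto
  qed
qed

lemma Rmax_mat_parts:
  assumes "A \<in> Rmax_mat" "l \<noteq> \<infinity>"
  shows "on_part A l C \<in> Rmax_mat" "off_part A l C \<in> Rmax_mat"
  using assms
  by (auto simp: on_part_def off_part_def mp_mat_add_def mat_on_def mat_off_def mp_mat_scale_def
      unit_on_def unit_off_def Rmax_mat_def Rmax_def max_def)

text \<open>In row \<open>s\<close> one side of the equation reduces to the picked term, the other
  is the maximum over the remaining terms.\<close>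

lemma W_circuit_row:
  fixes A :: "ereal ^ 'n ^ 'n"
  assumes A: "A \<in> Rmax_mat" and l: "l \<noteq> \<infinity>" and C: "permutation_graph C" and W: "x \<in> W_circuit A l C"
  shows "x \<in> Rmax_vec" "dominates A l (selection_of C) x"
    "val A l x s (selection_of C s) \<noteq> -\<infinity> \<Longrightarrow>
       \<exists>c. c \<noteq> selection_of C s \<and> val A l x s c = val A l x s (selection_of C s)"
proof -
  let ?\<tau> = "selection_of C"
  show x: "x \<in> Rmax_vec" using W by (simp add: W_circuit_def)
  have on: "(SUP j. on_part A l C $ s $ j + x $ j) = val A l x s (?\<tau> s)" for s
  proof -
    have "(SUP j. on_part A l C $ s $ j + x $ j) = on_part A l C $ s $ target s (?\<tau> s) + x $ target s (?\<tau> s)"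
      using Rmax_vec_not_PInf[OF x] by (intro SUP_single) (auto simp: on_part_entry[OF C l])
    thus ?thesis by (simp add: on_part_entry[OF C l] val_def)
  qed
  have eq: "(SUP j. off_part A l C $ s $ j + x $ j) = val A l x s (?\<tau> s)" for s
  proof -
    have "mp_mat_vec (off_part A l C) x = mp_mat_vec (on_part A l C) x"
      using W by (simp add: W_circuit_def on_part_def off_part_def)
    from arg_cong[OF this, of "\<lambda>v. v $ s"] show ?thesis using on[of s] by (simp add: mp_mat_vec_def)
  qed
  show "dominates A l ?\<tau> x"
    unfolding dominates_def
  proof (intro allI)
    fix s c
    show "val A l x s c \<le> val A l x s (?\<tau> s)"
    proof (cases "c = ?\<tau> s")
      case False
      have "val A l x s c \<le> off_part A l C $ s $ target s c + x $ target s c"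
        unfolding val_def by (rule add_right_mono[OF off_part_ge[OF C False]])
      also have "\<dots> \<le> (SUP j. off_part A l C $ s $ j + x $ j)" by (rule SUP_upper) simp
      finally show ?thesis using eq by simp
    qed simp
  qed
  show "\<exists>c. c \<noteq> ?\<tau> s \<and> val A l x s c = val A l x s (?\<tau> s)" if fin: "val A l x s (?\<tau> s) \<noteq> -\<infinity>"
  proof -
    let ?g = "\<lambda>j. off_part A l C $ s $ j + x $ j"
    have "Sup (range ?g) \<in> range ?g" using Max_Sup[of "range ?g"] Max_in[of "range ?g"] by simp
    then obtain j where j: "?g j = val A l x s (?\<tau> s)" using eq[of s] by auto
    have "off_part A l C $ s $ j \<noteq> -\<infinity>"
    proof
      assume "off_part A l C $ s $ j = -\<infinity>"
      thus False using j fin add_MInfty(2)[OF Rmax_vec_not_PInf[OF x, of j]] by simp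
    qed
    then obtain c where "c \<noteq> ?\<tau> s" "target s c = j" "off_part A l C $ s $ j = coef A l s c"
      by (rule off_part_cases[OF C l])
    thus ?thesis using j by (auto simp: val_def)
  qed
qed

text \<open>If the maximal term \<open>c\<close> is not the picked one, the picked one is the
  second; otherwise the equation supplies a second.\<close>

lemma W_circuit_tropical:
  fixes A :: "ereal ^ 'n ^ 'n"
  assumes "A \<in> Rmax_mat" "l \<noteq> \<infinity>" "permutation_graph C" "x \<in> W_circuit A l C"
  shows "tropical A l x"
  unfolding tropical_def
proof (intro allI impI)
  fix s c
  assume max: "\<forall>d. val A l x s d \<le> val A l x s c" and fin: "val A l x s c \<noteq> -\<infinity>"
  let ?\<tau> = "selection_of C"
  have eq: "val A l x s c = val A l x s (?\<tau> s)"
    using max W_circuit_row(2)[OF assms] unfolding dominates_def by (meson antisym)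
  show "\<exists>d. d \<noteq> c \<and> val A l x s d = val A l x s c"
    using W_circuit_row(3)[OF assms, of s] eq fin by metis
qed

text \<open>The first factor of \<open>B_mat\<close> has one finite entry per row, at the picked
  column. Its inverse is the negated transpose, which moves row \<open>row_of \<tau> j\<close> to
  position \<open>j\<close>.\<close>

lemma B_mat_eq:
  fixes A :: "ereal ^ 'n ^ 'n"
  assumes A: "A \<in> Rmax_mat" and C: "multi_circuit A C"
  defines "\<tau> \<equiv> selection_of C"
  shows "B_mat A (ereal l) C $ j $ m =
    off_part A l C $ row_of \<tau> j $ m - coef A l (row_of \<tau> j) (\<tau> (row_of \<tau> j))"
proof -
  note pg = multi_circuit_permutation_graph(1)[OF C]
  have sel: "selection \<tau>" unfolding \<tau>_def by (rule selection_selection_of[OF pg])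
  have l: "ereal l \<noteq> \<infinity>" by simp
  let ?P = "on_part A l C" and ?Q = "off_part A l C"
  define c where "c s = real_of_ereal (coef A l s (\<tau> s))" for s
  have c: "coef A l s (\<tau> s) = ereal (c s)" for s
    unfolding c_def using multi_circuit_supported[OF C, of l]
    by (intro coef_real[OF A l]) (simp add: supported_def \<tau>_def)
  have P: "?P $ s $ k = (if k = target s (\<tau> s) then ereal (c s) else -\<infinity>)" for s k
    unfolding on_part_entry[OF pg l] using c[of s] by (simp add: \<tau>_def)
  define N :: "ereal ^ 'n ^ 'n" where
    "N = (\<chi> k s. if k = target s (\<tau> s) then ereal (- c s) else -\<infinity>)"
  have N: "N $ k $ s = (if k = target s (\<tau> s) then ereal (- c s) else -\<infinity>)" for k s
    by (simp add: N_def)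
  have NR: "N \<in> Rmax_mat" by (simp add: Rmax_mat_def Rmax_def N)
  have inj: "target s (\<tau> s) = target t (\<tau> t) \<longleftrightarrow> s = t" for s t
    using sel unfolding selection_def bij_def by (auto dest: injD)
  have left: "mp_mat_mult ?P M $ s $ t = ereal (c s) + M $ target s (\<tau> s) $ t" if "M \<in> Rmax_mat" for M s t
  proof -
    have "M $ k $ t \<noteq> \<infinity>" for k using that by (simp add: Rmax_mat_def Rmax_def)
    hence "(SUP k. ?P $ s $ k + M $ k $ t) = ?P $ s $ target s (\<tau> s) + M $ target s (\<tau> s) $ t"
      by (intro SUP_single) (simp add: P add_MInfty)
    thus ?thesis by (simp add: mp_mat_mult_def P)
  qed
  have right: "mp_mat_mult N M $ k $ t = ereal (- c (row_of \<tau> k)) + M $ row_of \<tau> k $ t" if "M \<in> Rmax_mat" for M k t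
  proof -
    have "M $ s $ t \<noteq> \<infinity>" for s using that by (simp add: Rmax_mat_def Rmax_def)
    moreover have "k \<noteq> target s (\<tau> s)" if "s \<noteq> row_of \<tau> k" for s using that sel by auto
    ultimately have "(SUP s. N $ k $ s + M $ s $ t) = N $ k $ row_of \<tau> k + M $ row_of \<tau> k $ t"
      by (intro SUP_single) (simp add: N add_MInfty)
    thus ?thesis using sel by (simp add: mp_mat_mult_def N)
  qed
  have "mp_inverse ?P = N"
    unfolding mp_inverse_def
  proof (rule the_equality, intro conjI)
    show "N \<in> Rmax_mat" by (rule NR)
    show "mp_mat_mult ?P N = mp_unit"
      unfolding vec_eq_iff left[OF NR] by (auto simp: N mp_unit_def inj zero_ereal_def)
    show "mp_mat_mult N ?P = mp_unit"
      unfolding vec_eq_iff right[OF Rmax_mat_parts(1)[OF A l]] using sel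
      by (auto simp: P mp_unit_def zero_ereal_def)
  next
    fix M assume "M \<in> Rmax_mat \<and> mp_mat_mult ?P M = mp_unit \<and> mp_mat_mult M ?P = mp_unit"
    hence M: "M \<in> Rmax_mat" "mp_mat_mult ?P M = mp_unit" by auto
    have "M $ k $ t = N $ k $ t" for k t
    proof -
      have "ereal (c (row_of \<tau> k)) + M $ k $ t = (if row_of \<tau> k = t then 0 else -\<infinity>)"
        using left[OF M(1), of "row_of \<tau> k" t] M(2) sel by (simp add: mp_unit_def)
      moreover have "k = target t (\<tau> t) \<longleftrightarrow> row_of \<tau> k = t" using sel by auto
      ultimately show ?thesis by (cases "M $ k $ t") (auto simp: N zero_ereal_def split: if_splits)
    qed
    thus "M = N" by (simp add: vec_eq_iff)
  qed
  hence "B_mat A l C $ j $ m = ereal (- c (row_of \<tau> j)) + ?Q $ row_of \<tau> j $ m"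
    using right[OF Rmax_mat_parts(2)[OF A l]] by (simp add: B_mat_def on_part_def off_part_def)
  thus ?thesis unfolding c by (cases "?Q $ row_of \<tau> j $ m") auto
qed

section \<open>Circuits of \<open>B_mat\<close> and exchanges\<close>

lemma path_edges:
  assumes "rtrancl_path r x xs y"
  shows "set (zip (x # xs) (xs @ [z])) \<subseteq> insert (y, z) {(a, b). r a b}"
    "(y, z) \<in> set (zip (x # xs) (xs @ [z]))"
  using assms by (induction rule: rtrancl_path.induct) auto

text \<open>A repetition-free path from \<open>m\<close> to \<open>j\<close> is closed by the edge
  \<open>(j, m)\<close>, which is the last pair when \<open>m # ys\<close> is zipped with its
  rotation.\<close>

lemma circuit_through_edge:
  assumes "(j, m) \<in> E" "(m, j) \<in> E\<^sup>*"
  obtains vs where "vs \<noteq> []" "distinct vs" "set (zip vs (rotate1 vs)) \<subseteq> E" "(j, m) \<in> set (zip vs (rotate1 vs))"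
proof -
  have "(\<lambda>a b. (a, b) \<in> E)\<^sup>*\<^sup>* m j" using assms(2) by (simp add: rtranclp_rtrancl_eq)
  then obtain xs where "rtrancl_path (\<lambda>a b. (a, b) \<in> E) m xs j"
    by (auto simp: rtranclp_eq_rtrancl_path)
  then obtain ys where ys: "rtrancl_path (\<lambda>a b. (a, b) \<in> E) m ys j" "distinct (m # ys)"
    by (rule rtrancl_path_distinct)
  show thesis
  proof (rule that[of "m # ys"])
    show "set (zip (m # ys) (rotate1 (m # ys))) \<subseteq> E" using path_edges(1)[OF ys(1), of m] assms(1) by auto
    show "(j, m) \<in> set (zip (m # ys) (rotate1 (m # ys)))" using path_edges(2)[OF ys(1), of m] by simp
  qed (use ys in auto)
qed

text \<open>A circuit of \<open>B_mat\<close> is an exchange along its vertices, and its weight is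
  the gain of that exchange, at most 0 by optimality.\<close>

lemma B_mat_circuit_weight:
  fixes A :: "ereal ^ 'n ^ 'n"
  assumes A: "A \<in> Rmax_mat" and C: "multi_circuit A C" "optimal A (ereal l) (selection_of C)"
    and D: "elementary_circuit (B_mat A (ereal l) C) D"
  shows "circuit_weight (B_mat A (ereal l) C) D \<le> 0"
proof -
  let ?\<tau> = "selection_of C" and ?B = "B_mat A (ereal l) C"
  have l: "ereal l \<noteq> \<infinity>" by simp
  note pg = multi_circuit_permutation_graph(1)[OF C(1)]
  have sel: "selection ?\<tau>" "supported A l ?\<tau>" using C(2) by (auto simp: optimal_def)
  obtain \<rho> K where D': "\<rho> permutes K" "K \<noteq> {}" "D = (\<lambda>j. (j, \<rho> j)) ` K" "D \<subseteq> graph_edges ?B"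
    by (rule elementary_circuit_permutation[OF D])
  have "\<exists>c. target (row_of ?\<tau> j) c = \<rho> j \<and> coef A l (row_of ?\<tau> j) c \<noteq> -\<infinity> \<and>
      ?B $ j $ \<rho> j = coef A l (row_of ?\<tau> j) c - coef A l (row_of ?\<tau> j) (?\<tau> (row_of ?\<tau> j))" if "j \<in> K" for j
  proof -
    have "?B $ j $ \<rho> j \<noteq> -\<infinity>" using D'(3,4) that by (auto simp: graph_edges_def)
    moreover have "coef A l (row_of ?\<tau> j) (?\<tau> (row_of ?\<tau> j)) \<noteq> -\<infinity>"
      "coef A l (row_of ?\<tau> j) (?\<tau> (row_of ?\<tau> j)) \<noteq> \<infinity>"
      using sel(2) coef_not_PInf[OF A l] by (auto simp: supported_def)
    ultimately have nm: "off_part A l C $ row_of ?\<tau> j $ \<rho> j \<noteq> -\<infinity>"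
      unfolding B_mat_eq[OF A C(1)]
      by (cases "coef A l (row_of ?\<tau> j) (?\<tau> (row_of ?\<tau> j))") auto
    obtain c where "target (row_of ?\<tau> j) c = \<rho> j"
      "off_part A l C $ row_of ?\<tau> j $ \<rho> j = coef A l (row_of ?\<tau> j) c"
      by (rule off_part_cases[OF pg l nm])
    thus ?thesis using nm unfolding B_mat_eq[OF A C(1)] by metis
  qed
  then obtain \<kappa> where \<kappa>: "\<And>j. j \<in> K \<Longrightarrow> target (row_of ?\<tau> j) (\<kappa> j) = \<rho> j"
    "\<And>j. j \<in> K \<Longrightarrow> coef A l (row_of ?\<tau> j) (\<kappa> j) \<noteq> -\<infinity>"
    "\<And>j. j \<in> K \<Longrightarrow> ?B $ j $ \<rho> j = coef A l (row_of ?\<tau> j) (\<kappa> j) - coef A l (row_of ?\<tau> j) (?\<tau> (row_of ?\<tau> j))"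
    by metis
  have "bij_betw (succ ?\<tau> \<kappa>) K K \<longleftrightarrow> bij_betw \<rho> K K"
    by (rule bij_betw_cong) (simp add: succ_def \<kappa>(1))
  hence bij: "bij_betw (succ ?\<tau> \<kappa>) K K" using permutes_imp_bij[OF D'(1)] by simp
  define w where "w j = real_of_ereal (coef A l (row_of ?\<tau> j) (\<kappa> j)) -
       real_of_ereal (coef A l (row_of ?\<tau> j) (?\<tau> (row_of ?\<tau> j)))" for j
  have Bw: "?B $ j $ \<rho> j = ereal (w j)" if "j \<in> K" for j
    unfolding \<kappa>(3)[OF that] w_def
    using coef_real[OF A l \<kappa>(2)[OF that]] coef_real[OF A l, of "row_of ?\<tau> j" "?\<tau> (row_of ?\<tau> j)"] sel(2)
    unfolding supported_def by (metis ereal_minus(1))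
  have "weight A l (exchange ?\<tau> \<kappa> K) \<le> weight A l ?\<tau>"
    using C(2) selection_exchange[OF sel(1) bij] supported_exchange[OF sel \<kappa>(2)] unfolding optimal_def by blast
  hence le: "sum w K \<le> 0" unfolding weight_exchange[OF sel(1)] w_def by simp
  have "circuit_weight ?B D = (\<Sum>j\<in>K. ?B $ j $ \<rho> j)"
    unfolding circuit_weight_def D'(3) by (subst sum.reindex) (auto simp: inj_on_def)
  also have "\<dots> = ereal (sum w K)" using Bw by simp
  finally show ?thesis using le by simp
qed

lemma average_weight_zero:
  assumes "elementary_circuit B D"
  shows "circuit_weight B D \<le> 0 \<Longrightarrow> average_weight B D \<le> 0"
    "circuit_weight B D = 0 \<Longrightarrow> average_weight B D = 0"
proof -
  show "average_weight B D = 0" if "circuit_weight B D = 0" using that by (simp add: average_weight_def)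
  show "average_weight B D \<le> 0" if "circuit_weight B D \<le> 0"
    unfolding average_weight_def using that
    by (cases "circuit_weight B D"; cases "card D = 0") (auto simp: divide_le_0_iff zero_ereal_def)
qed

text \<open>Edge weights of tight edges are potential differences, so a circuit of tight edges has
  weight 0. As no circuit of \<open>B_mat\<close> has positive weight, it is critical, and the
  disjointness assumption separates such circuits.\<close>

lemma unique_circuits_of_disjoint:
  fixes A :: "ereal ^ 'n ^ 'n"
  assumes A: "A \<in> Rmax_mat" and opt: "optimal A (ereal l) \<tau>" and b: "b \<in> Rmax_vec"
    and dom: "dominates A (ereal l) \<tau> b"
    and disj: "\<And>C D D'. maximal_multi_circuit A (ereal l) C \<Longrightarrow>
           critical_circuit (B_mat A (ereal l) C) D \<Longrightarrow> critical_circuit (B_mat A (ereal l) C) D' \<Longrightarrow>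
           D \<noteq> D' \<Longrightarrow> Field D \<inter> Field D' = {}"
  shows "unique_circuits A (ereal l) \<tau> b"
proof -
  have l: "ereal l \<noteq> \<infinity>" by simp
  define C where "C = edges_of \<tau>"
  have rm: "real_maximal A l C" and \<tau>: "selection_of C = \<tau>"
    using real_maximal_edges_of[OF A opt] by (auto simp: C_def)
  have mc: "multi_circuit A C" using rm by (simp add: real_maximal_def)
  have sel: "selection \<tau>" "supported A l \<tau>" using opt by (auto simp: optimal_def)
  note pg = multi_circuit_permutation_graph(1)[OF mc]
  let ?B = "B_mat A (ereal l) C" and ?E = "tight A l \<tau> b"
  have edge: "?B $ j $ m = ereal (real_of_ereal (b $ j) - real_of_ereal (b $ m))" if "(j, m) \<in> ?E" for j m
  proof -
    obtain c where c: "tight_at A l \<tau> b j c" "m = target (row_of \<tau> j) c"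
      using \<open>(j, m) \<in> ?E\<close> by (auto simp: tight_def)
    note f = tight_at_target[OF A l b sel(1) c(1), folded c(2)]
    let ?s = "row_of \<tau> j" let ?u = "coef A l ?s (\<tau> ?s)"
    have fin: "?u = ereal (real_of_ereal ?u)" "b $ j = ereal (real_of_ereal (b $ j))"
      "b $ m = ereal (real_of_ereal (b $ m))"
      using coef_real[OF A l f(2)] ereal_finite[OF f(3) Rmax_vec_not_PInf[OF b]]
        ereal_finite[OF f(4) Rmax_vec_not_PInf[OF b]] by blast+
    have ge: "coef A l ?s c \<le> off_part A l C $ ?s $ m"
      using off_part_ge[OF pg, of c ?s A l] c unfolding \<tau> tight_at_def by simp
    have nm: "off_part A l C $ ?s $ m \<noteq> -\<infinity>" using ge f(1) by auto
    \<comment> \<open>The entry of \<open>B_mat\<close> may stem from another term \<open>d\<close>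
      with the same target; domination shows that its coefficient does not exceed that of
      \<open>c\<close>.\<close>
    obtain d where d: "target ?s d = m" "off_part A l C $ ?s $ m = coef A l ?s d"
      by (rule off_part_cases[OF pg l nm])
    have "val A l b ?s d \<le> val A l b ?s (\<tau> ?s)" using dom by (simp add: dominates_def)
    also have "\<dots> = val A l b ?s c" using c(1) by (simp add: tight_at_def)
    finally have "coef A l ?s d + b $ m \<le> coef A l ?s c + b $ m" using d(1) c(2) by (simp add: val_def)
    moreover obtain r where "b $ m = ereal r" using fin(3) by blast
    ultimately have "coef A l ?s d \<le> coef A l ?s c"
      by (cases "coef A l ?s d"; cases "coef A l ?s c") auto
    hence Q: "off_part A l C $ ?s $ m = coef A l ?s c" using ge d(2) by simp
    have "?B $ j $ m = coef A l ?s c - ?u" unfolding B_mat_eq[OF A mc] \<tau> Q ..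
    also have "\<dots> = ereal (real_of_ereal (coef A l ?s c) - real_of_ereal ?u)"
      using coef_real[OF A l f(1)] fin(1) by (metis ereal_minus(1))
    finally show ?thesis using f(5) by simp
  qed
  have max_le: "max_average_weight ?B \<le> 0"
    unfolding max_average_weight_def
    using average_weight_zero(1) B_mat_circuit_weight[OF A mc] opt \<tau> by (intro SUP_least) auto
  have crit: "critical_circuit ?B (set (zip vs (rotate1 vs)))"
    if vs: "vs \<noteq> []" "distinct vs" "set (zip vs (rotate1 vs)) \<subseteq> ?E" for vs
  proof -
    let ?D = "set (zip vs (rotate1 vs))" and ?\<rho> = "cycle_of_list vs"
    have "?D \<subseteq> graph_edges ?B" using vs(3) edge by (force simp: graph_edges_def)
    hence el: "elementary_circuit ?B ?D" using vs unfolding elementary_circuit_def by blast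
    have "circuit_weight ?B ?D = (\<Sum>j\<in>set vs. ?B $ j $ ?\<rho> j)"
      unfolding circuit_weight_def zip_rotate1[OF vs(2)] by (subst sum.reindex) (auto simp: inj_on_def)
    also have "\<dots> = (\<Sum>j\<in>set vs. ereal (real_of_ereal (b $ j) - real_of_ereal (b $ ?\<rho> j)))"
      by (rule sum.cong) (use vs(3) edge in \<open>auto simp: zip_rotate1[OF vs(2)]\<close>)
    also have "\<dots> = ereal ((\<Sum>j\<in>set vs. real_of_ereal (b $ j)) - (\<Sum>j\<in>set vs. real_of_ereal (b $ ?\<rho> j)))"
      by (simp add: sum_subtractf)
    also have "\<dots> = 0"
      using sum.reindex_bij_betw[OF permutes_imp_bij[OF cycle_permutes], of "\<lambda>j. real_of_ereal (b $ j)" vs]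
      by (simp add: zero_ereal_def)
    finally have "average_weight ?B ?D = 0" by (rule average_weight_zero(2)[OF el])
    moreover have "average_weight ?B ?D \<le> max_average_weight ?B"
      unfolding max_average_weight_def by (rule SUP_upper) (use el in simp)
    ultimately show ?thesis using el max_le unfolding critical_circuit_def by (metis antisym)
  qed
  show ?thesis
    unfolding unique_circuits_def
  proof (intro allI impI)
    fix j m m'
    assume jm: "(j, m) \<in> ?E" "(j, m') \<in> ?E" "(m, j) \<in> ?E\<^sup>*" "(m', j) \<in> ?E\<^sup>*"
    obtain vs where vs: "vs \<noteq> []" "distinct vs" "set (zip vs (rotate1 vs)) \<subseteq> ?E" "(j, m) \<in> set (zip vs (rotate1 vs))"
      by (rule circuit_through_edge[OF jm(1,3)])
    obtain ws where ws: "ws \<noteq> []" "distinct ws" "set (zip ws (rotate1 ws)) \<subseteq> ?E" "(j, m') \<in> set (zip ws (rotate1 ws))"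
      by (rule circuit_through_edge[OF jm(2,4)])
    have "maximal_multi_circuit A (ereal l) C" using rm by (simp add: maximal_multi_circuit_def)
    moreover have "j \<in> Field (set (zip vs (rotate1 vs))) \<inter> Field (set (zip ws (rotate1 ws)))"
      using vs(4) ws(4) by (auto intro: FieldI1)
    ultimately have "set (zip vs (rotate1 vs)) = set (zip ws (rotate1 ws))"
      using disj crit[OF vs(1-3)] crit[OF ws(1-3)] by blast
    thus "m = m'" using vs(4) ws(4) unfolding zip_rotate1[OF vs(2)] zip_rotate1[OF ws(2)] by auto
  qed
qed

subsection \<open>Consequences of the star condition\<close>

lemma supported_ereal_iff:
  "supported A (ereal \<mu>) \<tau> \<longleftrightarrow> (\<forall>s j. \<tau> s = Some j \<longrightarrow> A $ s $ j \<noteq> -\<infinity>)"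
proof -
  have "coef A (ereal \<mu>) s (\<tau> s) \<noteq> -\<infinity> \<longleftrightarrow> (\<forall>j. \<tau> s = Some j \<longrightarrow> A $ s $ j \<noteq> -\<infinity>)" for s
    by (cases "\<tau> s") auto
  thus ?thesis by (simp add: supported_def)
qed

lemma optimal_eventually:
  fixes A :: "ereal ^ 'n ^ 'n"
  obtains \<tau> where "\<forall>\<^sub>F \<mu> in at_bot. optimal A (ereal \<mu>) \<tau>"
proof -
  define T where "T = {\<tau>. selection \<tau> \<and> supported A (ereal 0) \<tau>}"
  define k where "k \<tau> = card {s. \<tau> s \<noteq> None}" for \<tau> :: "'n \<Rightarrow> 'n option"
  define w where "w \<tau> = (\<Sum>s\<in>{s. \<tau> s \<noteq> None}. real_of_ereal (A $ s $ target s (\<tau> s)))" for \<tau>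
  have "T \<noteq> {}" using supported_None(1)[of A 0] supported_None(2) unfolding T_def by blast
  \<comment> \<open>For very negative \<open>\<mu>\<close> the length decides first and the weight second.\<close>
  define kmax where "kmax = Max (k ` T)"
  have kmax: "k \<tau> \<le> kmax" if "\<tau> \<in> T" for \<tau> using that by (simp add: kmax_def)
  have "kmax \<in> k ` T" unfolding kmax_def using \<open>T \<noteq> {}\<close> by (intro Max_in) auto
  hence ne: "{\<tau>\<in>T. k \<tau> = kmax} \<noteq> {}" by auto
  hence "Max (w ` {\<tau>\<in>T. k \<tau> = kmax}) \<in> w ` {\<tau>\<in>T. k \<tau> = kmax}" by (intro Max_in) auto
  then obtain \<tau> where \<tau>: "\<tau> \<in> T" "k \<tau> = kmax" "w \<tau> = Max (w ` {\<tau>\<in>T. k \<tau> = kmax})" by auto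
  have w: "w \<rho> \<le> w \<tau>" if "\<rho> \<in> T" "k \<rho> = kmax" for \<rho> using that unfolding \<tau>(3) by (intro Max_ge) auto
  have "\<forall>\<^sub>F \<mu> in at_bot. weight A (ereal \<mu>) \<rho> \<le> weight A (ereal \<mu>) \<tau>" if \<rho>: "\<rho> \<in> T" for \<rho>
  proof (cases "k \<rho> = kmax")
    case True
    thus ?thesis using w[OF \<rho> True] \<tau>(2)
      unfolding weight_split k_def[symmetric] w_def[symmetric] by simp
  next
    case False
    hence less: "k \<rho> < k \<tau>" using kmax[OF \<rho>] \<tau>(2) by simp
    \<comment> \<open>At this value of \<open>\<mu>\<close> the two affine weights cross; below it
      the longer selection is at least as heavy.\<close>
    show ?thesis
      using eventually_le_at_bot[of "(w \<tau> - w \<rho>) / (real (k \<tau>) - real (k \<rho>))"]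
    proof eventually_elim
      case (elim \<mu>)
      hence "\<mu> * (real (k \<tau>) - real (k \<rho>)) \<le> w \<tau> - w \<rho>"
        using less by (simp add: pos_le_divide_eq)
      thus ?case unfolding weight_split k_def[symmetric] w_def[symmetric] by (simp add: algebra_simps)
    qed
  qed
  hence "\<forall>\<^sub>F \<mu> in at_bot. \<forall>\<rho>\<in>T. weight A (ereal \<mu>) \<rho> \<le> weight A (ereal \<mu>) \<tau>"
    by (intro eventually_ball_finite) auto
  hence "\<forall>\<^sub>F \<mu> in at_bot. optimal A (ereal \<mu>) \<tau>"
  proof eventually_elim
    case (elim \<mu>)
    have "selection \<rho> \<and> supported A (ereal \<mu>) \<rho> \<longleftrightarrow> \<rho> \<in> T" for \<rho>
      by (simp add: T_def supported_ereal_iff)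
    thus ?case using elim \<tau>(1) unfolding optimal_def by simp
  qed
  thus thesis by (rule that)
qed

lemma some_maximal_maximal:
  fixes A :: "ereal ^ 'n ^ 'n"
  assumes A: "A \<in> Rmax_mat" and l: "l \<noteq> \<infinity>"
  shows "maximal_multi_circuit A l (some_maximal A l)"
proof -
  have "\<exists>C. maximal_multi_circuit A l C"
  proof (cases l)
    case (real \<mu>)
    obtain \<tau> where "optimal A (ereal \<mu>) \<tau>" by (rule optimal_exists[OF A])
    hence "real_maximal A \<mu> (edges_of \<tau>)" by (rule real_maximal_edges_of(1)[OF A])
    thus ?thesis using real unfolding maximal_multi_circuit_def by blast
  next
    case MInf
    obtain \<tau> where "\<forall>\<^sub>F \<mu> in at_bot. optimal A (ereal \<mu>) \<tau>" by (rule optimal_eventually)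
    hence "\<forall>\<^sub>F \<mu> in at_bot. real_maximal A \<mu> (edges_of \<tau>)"
      by eventually_elim (rule real_maximal_edges_of(1)[OF A])
    thus ?thesis using MInf unfolding maximal_multi_circuit_def by blast
  qed (use l in simp)
  thus ?thesis unfolding some_maximal_def by (rule someI_ex)
qed

lemma maximal_multi_circuitD:
  assumes "maximal_multi_circuit A l C"
  shows "multi_circuit A C"
proof -
  have "\<exists>\<mu>. real_maximal A \<mu> C"
  proof (cases "\<exists>\<mu>. l = ereal \<mu> \<and> real_maximal A \<mu> C")
    case False
    hence "\<forall>\<^sub>F \<mu> in at_bot. real_maximal A \<mu> C" using assms by (auto simp: maximal_multi_circuit_def)
    thus ?thesis using eventually_happens'[OF trivial_limit_at_bot_linorder] by blast
  qed blast
  thus ?thesis by (auto simp: real_maximal_def)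
qed

lemma maximal_multi_circuit_ereal:
  "maximal_multi_circuit A (ereal \<mu>) C \<longleftrightarrow> real_maximal A \<mu> C"
  by (simp add: maximal_multi_circuit_def)

text \<open>Rows are counted through their picked columns, and outside \<open>K\<close> nothing
  changes. The additive form avoids subtraction of natural numbers.\<close>

lemma card_None_exchange:
  fixes \<tau> :: "'n::finite \<Rightarrow> 'n option"
  assumes "selection \<tau>"
  shows "card {s. exchange \<tau> \<kappa> K s = None} + card {j\<in>K. \<tau> (row_of \<tau> j) = None} =
    card {s. \<tau> s = None} + card {j\<in>K. \<kappa> j = None}"
proof -
  have col: "card {s. \<phi> s = None} = card {j\<in>K. \<phi> (row_of \<tau> j) = None} + card {j\<in>-K. \<phi> (row_of \<tau> j) = None}"
    for \<phi> :: "'n \<Rightarrow> 'n option"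
  proof -
    have "bij_betw (row_of \<tau>) {j. \<phi> (row_of \<tau> j) = None} {s. \<phi> s = None}"
      using bij_row[OF assms] unfolding bij_betw_def bij_def
      by (auto intro: inj_on_subset)
    hence "card {s. \<phi> s = None} = card {j. \<phi> (row_of \<tau> j) = None}" by (simp add: bij_betw_same_card)
    also have "\<dots> = card {j\<in>K. \<phi> (row_of \<tau> j) = None} + card {j\<in>-K. \<phi> (row_of \<tau> j) = None}"
      by (subst card_Un_disjoint[symmetric]) (auto intro: arg_cong[where f=card])
    finally show ?thesis .
  qed
  have "{j\<in>K. exchange \<tau> \<kappa> K (row_of \<tau> j) = None} = {j\<in>K. \<kappa> j = None}"
    "{j\<in>-K. exchange \<tau> \<kappa> K (row_of \<tau> j) = None} = {j\<in>-K. \<tau> (row_of \<tau> j) = None}"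
    by (auto simp: exchange_row[OF assms])
  thus ?thesis using col[of \<tau>] col[of "exchange \<tau> \<kappa> K"] by simp
qed

lemma card_not_None:
  fixes \<phi> :: "'n::finite \<Rightarrow> 'n option"
  shows "card {s. \<phi> s \<noteq> None} + card {s. \<phi> s = None} = CARD('n)"
  by (subst card_Un_disjoint[symmetric]) (auto intro: arg_cong[where f=card])

lemma exchange_neq:
  assumes "selection \<tau>" "k \<in> K" "\<kappa> k \<noteq> \<tau> (row_of \<tau> k)"
  shows "exchange \<tau> \<kappa> K \<noteq> \<tau>"
  using exchange_row[OF assms(1), of \<kappa> K k] assms(2,3) by auto

lemma star_edges_of:
  fixes A :: "ereal ^ 'n ^ 'n"
  assumes star: "star_condition A" and l: "l \<in> Rmax"
    and max: "maximal_multi_circuit A l (edges_of \<tau>)" "maximal_multi_circuit A l (edges_of \<rho>)"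
    and sel: "selection_of (edges_of \<tau>) = \<tau>" "selection_of (edges_of \<rho>) = \<rho>" and "\<tau> \<noteq> \<rho>"
  shows "card {s. \<tau> s = None} \<noteq> card {s. \<rho> s = None}"
proof -
  have "edges_of \<tau> \<noteq> edges_of \<rho>" using sel \<open>\<tau> \<noteq> \<rho>\<close> by metis
  hence "card (edges_of \<tau>) \<noteq> card (edges_of \<rho>)"
    using star l max unfolding star_condition_def by blast
  moreover have "card (edges_of \<phi>) = card {s. \<phi> s \<noteq> None}"
    if "maximal_multi_circuit A l (edges_of \<phi>)" "selection_of (edges_of \<phi>) = \<phi>" for \<phi> :: "'n \<Rightarrow> 'n option"
    using card_selection_of[OF multi_circuit_permutation_graph(1)[OF maximal_multi_circuitD[OF that(1)]]] that(2)
    by simp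
  ultimately have "card {s. \<tau> s \<noteq> None} \<noteq> card {s. \<rho> s \<noteq> None}" using max sel by simp
  thus ?thesis using card_not_None[of \<tau>] card_not_None[of \<rho>] by linarith
qed

text \<open>The exchange yields a second multi-circuit that is maximal for the same
  \<open>l\<close>, and the star condition forbids equal lengths.\<close>

lemma star_cycle_real:
  fixes A :: "ereal ^ 'n ^ 'n" and l :: real
  assumes A: "A \<in> Rmax_mat" and star: "star_condition A" and opt: "optimal A l \<tau>" and x: "x \<in> Rmax_vec"
    and p: "p > 0" "(succ \<tau> \<kappa> ^^ p) k = k"
    and t: "\<And>j. j \<in> orbit_from (succ \<tau> \<kappa>) k \<Longrightarrow> tight_at A l \<tau> x j (\<kappa> j)"
  shows "card {j\<in>orbit_from (succ \<tau> \<kappa>) k. \<kappa> j = None} \<noteq>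
     card {j\<in>orbit_from (succ \<tau> \<kappa>) k. \<tau> (row_of \<tau> j) = None}"
proof -
  let ?K = "orbit_from (succ \<tau> \<kappa>) k"
  let ?\<rho> = "exchange \<tau> \<kappa> ?K"
  have sel: "selection \<tau>" using opt by (simp add: optimal_def)
  have optr: "optimal A l ?\<rho>" by (rule optimal_exchange[OF A _ x opt t orbit_from_bij[OF p]]) auto
  have "?\<rho> \<noteq> \<tau>"
    by (rule exchange_neq[OF sel orbit_from_self]) (use t[OF orbit_from_self] in \<open>simp add: tight_at_def\<close>)
  hence "card {s. ?\<rho> s = None} \<noteq> card {s. \<tau> s = None}"
    using real_maximal_edges_of[OF A opt] real_maximal_edges_of[OF A optr]
    by (intro star_edges_of[OF star, of "ereal l"]) (auto simp: Rmax_def maximal_multi_circuit_ereal)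
  thus ?thesis using card_None_exchange[OF sel, of \<kappa> ?K] by linarith
qed

text \<open>At \<open>-\<infinity>\<close> a tight term is never \<open>None\<close>. An exchange
  along a cycle would then change neither the length nor, for any real \<open>\<mu>\<close>, the
  weight, giving two distinct maximal multi-circuits of equal length.\<close>

lemma star_cycle_MInf:
  fixes A :: "ereal ^ 'n ^ 'n"
  assumes A: "A \<in> Rmax_mat" and star: "star_condition A" and C: "maximal_multi_circuit A (-\<infinity>) C"
    and x: "x \<in> Rmax_vec" and p: "p > 0" "(succ (selection_of C) \<kappa> ^^ p) k = k"
    and t: "\<And>j. j \<in> orbit_from (succ (selection_of C) \<kappa>) k \<Longrightarrow> tight_at A (-\<infinity>) (selection_of C) x j (\<kappa> j)"
  shows False
proof -
  define \<tau> where "\<tau> = selection_of C"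
  let ?K = "orbit_from (succ \<tau> \<kappa>) k"
  let ?\<rho> = "exchange \<tau> \<kappa> ?K"
  have l: "-\<infinity> \<noteq> (\<infinity> :: ereal)" by simp
  note pg = multi_circuit_permutation_graph(1)[OF maximal_multi_circuitD[OF C]]
  have sel: "selection \<tau>" unfolding \<tau>_def by (rule selection_selection_of[OF pg])
  note t = t[folded \<tau>_def] and p = p[folded \<tau>_def]
  have tK: "coef A (-\<infinity>) (row_of \<tau> j) (\<kappa> j) \<noteq> -\<infinity>" "coef A (-\<infinity>) (row_of \<tau> j) (\<tau> (row_of \<tau> j)) \<noteq> -\<infinity>"
    if "j \<in> ?K" for j using tight_at_target(1,2)[OF A l x sel t[OF that]] by auto
  have Some: "\<kappa> j \<noteq> None" "\<tau> (row_of \<tau> j) \<noteq> None" if "j \<in> ?K" for j using tK[OF that] by (metis coef_simps(1))+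
  have cf: "coef A l (row_of \<tau> j) (\<kappa> j) = coef A (-\<infinity>) (row_of \<tau> j) (\<kappa> j)"
    "coef A l (row_of \<tau> j) (\<tau> (row_of \<tau> j)) = coef A (-\<infinity>) (row_of \<tau> j) (\<tau> (row_of \<tau> j))"
    if "j \<in> ?K" for j l using Some[OF that] by auto
  have "(\<Sum>j\<in>?K. real_of_ereal (coef A (ereal \<mu>) (row_of \<tau> j) (\<kappa> j)) -
             real_of_ereal (coef A (ereal \<mu>) (row_of \<tau> j) (\<tau> (row_of \<tau> j)))) = 0" for \<mu>
  proof -
    have "(\<Sum>j\<in>?K. real_of_ereal (coef A (-\<infinity>) (row_of \<tau> j) (\<kappa> j)) -
             real_of_ereal (coef A (-\<infinity>) (row_of \<tau> j) (\<tau> (row_of \<tau> j)))) = 0"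
      by (rule exchange_tight(1)[OF A l x sel t orbit_from_bij[OF p]])
    moreover have "(\<Sum>j\<in>?K. real_of_ereal (coef A (ereal \<mu>) (row_of \<tau> j) (\<kappa> j)) -
             real_of_ereal (coef A (ereal \<mu>) (row_of \<tau> j) (\<tau> (row_of \<tau> j)))) =
        (\<Sum>j\<in>?K. real_of_ereal (coef A (-\<infinity>) (row_of \<tau> j) (\<kappa> j)) -
             real_of_ereal (coef A (-\<infinity>) (row_of \<tau> j) (\<tau> (row_of \<tau> j))))"
      by (rule sum.cong) (simp_all only: cf[of _ "ereal \<mu>"])
    ultimately show ?thesis by simp
  qed
  hence w: "weight A (ereal \<mu>) ?\<rho> = weight A (ereal \<mu>) \<tau>" for \<mu>
    unfolding weight_exchange[OF sel] by simp
  have optr: "optimal A (ereal \<mu>) ?\<rho>" if "optimal A (ereal \<mu>) \<tau>" for \<mu>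
  proof -
    have "supported A (ereal \<mu>) ?\<rho>"
      by (rule supported_exchange[OF sel]) (use that tK cf[of _ "ereal \<mu>"] in \<open>simp_all add: optimal_def\<close>)
    thus ?thesis using that w selection_exchange[OF sel orbit_from_bij[OF p]] unfolding optimal_def by simp
  qed
  have ev: "\<forall>\<^sub>F \<mu> in at_bot. real_maximal A \<mu> C" using C by (simp add: maximal_multi_circuit_def)
  have e: "edges_of \<tau> = C" unfolding \<tau>_def by (rule edges_of_selection_of[OF pg])
  have "\<forall>\<^sub>F \<mu> in at_bot. real_maximal A \<mu> (edges_of ?\<rho>) \<and> selection_of (edges_of ?\<rho>) = ?\<rho>"
    using ev
  proof eventually_elim
    case (elim \<mu>)
    hence "optimal A (ereal \<mu>) \<tau>" using real_maximal_iff[OF A] by (simp add: \<tau>_def)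
    thus ?case using real_maximal_edges_of[OF A optr] by blast
  qed
  hence "\<forall>\<^sub>F \<mu> in at_bot. real_maximal A \<mu> (edges_of ?\<rho>)" "selection_of (edges_of ?\<rho>) = ?\<rho>"
    using eventually_happens'[OF trivial_limit_at_bot_linorder, of "\<lambda>\<mu>. real_maximal A \<mu> (edges_of ?\<rho>) \<and> selection_of (edges_of ?\<rho>) = ?\<rho>"]
    by (auto elim: eventually_mono)
  hence "maximal_multi_circuit A (-\<infinity>) (edges_of ?\<rho>)" "selection_of (edges_of ?\<rho>) = ?\<rho>"
    by (simp_all add: maximal_multi_circuit_def)
  moreover have "?\<rho> \<noteq> \<tau>"
    by (rule exchange_neq[OF sel orbit_from_self]) (use t[OF orbit_from_self] in \<open>simp add: tight_at_def\<close>)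
  ultimately have "card {s. ?\<rho> s = None} \<noteq> card {s. \<tau> s = None}"
    using C e by (intro star_edges_of[OF star, of "-\<infinity>"]) (auto simp: Rmax_def \<tau>_def)
  moreover have "{j\<in>?K. \<kappa> j = None} = {}" "{j\<in>?K. \<tau> (row_of \<tau> j) = None} = {}" using Some by auto
  ultimately show False using card_None_exchange[OF sel, of \<kappa> ?K] by (simp only: card.empty)
qed

lemma choose_tight:
  fixes A :: "ereal ^ 'n ^ 'n"
  assumes A: "A \<in> Rmax_mat" and l: "l \<noteq> \<infinity>" and C: "permutation_graph C" and W: "x \<in> W_circuit A l C"
  obtains \<kappa> where "\<And>j. x $ j \<noteq> -\<infinity> \<Longrightarrow>
      coef A l (row_of (selection_of C) j) (selection_of C (row_of (selection_of C) j)) \<noteq> -\<infinity> \<Longrightarrow>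
      tight_at A l (selection_of C) x j (\<kappa> j)"
proof -
  let ?\<tau> = "selection_of C"
  have sel: "selection ?\<tau>" by (rule selection_selection_of[OF C])
  note x = W_circuit_row(1)[OF A l C W]
  have "\<exists>c. tight_at A l ?\<tau> x j c"
    if "x $ j \<noteq> -\<infinity>" "coef A l (row_of ?\<tau> j) (?\<tau> (row_of ?\<tau> j)) \<noteq> -\<infinity>" for j
  proof -
    have "val A l x (row_of ?\<tau> j) (?\<tau> (row_of ?\<tau> j)) \<noteq> -\<infinity>"
      using that sel unfolding val_finite_iff[OF A l x] by simp
    thus ?thesis using W_circuit_row(3)[OF A l C W] unfolding tight_at_def by metis
  qed
  thus thesis using that by metis
qed

lemma tight_at_succ:
  assumes "A \<in> Rmax_mat" "l \<noteq> \<infinity>" "x \<in> Rmax_vec" "selection \<tau>" "tight_at A l \<tau> x j (\<kappa> j)"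
  shows "x $ succ \<tau> \<kappa> j \<noteq> -\<infinity>"
  using tight_at_target(4)[OF assms] by (simp add: succ_def)

text \<open>Iterating a choice \<open>\<kappa>\<close> of second maxima never leaves the support of
  \<open>x\<close>. The conclusion about periodic points mentions neither the matrix nor
  \<open>x\<close>, so it can be carried through a limit.\<close>

lemma chain_real:
  fixes A :: "ereal ^ 'n ^ 'n" and l :: real
  assumes A: "A \<in> Rmax_mat" and star: "star_condition A" and C: "real_maximal A l C"
    and W: "x \<in> W_circuit A l C" and i: "x $ i \<noteq> -\<infinity>"
  obtains \<kappa> where "\<And>j. j \<in> orbit_from (succ (selection_of C) \<kappa>) i \<Longrightarrow> tight_at A l (selection_of C) x j (\<kappa> j)"
    "\<And>k p. k \<in> orbit_from (succ (selection_of C) \<kappa>) i \<Longrightarrow> p > 0 \<Longrightarrow> (succ (selection_of C) \<kappa> ^^ p) k = k \<Longrightarrow>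
       card {j\<in>orbit_from (succ (selection_of C) \<kappa>) k. \<kappa> j = None} \<noteq>
       card {j\<in>orbit_from (succ (selection_of C) \<kappa>) k. selection_of C (row_of (selection_of C) j) = None}"
proof -
  define \<tau> where "\<tau> = selection_of C"
  have l: "ereal l \<noteq> \<infinity>" by simp
  have opt: "optimal A l \<tau>" and mc: "multi_circuit A C" using C real_maximal_iff[OF A] by (auto simp: \<tau>_def)
  have sel: "selection \<tau>" "supported A l \<tau>" using opt by (auto simp: optimal_def)
  note pg = multi_circuit_permutation_graph(1)[OF mc]
  note x = W_circuit_row(1)[OF A l pg W]
  obtain \<kappa> where \<kappa>: "\<And>j. x $ j \<noteq> -\<infinity> \<Longrightarrow> coef A l (row_of \<tau> j) (\<tau> (row_of \<tau> j)) \<noteq> -\<infinity> \<Longrightarrow>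
      tight_at A l \<tau> x j (\<kappa> j)"
    by (rule choose_tight[OF A l pg W, folded \<tau>_def]) blast
  have tight: "tight_at A l \<tau> x j (\<kappa> j)" if "x $ j \<noteq> -\<infinity>" for j
    using \<kappa>[OF that] sel(2) by (simp add: supported_def)
  have fin: "x $ j \<noteq> -\<infinity>" if "j \<in> orbit_from (succ \<tau> \<kappa>) i" for j
  proof -
    have "x $ (succ \<tau> \<kappa> ^^ n) i \<noteq> -\<infinity>" for n
    proof (induction n)
      case (Suc n)
      show ?case using tight_at_target(4)[OF A l x sel(1) tight[OF Suc]] by (simp add: succ_def)
    qed (use i in simp)
    thus ?thesis using that by (auto simp: orbit_from_def)
  qed
  show thesis
  proof (rule that[folded \<tau>_def])
    show "tight_at A l \<tau> x j (\<kappa> j)" if "j \<in> orbit_from (succ \<tau> \<kappa>) i" for j using tight[OF fin[OF that]] .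
    fix k p assume k: "k \<in> orbit_from (succ \<tau> \<kappa>) i" and p: "p > 0" "(succ \<tau> \<kappa> ^^ p) k = k"
    have "orbit_from (succ \<tau> \<kappa>) k \<subseteq> orbit_from (succ \<tau> \<kappa>) i"
      using k by (auto simp: orbit_from_def funpow_add[symmetric, unfolded comp_def fun_eq_iff])
    thus "card {j\<in>orbit_from (succ \<tau> \<kappa>) k. \<kappa> j = None} \<noteq>
       card {j\<in>orbit_from (succ \<tau> \<kappa>) k. \<tau> (row_of \<tau> j) = None}"
      using tight fin by (intro star_cycle_real[OF A star opt x p]) blast
  qed
qed

text \<open>Tight cycles are impossible here, so the iteration must leave the vertices of
  \<open>C\<close>. It stops at the first vertex outside, whose row has picked value
  \<open>-\<infinity>\<close> and therefore offers no tight term.\<close>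

lemma chain_MInf:
  fixes A :: "ereal ^ 'n ^ 'n"
  assumes A: "A \<in> Rmax_mat" and star: "star_condition A" and C: "maximal_multi_circuit A (-\<infinity>) C"
    and W: "x \<in> W_circuit A (-\<infinity>) C" and i: "x $ i \<noteq> -\<infinity>"
  obtains \<kappa> n where "(succ (selection_of C) \<kappa> ^^ n) i \<notin> Field C"
    "\<And>q. q < n \<Longrightarrow> tight_at A (-\<infinity>) (selection_of C) x ((succ (selection_of C) \<kappa> ^^ q) i) (\<kappa> ((succ (selection_of C) \<kappa> ^^ q) i))"
proof -
  define \<tau> where "\<tau> = selection_of C"
  have l: "-\<infinity> \<noteq> (\<infinity> :: ereal)" by simp
  note mc = maximal_multi_circuitD[OF C]
  note pg = multi_circuit_permutation_graph(1)[OF mc]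
  have sel: "selection \<tau>" unfolding \<tau>_def by (rule selection_selection_of[OF pg])
  note x = W_circuit_row(1)[OF A l pg W]
  obtain \<kappa> where \<kappa>: "\<And>j. x $ j \<noteq> -\<infinity> \<Longrightarrow> coef A (-\<infinity>) (row_of \<tau> j) (\<tau> (row_of \<tau> j)) \<noteq> -\<infinity> \<Longrightarrow>
      tight_at A (-\<infinity>) \<tau> x j (\<kappa> j)"
    by (rule choose_tight[OF A l pg W, folded \<tau>_def]) blast
  let ?f = "succ \<tau> \<kappa>"
  have tight: "tight_at A (-\<infinity>) \<tau> x j (\<kappa> j)" if j: "x $ j \<noteq> -\<infinity>" "j \<in> Field C" for j
  proof (rule \<kappa>[OF j(1)])
    have "\<tau> (row_of \<tau> j) \<noteq> None"
    proof
      assume n: "\<tau> (row_of \<tau> j) = None"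
      hence "row_of \<tau> j = j" by (rule row_None'[OF sel])
      thus False using n j(2) selection_of_None[of C j] by (simp add: \<tau>_def)
    qed
    then obtain k where "\<tau> (row_of \<tau> j) = Some k" by blast
    thus "coef A (-\<infinity>) (row_of \<tau> j) (\<tau> (row_of \<tau> j)) \<noteq> -\<infinity>"
      using multi_circuit_supported[OF mc, of 0] unfolding supported_ereal_iff \<tau>_def by simp
  qed
  have fin: "x $ (?f ^^ q) i \<noteq> -\<infinity>" if "\<And>r. r < q \<Longrightarrow> (?f ^^ r) i \<in> Field C" for q
    using that
  proof (induction q)
    case (Suc q)
    hence "tight_at A (-\<infinity>) \<tau> x ((?f ^^ q) i) (\<kappa> ((?f ^^ q) i))" by (intro tight) auto
    thus ?case using tight_at_succ[OF A l x sel] by simp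
  qed (use i in simp)
  have ex: "\<exists>n. (?f ^^ n) i \<notin> Field C"
  proof (rule ccontr)
    assume "\<nexists>n. (?f ^^ n) i \<notin> Field C"
    hence all: "tight_at A (-\<infinity>) \<tau> x ((?f ^^ q) i) (\<kappa> ((?f ^^ q) i))" for q using tight fin by blast
    obtain m p where p: "p > 0" "(?f ^^ p) ((?f ^^ m) i) = (?f ^^ m) i" by (rule eventually_periodic)
    have "tight_at A (-\<infinity>) \<tau> x j (\<kappa> j)" if jo: "j \<in> orbit_from ?f ((?f ^^ m) i)" for j
    proof -
      obtain n where "j = (?f ^^ n) ((?f ^^ m) i)" using jo unfolding orbit_from_def by blast
      hence "j = (?f ^^ (n + m)) i" by (simp add: funpow_add)
      thus ?thesis using all by blast
    qed
    thus False using star_cycle_MInf[OF A star C x, folded \<tau>_def, OF p] by blast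
  qed
  define n where "n = (LEAST n. (?f ^^ n) i \<notin> Field C)"
  have n: "(?f ^^ n) i \<notin> Field C" unfolding n_def using LeastI_ex[OF ex] .
  have less: "(?f ^^ q) i \<in> Field C" if "q < n" for q using not_less_Least[OF that[unfolded n_def]] by blast
  show thesis
  proof (rule that[folded \<tau>_def, OF n])
    fix q assume "q < n"
    thus "tight_at A (-\<infinity>) \<tau> x ((?f ^^ q) i) (\<kappa> ((?f ^^ q) i))" using less fin[of q] by (intro tight) auto
  qed
qed

subsection \<open>Limits of perturbed eigenvectors\<close>

lemma perturb_Rmax: "A \<in> Rmax_mat \<Longrightarrow> perturb A \<zeta> \<delta> \<in> Rmax_mat"
  unfolding Rmax_mat_def Rmax_def perturb_def
proof (clarsimp)
  fix i j assume "\<forall>i j. A $ i $ j \<noteq> \<infinity>" "A $ i $ j - ereal (\<zeta> $ i $ j * \<delta>) = \<infinity>"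
  thus False by (cases "A $ i $ j") auto
qed

lemma perturb_MInf_iff: "perturb A \<zeta> \<delta> $ i $ j = -\<infinity> \<longleftrightarrow> A $ i $ j = -\<infinity>"
  by (cases "A $ i $ j") (auto simp: perturb_def)

lemma eventually_less_limits:
  fixes f g :: "'a \<Rightarrow> ereal"
  assumes "(f \<longlongrightarrow> a) F" "(g \<longlongrightarrow> b) F" "a < b"
  shows "\<forall>\<^sub>F x in F. f x < g x"
proof -
  obtain c where "a < c" "c < b" using dense[OF assms(3)] by blast
  with assms(1,2) have "\<forall>\<^sub>F x in F. f x < c" "\<forall>\<^sub>F x in F. c < g x"
    by (auto intro: order_tendstoD)
  thus ?thesis by eventually_elim (rule less_trans)
qed

text \<open>A maximum attained only once in the limit would be a strict and finite maximum of late
  members of the sequence.\<close>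

lemma tropical_limit:
  fixes A :: "ereal ^ 'n ^ 'n"
  assumes lim: "\<And>s c. (\<lambda>m. val (P m) (L m) (Y m) s c) \<longlonglongrightarrow> val A l y s c"
    and trop: "\<And>m::nat. tropical (P m) (L m) (Y m)"
  shows "tropical A l y"
  unfolding tropical_def
proof (intro allI impI)
  fix s c
  assume max: "\<forall>d. val A l y s d \<le> val A l y s c" and fin: "val A l y s c \<noteq> -\<infinity>"
  show "\<exists>d. d \<noteq> c \<and> val A l y s d = val A l y s c"
  proof (rule ccontr)
    assume "\<nexists>d. d \<noteq> c \<and> val A l y s d = val A l y s c"
    hence less: "val A l y s d < val A l y s c" if "d \<noteq> c" for d
      using max that by (auto simp: order_less_le)
    have "\<forall>\<^sub>F m in sequentially. val (P m) (L m) (Y m) s d < val (P m) (L m) (Y m) s c" if "d \<noteq> c" for d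
      using eventually_less_limits[OF lim lim less[OF that]] .
    hence "\<forall>\<^sub>F m in sequentially. \<forall>d\<in>-{c}. val (P m) (L m) (Y m) s d < val (P m) (L m) (Y m) s c"
      by (intro eventually_ball_finite) auto
    moreover have "\<forall>\<^sub>F m in sequentially. val (P m) (L m) (Y m) s c > -\<infinity>"
      by (rule order_tendstoD(1)[OF lim]) (use fin in \<open>simp add: less_ereal.simps order_less_le\<close>)
    ultimately have "\<forall>\<^sub>F m in sequentially. False"
    proof eventually_elim
      case (elim m)
      have "val (P m) (L m) (Y m) s d \<le> val (P m) (L m) (Y m) s c" for d
        using elim(1) by (cases "d = c") (auto intro: less_imp_le)
      then obtain d where "d \<noteq> c" "val (P m) (L m) (Y m) s d = val (P m) (L m) (Y m) s c"
        using trop[of m] elim(2) unfolding tropical_def by (metis order_less_irrefl)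
      thus False using elim(1) by (metis ComplI order_less_irrefl singletonD)
    qed
    thus False by simp
  qed
qed

text \<open>One \<open>C\<close> serves all \<open>m\<close>: a subsequence makes the finitely many
  possible multi-circuits constant. All combinatorial data then refer to one selection, while
  matrices, values \<open>L m\<close> and vectors \<open>Y m\<close> converge.\<close>

locale approximation =
  fixes A :: "ereal ^ 'n ^ 'n" and \<zeta> :: "real ^ 'n ^ 'n" and l :: ereal and d :: "nat \<Rightarrow> real"
    and L :: "nat \<Rightarrow> ereal" and C :: "('n \<times> 'n) set" and Y :: "nat \<Rightarrow> ereal ^ 'n" and y :: "ereal ^ 'n"
  assumes A: "A \<in> Rmax_mat" and l: "l \<noteq> \<infinity>" and y_in_Rmax: "y \<in> Rmax_vec"
    and star: "\<And>m. star_condition (perturb A \<zeta> (d m))"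
    and ball: "\<And>m. L m \<in> mp_ball l (real CARD('n) * d m)"
    and maximal: "\<And>m. maximal_multi_circuit (perturb A \<zeta> (d m)) (L m) C"
    and W: "\<And>m. Y m \<in> W_circuit (perturb A \<zeta> (d m)) (L m) C"
    and d_lim: "d \<longlonglongrightarrow> 0"
    and Y_lim: "\<And>j. (\<lambda>m. Y m $ j) \<longlonglongrightarrow> y $ j"
begin

abbreviation P :: "nat \<Rightarrow> ereal ^ 'n ^ 'n" where "P m \<equiv> perturb A \<zeta> (d m)"

abbreviation \<tau> :: "'n \<Rightarrow> 'n option" where "\<tau> \<equiv> selection_of C"

lemma P: "P m \<in> Rmax_mat"
  by (rule perturb_Rmax[OF A])

lemma L_MInf: "l = -\<infinity> \<Longrightarrow> L m = -\<infinity>"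
  using ball[of m] by (auto simp: mp_ball_def)

lemma L_real:
  assumes "l = ereal r"
  shows "\<exists>q. L m = ereal q"
proof -
  have "ereal (r - real CARD('n) * d m) \<le> L m" "L m \<le> ereal (r + real CARD('n) * d m)"
    using ball[of m] assms by (auto simp: mp_ball_def)
  thus ?thesis by (cases "L m") auto
qed

lemma L_lim: "L \<longlonglongrightarrow> l"
proof (cases l)
  case (real r)
  have "(\<lambda>m. ereal (r - real CARD('n) * d m)) \<longlonglongrightarrow> ereal (r - real CARD('n) * 0)"
    "(\<lambda>m. ereal (r + real CARD('n) * d m)) \<longlonglongrightarrow> ereal (r + real CARD('n) * 0)"
    by (intro tendsto_ereal tendsto_diff tendsto_add tendsto_mult tendsto_const d_lim)+
  moreover have "ereal (r - real CARD('n) * d m) \<le> L m" "L m \<le> ereal (r + real CARD('n) * d m)" for m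
    using ball[of m] real by (auto simp: mp_ball_def)
  ultimately show ?thesis using real
    by (intro tendsto_sandwich[of "\<lambda>m. ereal (r - real CARD('n) * d m)" L _ "\<lambda>m. ereal (r + real CARD('n) * d m)"]) auto
next
  case MInf
  hence "L = (\<lambda>m. -\<infinity>)" using L_MInf by auto
  thus ?thesis using MInf by simp
qed (use l in simp)

lemma L: "L m \<noteq> \<infinity>"
proof (cases l)
  case (real r)
  obtain q where "L m = ereal q" using L_real[OF real] by blast
  thus ?thesis by simp
qed (use l L_MInf in auto)

lemma multi: "multi_circuit (P m) C"
  by (rule maximal_multi_circuitD[OF maximal])

lemma pg: "permutation_graph C"
  by (rule multi_circuit_permutation_graph(1)[OF multi])

lemma sel: "selection \<tau>"
  by (rule selection_selection_of[OF pg])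

lemma coef_lim: "(\<lambda>m. coef (P m) (L m) s c) \<longlonglongrightarrow> coef A l s c"
proof (cases c)
  case (Some j)
  have "(\<lambda>m. ereal (\<zeta> $ s $ j * d m)) \<longlonglongrightarrow> ereal (\<zeta> $ s $ j * 0)"
    by (intro tendsto_ereal tendsto_mult tendsto_const d_lim)
  hence "(\<lambda>m. A $ s $ j + - ereal (\<zeta> $ s $ j * d m)) \<longlonglongrightarrow> A $ s $ j + - ereal (\<zeta> $ s $ j * 0)"
    by (intro tendsto_add_ereal_general tendsto_const tendsto_uminus_ereal) auto
  thus ?thesis using Some by (simp add: perturb_def minus_ereal_def zero_ereal_def[symmetric])
qed (use L_lim in simp)

lemma val_lim: "(\<lambda>m. val (P m) (L m) (Y m) s c) \<longlonglongrightarrow> val A l y s c"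
  unfolding val_def
  using coef_not_PInf[OF A l, of s c] Rmax_vec_not_PInf[OF y_in_Rmax]
  by (intro tendsto_add_ereal_general coef_lim Y_lim) auto

lemma Y: "Y m \<in> Rmax_vec" "dominates (P m) (L m) \<tau> (Y m)"
  using W_circuit_row(1,2)[OF P L pg W] by auto

lemma dominates_y: "dominates A l \<tau> y"
  unfolding dominates_def
proof (intro allI)
  fix s c
  show "val A l y s c \<le> val A l y s (\<tau> s)"
    by (rule LIMSEQ_le[OF val_lim val_lim]) (use Y(2) in \<open>auto simp: dominates_def\<close>)
qed

lemma tropical_y: "tropical A l y"
  by (rule tropical_limit[OF val_lim W_circuit_tropical[OF P L pg W]])

lemma supported_iff: "supported (P m) (ereal q) \<rho> \<longleftrightarrow> supported A (ereal r) \<rho>"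
  by (simp add: supported_ereal_iff perturb_MInf_iff)

text \<open>Perturbation keeps the positions of \<open>-\<infinity>\<close>, so the same selections
  compete before and in the limit, and their weights converge.\<close>

lemma optimal_A:
  assumes r: "l = ereal r"
  shows "optimal A (ereal r) \<tau>"
proof -
  obtain q where q: "\<And>m. L m = ereal (q m)" using choice[of "\<lambda>m q. L m = ereal q"] L_real[OF r] by blast
  have opt: "optimal (P m) (ereal (q m)) \<tau>" for m
    using maximal[of m] real_maximal_iff[OF P] unfolding q maximal_multi_circuit_ereal by blast
  have sup: "supported A (ereal r) \<tau>" using opt supported_iff[of 0 "q 0" \<tau> r] by (auto simp: optimal_def)
  have wlim: "(\<lambda>m. weight (P m) (ereal (q m)) \<rho>) \<longlonglongrightarrow> weight A (ereal r) \<rho>"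
    if "supported A (ereal r) \<rho>" for \<rho>
    unfolding weight_def
  proof (rule tendsto_sum)
    fix s
    have "coef A (ereal r) s (\<rho> s) = ereal (real_of_ereal (coef A (ereal r) s (\<rho> s)))"
      by (rule coef_real[OF A]) (use that in \<open>auto simp: supported_def\<close>)
    thus "(\<lambda>m. real_of_ereal (coef (P m) (ereal (q m)) s (\<rho> s))) \<longlonglongrightarrow> real_of_ereal (coef A (ereal r) s (\<rho> s))"
      using coef_lim[of s "\<rho> s"] unfolding q r by (intro lim_real_of_ereal) simp
  qed
  have "weight A (ereal r) \<rho> \<le> weight A (ereal r) \<tau>" if \<rho>: "selection \<rho>" "supported A (ereal r) \<rho>" for \<rho>
  proof -
    have "weight (P m) (ereal (q m)) \<rho> \<le> weight (P m) (ereal (q m)) \<tau>" for m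
      using opt[of m] \<rho> supported_iff unfolding optimal_def by blast
    thus ?thesis by (intro LIMSEQ_le[OF wlim[OF \<rho>(2)] wlim[OF sup]]) blast
  qed
  thus ?thesis using sel sup by (simp add: optimal_def)
qed

text \<open>Infinitely many ties are enough, because a strict inequality in the limit would hold
  eventually.\<close>

lemma tight_at_limit:
  assumes "\<exists>\<^sub>F m in sequentially. tight_at (P m) (L m) \<tau> (Y m) j c"
    and fin: "y $ j \<noteq> -\<infinity>" "coef A l (row_of \<tau> j) (\<tau> (row_of \<tau> j)) \<noteq> -\<infinity>"
  shows "tight_at A l \<tau> y j c"
proof -
  let ?s = "row_of \<tau> j"
  have "val A l y ?s (\<tau> ?s) \<noteq> -\<infinity>"
    using fin sel unfolding val_finite_iff[OF A l y_in_Rmax] by simp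
  moreover have "val A l y ?s c = val A l y ?s (\<tau> ?s)"
  proof (rule ccontr)
    assume "val A l y ?s c \<noteq> val A l y ?s (\<tau> ?s)"
    hence "val A l y ?s c < val A l y ?s (\<tau> ?s)"
      using dominates_y by (auto simp: dominates_def order_less_le)
    hence "\<forall>\<^sub>F m in sequentially. val (P m) (L m) (Y m) ?s c < val (P m) (L m) (Y m) ?s (\<tau> ?s)"
      by (rule eventually_less_limits[OF val_lim val_lim])
    hence "\<forall>\<^sub>F m in sequentially. \<not> tight_at (P m) (L m) \<tau> (Y m) j c"
      by eventually_elim (auto simp: tight_at_def)
    thus False using assms(1) by (simp add: frequently_def)
  qed
  moreover have "c \<noteq> \<tau> ?s"
    using assms(1) by (auto simp: tight_at_def dest: frequently_ex)
  ultimately show ?thesis by (simp add: tight_at_def)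
qed

text \<open>Pigeonhole over the finitely many functions \<open>\<kappa>\<close>. Since
  \<open>y $ i\<close> is finite, so are the late \<open>Y m $ i\<close>.\<close>

lemma frequently_choice:
  assumes "\<And>m. Y m $ i \<noteq> -\<infinity> \<Longrightarrow> \<exists>\<kappa>. Q \<kappa> m" and i: "y $ i \<noteq> -\<infinity>"
  obtains \<kappa> :: "'n \<Rightarrow> 'n option" where "\<exists>\<^sub>F m in sequentially. Q \<kappa> m"
proof -
  have "-\<infinity> < y $ i" using i by (cases "y $ i") auto
  hence "\<forall>\<^sub>F m in sequentially. -\<infinity> < Y m $ i" by (rule order_tendstoD(1)[OF Y_lim])
  hence ev: "\<forall>\<^sub>F m in sequentially. \<exists>\<kappa>. Q \<kappa> m"
    by eventually_elim (use assms(1) in auto)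
  have "\<exists>\<kappa>. \<exists>\<^sub>F m in sequentially. Q \<kappa> m"
  proof (rule ccontr)
    assume "\<nexists>\<kappa>. \<exists>\<^sub>F m in sequentially. Q \<kappa> m"
    hence "\<forall>\<^sub>F m in sequentially. \<forall>\<kappa>\<in>UNIV. \<not> Q \<kappa> m"
      by (intro eventually_ball_finite) (auto simp: frequently_def)
    with ev have "\<forall>\<^sub>F m in sequentially. False" by eventually_elim auto
    thus False by simp
  qed
  thus thesis using that by blast
qed

lemma length_changing:
  assumes r: "l = ereal r" and i: "y $ i \<noteq> -\<infinity>"
  shows "\<exists>\<kappa> k. (i, k) \<in> (tight A l \<tau> y)\<^sup>* \<and> length_changing_cycle A l \<tau> y \<kappa> k"
proof -
  \<comment> \<open>This depends on \<open>\<tau>\<close> and \<open>\<kappa>\<close> only, so once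
    true it holds in the limit too.\<close>
  define changes where "changes \<kappa> \<longleftrightarrow> (\<forall>k\<in>orbit_from (succ \<tau> \<kappa>) i. \<forall>p>0. (succ \<tau> \<kappa> ^^ p) k = k \<longrightarrow>
     card {j\<in>orbit_from (succ \<tau> \<kappa>) k. \<kappa> j = None} \<noteq>
     card {j\<in>orbit_from (succ \<tau> \<kappa>) k. \<tau> (row_of \<tau> j) = None})" for \<kappa>
  have "\<exists>\<kappa>. changes \<kappa> \<and> (\<forall>j\<in>orbit_from (succ \<tau> \<kappa>) i. tight_at (P m) (L m) \<tau> (Y m) j (\<kappa> j))"
    if fin: "Y m $ i \<noteq> -\<infinity>" for m
  proof -
    obtain q where q: "L m = ereal q" using L_real[OF r] by blast
    have rm: "real_maximal (P m) q C" using maximal[of m] unfolding q maximal_multi_circuit_ereal .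
    obtain \<kappa> where "\<And>j. j \<in> orbit_from (succ \<tau> \<kappa>) i \<Longrightarrow> tight_at (P m) (ereal q) \<tau> (Y m) j (\<kappa> j)"
      "\<And>k p. k \<in> orbit_from (succ \<tau> \<kappa>) i \<Longrightarrow> p > 0 \<Longrightarrow> (succ \<tau> \<kappa> ^^ p) k = k \<Longrightarrow>
       card {j\<in>orbit_from (succ \<tau> \<kappa>) k. \<kappa> j = None} \<noteq>
       card {j\<in>orbit_from (succ \<tau> \<kappa>) k. \<tau> (row_of \<tau> j) = None}"
      by (rule chain_real[OF P star rm W[of m, unfolded q] fin]) blast
    thus ?thesis unfolding changes_def q by blast
  qed
  then obtain \<kappa> where freq: "\<exists>\<^sub>F m in sequentially. changes \<kappa> \<and>
      (\<forall>j\<in>orbit_from (succ \<tau> \<kappa>) i. tight_at (P m) (L m) \<tau> (Y m) j (\<kappa> j))"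
    using frequently_choice[of i "\<lambda>\<kappa> m. changes \<kappa> \<and>
      (\<forall>j\<in>orbit_from (succ \<tau> \<kappa>) i. tight_at (P m) (L m) \<tau> (Y m) j (\<kappa> j))"] i by blast
  let ?f = "succ \<tau> \<kappa>"
  have changes: "changes \<kappa>" using frequently_ex[OF freq] by blast
  have sup: "coef A l s (\<tau> s) \<noteq> -\<infinity>" for s using optimal_A[OF r] r by (simp add: optimal_def supported_def)
  have step: "tight_at A l \<tau> y j (\<kappa> j)" if "j \<in> orbit_from ?f i" "y $ j \<noteq> -\<infinity>" for j
    by (rule tight_at_limit[OF _ that(2) sup]) (use freq that(1) in \<open>auto elim!: frequently_elim1\<close>)
  have orb: "(?f ^^ n) i \<in> orbit_from ?f i" for n by (auto simp: orbit_from_def)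
  have fin: "y $ (?f ^^ n) i \<noteq> -\<infinity>" for n
  proof (induction n)
    case (Suc n)
    show ?case using tight_at_succ[where \<kappa>=\<kappa>, OF A l y_in_Rmax sel step[OF orb Suc]] by simp
  qed (use i in simp)
  have path: "(i, (?f ^^ n) i) \<in> (tight A l \<tau> y)\<^sup>*" for n
  proof (induction n)
    case (Suc n)
    have "((?f ^^ n) i, (?f ^^ Suc n) i) \<in> tight A l \<tau> y"
      using step[OF orb fin] unfolding tight_def by (auto simp: succ_def)
    thus ?case using Suc by (rule rtrancl_into_rtrancl[rotated])
  qed simp
  obtain m p where p: "p > 0" "(?f ^^ p) ((?f ^^ m) i) = (?f ^^ m) i" by (rule eventually_periodic)
  have sub: "j = (?f ^^ n) ((?f ^^ m) i) \<Longrightarrow> j = (?f ^^ (n + m)) i" for j n by (simp add: funpow_add)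
  have "length_changing_cycle A l \<tau> y \<kappa> ((?f ^^ m) i)"
    unfolding length_changing_cycle_def
  proof (intro conjI ballI)
    show "\<exists>p>0. (?f ^^ p) ((?f ^^ m) i) = (?f ^^ m) i" using p by blast
    show "card {j\<in>orbit_from ?f ((?f ^^ m) i). \<kappa> j = None} \<noteq>
      card {j\<in>orbit_from ?f ((?f ^^ m) i). \<tau> (row_of \<tau> j) = None}"
      using changes orb[of m] p unfolding changes_def by blast
    fix j assume j: "j \<in> orbit_from ?f ((?f ^^ m) i)"
    obtain n where "j = (?f ^^ n) ((?f ^^ m) i)" using j unfolding orbit_from_def by blast
    from sub[OF this] show "tight_at A l \<tau> y j (\<kappa> j)" using step[OF orb fin] by blast
  qed
  thus ?thesis using path by blast
qed

lemma escape:
  assumes MInf: "l = -\<infinity>" and i: "y $ i \<noteq> -\<infinity>"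
  obtains k where "k \<notin> Field C" "(i, k) \<in> (tight A l \<tau> y)\<^sup>*" "y $ k \<noteq> -\<infinity>"
proof -
  \<comment> \<open>The exit time depends on \<open>\<kappa>\<close> and \<open>C\<close> only,
    hence is the same for every \<open>m\<close>.\<close>
  define N where "N \<kappa> = (LEAST n. (succ \<tau> \<kappa> ^^ n) i \<notin> Field C)" for \<kappa>
  have "\<exists>\<kappa>. (\<exists>n. (succ \<tau> \<kappa> ^^ n) i \<notin> Field C) \<and>
      (\<forall>q<N \<kappa>. tight_at (P m) (L m) \<tau> (Y m) ((succ \<tau> \<kappa> ^^ q) i) (\<kappa> ((succ \<tau> \<kappa> ^^ q) i)))"
    if fin: "Y m $ i \<noteq> -\<infinity>" for m
  proof -
    have q: "L m = -\<infinity>" by (rule L_MInf[OF MInf])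
    obtain \<kappa> n where n: "(succ \<tau> \<kappa> ^^ n) i \<notin> Field C"
      "\<And>q. q < n \<Longrightarrow> tight_at (P m) (-\<infinity>) \<tau> (Y m) ((succ \<tau> \<kappa> ^^ q) i) (\<kappa> ((succ \<tau> \<kappa> ^^ q) i))"
      by (rule chain_MInf[OF P star maximal[of m, unfolded q] W[of m, unfolded q] fin]) blast
    have "N \<kappa> \<le> n" unfolding N_def by (rule Least_le[of "\<lambda>n. (succ \<tau> \<kappa> ^^ n) i \<notin> Field C", OF n(1)])
    thus ?thesis using n unfolding q by (metis order_less_le_trans)
  qed
  then obtain \<kappa> where freq: "\<exists>\<^sub>F m in sequentially. (\<exists>n. (succ \<tau> \<kappa> ^^ n) i \<notin> Field C) \<and>
      (\<forall>q<N \<kappa>. tight_at (P m) (L m) \<tau> (Y m) ((succ \<tau> \<kappa> ^^ q) i) (\<kappa> ((succ \<tau> \<kappa> ^^ q) i)))"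
    using frequently_choice[of i "\<lambda>\<kappa> m. (\<exists>n. (succ \<tau> \<kappa> ^^ n) i \<notin> Field C) \<and>
      (\<forall>q<N \<kappa>. tight_at (P m) (L m) \<tau> (Y m) ((succ \<tau> \<kappa> ^^ q) i) (\<kappa> ((succ \<tau> \<kappa> ^^ q) i)))"] i by blast
  let ?f = "succ \<tau> \<kappa>"
  obtain m where m: "\<exists>n. (?f ^^ n) i \<notin> Field C"
    "\<And>q. q < N \<kappa> \<Longrightarrow> tight_at (P m) (L m) \<tau> (Y m) ((?f ^^ q) i) (\<kappa> ((?f ^^ q) i))"
    using frequently_ex[OF freq] by blast
  have out: "(?f ^^ N \<kappa>) i \<notin> Field C" unfolding N_def by (rule LeastI_ex[of "\<lambda>n. (?f ^^ n) i \<notin> Field C", OF m(1)])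
  have coefs: "coef A l s c = -\<infinity> \<longleftrightarrow> coef (P m) (L m) s c = -\<infinity>" for s c
    using MInf L_MInf by (cases c) (auto simp: perturb_MInf_iff)
  have step: "tight_at A l \<tau> y ((?f ^^ q) i) (\<kappa> ((?f ^^ q) i))"
    if q: "q < N \<kappa>" and fin: "y $ (?f ^^ q) i \<noteq> -\<infinity>" for q
  proof (rule tight_at_limit[OF _ fin])
    show "\<exists>\<^sub>F m in sequentially. tight_at (P m) (L m) \<tau> (Y m) ((?f ^^ q) i) (\<kappa> ((?f ^^ q) i))"
      by (rule frequently_elim1[OF freq]) (use q in blast)
    show "coef A l (row_of \<tau> ((?f ^^ q) i)) (\<tau> (row_of \<tau> ((?f ^^ q) i))) \<noteq> -\<infinity>"
      unfolding coefs by (rule tight_at_target(2)[OF P L Y(1) sel m(2)[OF q]])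
  qed
  have path: "n \<le> N \<kappa> \<Longrightarrow> (i, (?f ^^ n) i) \<in> (tight A l \<tau> y)\<^sup>* \<and> y $ (?f ^^ n) i \<noteq> -\<infinity>" for n
  proof (induction n)
    case (Suc n)
    hence t: "tight_at A l \<tau> y ((?f ^^ n) i) (\<kappa> ((?f ^^ n) i))" by (intro step) auto
    hence "((?f ^^ n) i, (?f ^^ Suc n) i) \<in> tight A l \<tau> y"
      unfolding tight_def by (auto simp: succ_def)
    moreover have "y $ (?f ^^ Suc n) i \<noteq> -\<infinity>" using tight_at_succ[where \<kappa>=\<kappa>, OF A l y_in_Rmax sel t] by simp
    ultimately show ?case using Suc by auto
  qed (use i in simp)
  show thesis by (rule that[OF out]) (use path[of "N \<kappa>"] in auto)
qed

end

lemma convergent_subsequence: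
  fixes X :: "nat \<Rightarrow> ereal ^ 'n"
  obtains r y where "strict_mono r" "\<And>j. (\<lambda>m. X (r m) $ j) \<longlonglongrightarrow> y $ j"
proof -
  have "\<exists>r y. strict_mono r \<and> (\<forall>j\<in>S. (\<lambda>m. X (r m) $ j) \<longlonglongrightarrow> y j)" for S :: "'n set"
  proof (induction S rule: finite_induct[OF finite])
    case 1
    show ?case using strict_mono_id by auto
  next
    case (2 i S)
    then obtain r y where r: "strict_mono r" "\<forall>j\<in>S. (\<lambda>m. X (r m) $ j) \<longlonglongrightarrow> y j" by blast
    obtain r' a where r': "strict_mono r'" "((\<lambda>m. X (r m) $ i) \<circ> r') \<longlonglongrightarrow> a"
      using compact_complete_linorder by metis
    have "(\<lambda>m. X ((r \<circ> r') m) $ j) \<longlonglongrightarrow> (y(i := a)) j" if "j \<in> insert i S" for j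
    proof (cases "j = i")
      case False
      hence "(\<lambda>m. X (r m) $ j) \<longlonglongrightarrow> y j" using r(2) that by blast
      from LIMSEQ_subseq_LIMSEQ[OF this r'(1)] show ?thesis using False by (simp add: o_def)
    qed (use r'(2) in \<open>simp add: o_def\<close>)
    thus ?case using strict_mono_o[OF r(1) r'(1)] by blast
  qed
  from this[of UNIV] obtain r y where "strict_mono r" "\<And>j. (\<lambda>m. X (r m) $ j) \<longlonglongrightarrow> y j" by auto
  thus thesis using that[of r "\<chi> j. y j"] by simp
qed

lemma zero_in_W_circuit:
  fixes A :: "ereal ^ 'n ^ 'n"
  assumes "A \<in> Rmax_mat" "l \<noteq> \<infinity>"
  shows "(\<chi> i. -\<infinity>) \<in> W_circuit A l C"
proof -
  have "mp_mat_vec M (\<chi> i. -\<infinity>) = (\<chi> i. -\<infinity>)" if "M \<in> Rmax_mat" for M :: "ereal ^ 'n ^ 'n"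
    using that by (simp add: mp_mat_vec_def vec_eq_iff Rmax_mat_def Rmax_def add_MInfty)
  thus ?thesis using Rmax_mat_parts[OF assms, of C]
    by (simp add: W_circuit_def on_part_def off_part_def Rmax_vec_def Rmax_def)
qed

lemma finite_SUP_attained:
  fixes f :: "'a \<Rightarrow> ereal"
  assumes "finite F" "F \<noteq> {}"
  obtains k where "k \<in> F" "(SUP k\<in>F. f k) = f k"
proof -
  have "Sup (f ` F) \<in> f ` F" using assms Max_Sup[of "f ` F"] Max_in[of "f ` F"] by simp
  thus thesis using that by auto
qed

text \<open>A finite supremum is attained, so every coordinate has a responsible summand. The zero
  vector in \<open>U l\<close> covers the empty sum.\<close>

lemma space_sum_coordinate:
  assumes "X \<in> mp_space_sum K U" "l \<in> K" "(\<chi> i. -\<infinity>) \<in> U l"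
  shows "\<exists>k\<in>K. \<exists>Y\<in>U k. (\<forall>j. Y $ j \<le> X $ j) \<and> Y $ i = X $ i"
proof -
  obtain F f where F: "finite F" "F \<subseteq> K" "\<And>k. k \<in> F \<Longrightarrow> f k \<in> U k" "X = mp_sum F f"
    using assms(1) unfolding mp_space_sum_def by blast
  show ?thesis
  proof (cases "F = {}")
    case True
    hence "X = (\<chi> i. -\<infinity>)" using F(4) by (simp add: mp_sum_def bot_ereal_def)
    thus ?thesis using assms(2,3) by blast
  next
    case False
    obtain k where k: "k \<in> F" "(SUP k\<in>F. f k $ i) = f k $ i"
      by (rule finite_SUP_attained[OF F(1) False])
    have "f k $ j \<le> X $ j" for j unfolding F(4) mp_sum_def using k(1) by (auto intro: SUP_upper)
    moreover have "f k $ i = X $ i" unfolding F(4) mp_sum_def using k(2) by simp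
    ultimately show ?thesis using k(1) F(2,3) by blast
  qed
qed

text \<open>Only coordinate \<open>i\<close> is recovered exactly, because the summand responsible
  for \<open>i\<close> need not carry the others. One subsequence makes the multi-circuit constant,
  a second one makes the summands converge.\<close>

lemma approximation_exists:
  fixes A :: "ereal ^ 'n ^ 'n"
  assumes A: "A \<in> Rmax_mat" and l: "l \<noteq> \<infinity>" and \<zeta>: "\<zeta> \<in> generic_directions A"
    and x: "x \<in> alg_eigenspace A l"
  shows "\<exists>d L C Y y. approximation A \<zeta> l d L C Y y \<and> (\<forall>j. y $ j \<le> x $ j) \<and> y $ i = x $ i"
proof -
  let ?P = "perturb A \<zeta>"
  let ?S = "\<lambda>\<delta>. mp_space_sum (mp_ball l (real CARD('n) * \<delta>)) (\<lambda>l'. W_circuit (?P \<delta>) l' (some_maximal (?P \<delta>) l'))"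
  have "x \<in> limit_at_0 ?S" using x \<zeta> unfolding alg_eigenspace_def by blast
  then obtain X where xR: "x \<in> Rmax_vec" and X: "\<forall>\<^sub>F \<delta> in at_right 0. X \<delta> \<in> ?S \<delta>" "(X \<longlongrightarrow> x) (at_right 0)"
    unfolding limit_at_0_def by blast
  obtain b1 where b1: "b1 > 0" "\<And>\<delta>. 0 < \<delta> \<Longrightarrow> \<delta> < b1 \<Longrightarrow> X \<delta> \<in> ?S \<delta>"
    using X(1) unfolding eventually_at_right_field by auto
  obtain b2 where b2: "b2 > 0" "\<And>\<delta>. 0 < \<delta> \<Longrightarrow> \<delta> < b2 \<Longrightarrow> star_condition (?P \<delta>)"
    using \<zeta> unfolding generic_directions_def by blast
  define b where "b = min b1 b2"
  have b: "b > 0" "b \<le> b1" "b \<le> b2" using b1(1) b2(1) by (auto simp: b_def)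
  \<comment> \<open>The offset 2 keeps \<open>D m\<close> strictly below \<open>b\<close>, already
    for \<open>m = 0\<close>.\<close>
  define D where "D m = b / (real m + 2)" for m
  have D: "0 < D m" "D m < b1" "D m < b2" for m
  proof -
    have "b * 1 < b * (real m + 2)" using b(1) by (intro mult_strict_left_mono) auto
    hence "D m < b" by (simp add: D_def pos_divide_less_eq)
    thus "D m < b1" "D m < b2" using b by simp_all
    show "0 < D m" using b(1) by (simp add: D_def)
  qed
  have D0: "D \<longlonglongrightarrow> 0" 
    using LIMSEQ_ignore_initial_segment[OF lim_const_over_n[of b], of 2] by (simp add: D_def[abs_def] add_ac)
  have XD: "(\<lambda>m. X (D m) $ j) \<longlonglongrightarrow> x $ j" for j
  proof -
    have "filterlim D (at_right 0) sequentially"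
      by (rule tendsto_imp_filterlim_at_right[OF D0]) (simp add: D)
    hence "(\<lambda>m. X (D m)) \<longlonglongrightarrow> x" by (rule filterlim_compose[OF X(2)])
    thus ?thesis by (rule tendsto_vec_nth)
  qed
  have not_PInf: "l' \<noteq> \<infinity>" if "l' \<in> mp_ball l r" for l' r
    using that l by (cases l) (auto simp: mp_ball_def)
  have in_ball: "l \<in> mp_ball l r" if "r \<ge> 0" for r
    using that l by (cases l) (auto simp: mp_ball_def)
  have "\<exists>L Y. L \<in> mp_ball l (real CARD('n) * D m) \<and> Y \<in> W_circuit (?P (D m)) L (some_maximal (?P (D m)) L) \<and>
      (\<forall>j. Y $ j \<le> X (D m) $ j) \<and> Y $ i = X (D m) $ i" for m
    using space_sum_coordinate[OF b1(2)[OF D(1,2)] in_ball zero_in_W_circuit[OF perturb_Rmax[OF A] l], of m i] D(1)[of m]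
    by (auto simp: less_imp_le)
  then obtain L Y where LY: "\<And>m. L m \<in> mp_ball l (real CARD('n) * D m)"
    "\<And>m. Y m \<in> W_circuit (?P (D m)) (L m) (some_maximal (?P (D m)) (L m))"
    "\<And>m j. Y m $ j \<le> X (D m) $ j" "\<And>m. Y m $ i = X (D m) $ i"
    by metis
  let ?C = "\<lambda>m. some_maximal (?P (D m)) (L m)"
  obtain m0 where "infinite {m\<in>UNIV. ?C m = ?C m0}"
    using pigeonhole_infinite[of UNIV ?C] by auto
  then obtain r0 :: "nat \<Rightarrow> nat" where r0: "strict_mono r0" "\<And>m. ?C (r0 m) = ?C m0"
    using infinite_enumerate[of "{m\<in>UNIV. ?C m = ?C m0}"] by auto
  obtain r1 y where r1: "strict_mono r1" "\<And>j. (\<lambda>m. Y (r0 (r1 m)) $ j) \<longlonglongrightarrow> y $ j"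
    using convergent_subsequence[of "\<lambda>m. Y (r0 m)"] by blast
  define r where "r = r0 \<circ> r1"
  have r: "strict_mono r" using strict_mono_o[OF r0(1) r1(1)] by (simp add: r_def)
  have Ylim: "(\<lambda>m. Y (r m) $ j) \<longlonglongrightarrow> y $ j" for j using r1(2) by (simp add: r_def)
  have Xlim: "(\<lambda>m. X (D (r m)) $ j) \<longlonglongrightarrow> x $ j" for j
    using LIMSEQ_subseq_LIMSEQ[OF XD r] by (simp add: o_def)
  have yx: "y $ j \<le> x $ j" for j
    by (rule LIMSEQ_le[OF Ylim Xlim]) (use LY(3) in blast)
  have Cr: "?C (r m) = ?C m0" for m using r0(2) by (simp add: r_def)
  show ?thesis
  proof (intro exI conjI allI)
    show "approximation A \<zeta> l (\<lambda>m. D (r m)) (\<lambda>m. L (r m)) (?C m0) (\<lambda>m. Y (r m)) y"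
    proof
      show "y \<in> Rmax_vec"
      proof -
        have "y $ j \<noteq> \<infinity>" for j using yx[of j] Rmax_vec_not_PInf[OF xR, of j] by auto
        thus ?thesis by (simp add: Rmax_vec_def Rmax_def)
      qed
      show "star_condition (?P (D (r m)))" for m using b2(2) D by blast
      show "maximal_multi_circuit (?P (D (r m))) (L (r m)) (?C m0)" for m
        using some_maximal_maximal[OF perturb_Rmax[OF A] not_PInf[OF LY(1)[of "r m"]], of \<zeta> "D (r m)"] by (simp add: Cr)
      show "Y (r m) \<in> W_circuit (?P (D (r m))) (L (r m)) (?C m0)" for m
        using LY(2)[of "r m"] by (simp add: Cr)
      show "(\<lambda>m. D (r m)) \<longlonglongrightarrow> 0" using LIMSEQ_subseq_LIMSEQ[OF D0 r] by (simp add: o_def)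
    qed (use A l LY(1) Ylim in auto)
    show "y $ j \<le> x $ j" for j by (rule yx)
    have "(\<lambda>m. Y (r m) $ i) \<longlonglongrightarrow> x $ i" using Xlim by (simp add: LY(4))
    thus "y $ i = x $ i" by (rule LIMSEQ_unique[OF Ylim])
  qed
qed

text \<open>
  Here the ball is \<open>{-\<infinity>}\<close>, so the multi-circuit depends on \<open>\<delta>\<close> only and one \<open>C\<close> serves all vectors.
\<close>
lemma MInf_approximation_exists:
  fixes A :: "ereal ^ 'n ^ 'n"
  assumes A: "A \<in> Rmax_mat" and \<zeta>: "\<zeta> \<in> generic_directions A"
  obtains C where "\<And>x. x \<in> alg_eigenspace A (-\<infinity>) \<Longrightarrow> \<exists>d L Y. approximation A \<zeta> (-\<infinity>) d L C Y x"
proof -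
  let ?P = "perturb A \<zeta>" and ?l = "-\<infinity> :: ereal"
  have l: "?l \<noteq> \<infinity>" by simp
  obtain b where b: "b > 0" "\<And>\<delta>. 0 < \<delta> \<Longrightarrow> \<delta> < b \<Longrightarrow> star_condition (?P \<delta>)"
    using \<zeta> unfolding generic_directions_def by blast
  define D where "D m = b / (real m + 2)" for m
  have D: "0 < D m" "D m < b" for m
  proof -
    have "b * 1 < b * (real m + 2)" using b(1) by (intro mult_strict_left_mono) auto
    thus "D m < b" by (simp add: D_def pos_divide_less_eq)
    show "0 < D m" using b(1) by (simp add: D_def)
  qed
  have D0: "D \<longlonglongrightarrow> 0" 
    using LIMSEQ_ignore_initial_segment[OF lim_const_over_n[of b], of 2] by (simp add: D_def[abs_def] add_ac)
  let ?C = "\<lambda>m. some_maximal (?P (D m)) ?l"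
  obtain m0 where "infinite {m\<in>UNIV. ?C m = ?C m0}"
    using pigeonhole_infinite[of UNIV ?C] by auto
  then obtain r :: "nat \<Rightarrow> nat" where r: "strict_mono r" "\<And>m. ?C (r m) = ?C m0"
    using infinite_enumerate[of "{m\<in>UNIV. ?C m = ?C m0}"] by auto
  have Dr0: "(\<lambda>m. D (r m)) \<longlonglongrightarrow> 0" using LIMSEQ_subseq_LIMSEQ[OF D0 r(1)] by (simp add: o_def)
  have "\<exists>d L Y. approximation A \<zeta> ?l d L (?C m0) Y x" if x: "x \<in> alg_eigenspace A ?l" for x
  proof -
    let ?W = "\<lambda>\<delta> l'. W_circuit (?P \<delta>) l' (some_maximal (?P \<delta>) l')"
    let ?S = "\<lambda>\<delta>. mp_space_sum (mp_ball ?l (real CARD('n) * \<delta>)) (?W \<delta>)"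
    have "x \<in> limit_at_0 ?S" using x \<zeta> unfolding alg_eigenspace_def by blast
    then obtain X where xR: "x \<in> Rmax_vec" and X: "\<forall>\<^sub>F \<delta> in at_right 0. X \<delta> \<in> ?S \<delta>" "(X \<longlongrightarrow> x) (at_right 0)"
      unfolding limit_at_0_def by blast
    have ball: "mp_ball ?l q = {?l}" for q by (auto simp: mp_ball_def)
    have S: "?S \<delta> \<subseteq> ?W \<delta> ?l" for \<delta>
    proof
      fix v assume "v \<in> ?S \<delta>"
      then obtain F f where F: "F \<subseteq> {?l}" "\<And>k. k \<in> F \<Longrightarrow> f k \<in> ?W \<delta> k" "v = mp_sum F f"
        unfolding mp_space_sum_def ball by blast
      consider "F = {}" | "F = {?l}" using F(1) by blast
      thus "v \<in> ?W \<delta> ?l"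
      proof cases
        case 1
        hence "v = (\<chi> i. -\<infinity>)" using F(3) by (simp add: mp_sum_def bot_ereal_def)
        thus ?thesis using zero_in_W_circuit[OF perturb_Rmax[OF A] l] by simp
      next
        case 2
        hence "v = f ?l" using F(3) by (simp add: mp_sum_def)
        thus ?thesis using F(2)[of ?l] 2 by simp
      qed
    qed
    have lim: "filterlim (\<lambda>m. D (r m)) (at_right 0) sequentially"
      by (rule tendsto_imp_filterlim_at_right[OF Dr0]) (simp add: D)
    have "\<forall>\<^sub>F m in sequentially. X (D (r m)) \<in> ?S (D (r m))"
      using lim X(1) unfolding filterlim_iff by blast
    \<comment> \<open>Membership in the spaces holds only eventually, hence the shift by
      \<open>N\<close> below.\<close>
    then obtain N where N: "\<And>m. m \<ge> N \<Longrightarrow> X (D (r m)) \<in> ?S (D (r m))"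
      unfolding eventually_sequentially by blast
    have Xlim: "(\<lambda>m. X (D (r m)) $ j) \<longlonglongrightarrow> x $ j" for j
      by (rule tendsto_vec_nth[OF filterlim_compose[OF X(2) lim]])
    have "approximation A \<zeta> ?l (\<lambda>m. D (r (m + N))) (\<lambda>m. ?l) (?C m0) (\<lambda>m. X (D (r (m + N)))) x"
    proof
      show "star_condition (?P (D (r (m + N))))" for m using b(2) D by blast
      show "maximal_multi_circuit (?P (D (r (m + N)))) ?l (?C m0)" for m
        using some_maximal_maximal[OF perturb_Rmax[OF A] l, of \<zeta> "D (r (m + N))"] by (simp add: r(2))
      show "X (D (r (m + N))) \<in> W_circuit (?P (D (r (m + N)))) ?l (?C m0)" for m
        using N[of "m + N"] S[of "D (r (m + N))"] r(2)[of "m + N"] by auto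
      show "(\<lambda>m. D (r (m + N))) \<longlonglongrightarrow> 0" using LIMSEQ_ignore_initial_segment[OF Dr0] .
      show "(\<lambda>m. X (D (r (m + N))) $ j) \<longlonglongrightarrow> x $ j" for j using LIMSEQ_ignore_initial_segment[OF Xlim] .
    qed (use A xR ball in auto)
    thus ?thesis by blast
  qed
  thus thesis by (rule that)
qed

section \<open>From approximating limits to vectors of the eigenspace\<close>

lemma eigenspace_Rmax:
  assumes "\<zeta> \<in> generic_directions A" "x \<in> alg_eigenspace A l"
  shows "x \<in> Rmax_vec"
  using assms unfolding alg_eigenspace_def limit_at_0_def by blast

lemma eigenspace_tropical_cover:
  fixes A :: "ereal ^ 'n ^ 'n"
  assumes "A \<in> Rmax_mat" "l \<noteq> \<infinity>" "\<zeta> \<in> generic_directions A" "x \<in> alg_eigenspace A l"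
  shows "\<exists>z. (\<forall>j. z $ j \<le> x $ j) \<and> tropical A l z \<and> z $ i = x $ i"
proof -
  obtain d L C Y y where ap: "approximation A \<zeta> l d L C Y y" and y: "\<And>j. y $ j \<le> x $ j" "y $ i = x $ i"
    using approximation_exists[OF assms, of i] by blast
  interpret approximation A \<zeta> l d L C Y y by (rule ap)
  show ?thesis using tropical_y y by blast
qed

text \<open>The left side of the inequality involves \<open>x\<close> at one index only, where a
  suitable \<open>y\<close> is exact; on the right \<open>y\<close> below \<open>x\<close> suffices.
  The selection belonging to \<open>y\<close> is replaced by \<open>\<rho>\<close> through
  \<open>dominates_optimal\<close>.\<close>

lemma eigenspace_dominated:
  fixes A :: "ereal ^ 'n ^ 'n" and l :: real
  assumes A: "A \<in> Rmax_mat" and \<zeta>: "\<zeta> \<in> generic_directions A" and x: "x \<in> alg_eigenspace A l"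
    and opt: "optimal A l \<rho>"
  shows "dominates A l \<rho> x"
  unfolding dominates_def
proof (intro allI)
  fix s c
  have l: "ereal l \<noteq> \<infinity>" by simp
  obtain d L C Y y where ap: "approximation A \<zeta> l d L C Y y"
    and y: "\<And>j. y $ j \<le> x $ j" "y $ target s c = x $ target s c"
    using approximation_exists[OF A l \<zeta> x, of "target s c"] by blast
  interpret approximation A \<zeta> "ereal l" d L C Y y by (rule ap)
  have "optimal A l \<tau>" by (rule optimal_A[OF refl])
  hence "dominates A l \<rho> y"
    using dominates_optimal[OF A l y_in_Rmax opt _ _ dominates_y] by (simp add: optimal_def)
  hence "val A l y s c \<le> val A l y s (\<rho> s)" by (simp add: dominates_def)
  also have "\<dots> \<le> val A l x s (\<rho> s)" by (rule val_mono[OF y(1)])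
  finally show "val A l x s c \<le> val A l x s (\<rho> s)" using y(2) by (simp add: val_def)
qed

text \<open>Forward propagation, the counterpart of \<open>tight_tail\<close>. If \<open>y\<close>
  meets \<open>b\<close> at \<open>j\<close>, both have the same maximum in that row, and the value
  of \<open>b\<close> at \<open>c\<close> is squeezed between them.\<close>

lemma tight_at_upgrade:
  assumes A: "A \<in> Rmax_mat" and l: "l \<noteq> \<infinity>" and y: "y \<in> Rmax_vec" and sel: "selection \<tau>"
    and dom: "dominates A l \<tau> b" and le: "\<And>j. y $ j \<le> b $ j"
    and t: "tight_at A l \<tau> y j c" and eq: "y $ j = b $ j"
  shows "tight_at A l \<tau> b j c" "y $ target (row_of \<tau> j) c = b $ target (row_of \<tau> j) c"
proof -
  let ?s = "row_of \<tau> j"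
  have e: "val A l y ?s (\<tau> ?s) = val A l b ?s (\<tau> ?s)" using eq sel by (simp add: val_def)
  have "val A l b ?s c \<le> val A l y ?s (\<tau> ?s)" using dom unfolding e by (simp add: dominates_def)
  hence eqc: "val A l y ?s c = val A l b ?s c"
    using val_mono[OF le, of A l ?s c] t by (simp add: tight_at_def)
  show "tight_at A l \<tau> b j c" using t unfolding tight_at_def e eqc .
  show "y $ target ?s c = b $ target ?s c"
    by (rule val_eqD[OF A l eqc tight_at_target(1)[OF A l y sel t]])
qed

lemma tight_path_upgrade:
  assumes A: "A \<in> Rmax_mat" and l: "l \<noteq> \<infinity>" and y: "y \<in> Rmax_vec" and sel: "selection \<tau>"
    and dom: "dominates A l \<tau> b" and le: "\<And>j. y $ j \<le> b $ j"
    and path: "(i, k) \<in> (tight A l \<tau> y)\<^sup>*" and eq: "y $ i = b $ i"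
  shows "(i, k) \<in> (tight A l \<tau> b)\<^sup>* \<and> y $ k = b $ k"
  using path
proof (induction rule: rtrancl_induct)
  case (step j k)
  then obtain c where c: "tight_at A l \<tau> y j c" "k = target (row_of \<tau> j) c" by (auto simp: tight_def)
  have "y $ j = b $ j" using step.IH by simp
  note u = tight_at_upgrade[OF A l y sel dom le c(1) this]
  have "(j, k) \<in> tight A l \<tau> b" using u(1) c(2) unfolding tight_def by blast
  thus ?case using step.IH u(2) c(2) by (auto intro: rtrancl_into_rtrancl)
qed (use eq in simp)

lemma length_changing_cycle_upgrade:
  assumes A: "A \<in> Rmax_mat" and l: "l \<noteq> \<infinity>" and y: "y \<in> Rmax_vec" and sel: "selection \<tau>"
    and dom: "dominates A l \<tau> b" and le: "\<And>j. y $ j \<le> b $ j"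
    and cyc: "length_changing_cycle A l \<tau> y \<kappa> k" and eq: "y $ k = b $ k"
  shows "length_changing_cycle A l \<tau> b \<kappa> k"
proof -
  let ?f = "succ \<tau> \<kappa>"
  have t: "tight_at A l \<tau> y j (\<kappa> j)" if "j \<in> orbit_from ?f k" for j
    using cyc that unfolding length_changing_cycle_def by blast
  have e: "y $ (?f ^^ n) k = b $ (?f ^^ n) k" for n
  proof (induction n)
    case (Suc n)
    have "(?f ^^ n) k \<in> orbit_from ?f k" by (auto simp: orbit_from_def)
    from tight_at_upgrade(2)[OF A l y sel dom le t[OF this] Suc] show ?case
      unfolding funpow.simps comp_apply succ_def[of \<tau> \<kappa> "(?f ^^ n) k"] .
  qed (use eq in simp)
  have "tight_at A l \<tau> b j (\<kappa> j)" if j: "j \<in> orbit_from ?f k" for j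
  proof -
    obtain n where "j = (?f ^^ n) k" using j unfolding orbit_from_def by blast
    hence "y $ j = b $ j" using e by simp
    thus ?thesis by (rule tight_at_upgrade(1)[OF A l y sel dom le t[OF j]])
  qed
  thus ?thesis using cyc unfolding length_changing_cycle_def by blast
qed

text \<open>The path and the cycle are found for a limit \<open>y\<close> that is exact at
  \<open>i\<close>; forward propagation from \<open>i\<close> carries them over to
  \<open>x\<close>.\<close>

lemma eigenspace_chain:
  fixes A :: "ereal ^ 'n ^ 'n" and l :: real
  assumes A: "A \<in> Rmax_mat" and \<zeta>: "\<zeta> \<in> generic_directions A" and x: "x \<in> alg_eigenspace A l"
    and i: "x $ i \<noteq> -\<infinity>"
  shows "\<exists>\<tau> \<kappa> k. optimal A l \<tau> \<and> (i, k) \<in> (tight A l \<tau> x)\<^sup>* \<and> length_changing_cycle A l \<tau> x \<kappa> k"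
proof -
  have l: "ereal l \<noteq> \<infinity>" by simp
  obtain d L C Y y where ap: "approximation A \<zeta> l d L C Y y"
    and y: "\<And>j. y $ j \<le> x $ j" "y $ i = x $ i"
    using approximation_exists[OF A l \<zeta> x, of i] by blast
  interpret approximation A \<zeta> "ereal l" d L C Y y by (rule ap)
  have opt: "optimal A l \<tau>" by (rule optimal_A[OF refl])
  have dom: "dominates A l \<tau> x" by (rule eigenspace_dominated[OF A \<zeta> x opt])
  obtain \<kappa> k where k: "(i, k) \<in> (tight A l \<tau> y)\<^sup>*" "length_changing_cycle A l \<tau> y \<kappa> k"
    using length_changing[OF refl] y(2) i by metis
  note u = tight_path_upgrade[OF A l y_in_Rmax sel dom y(1) k(1) y(2)]
  have "length_changing_cycle A l \<tau> x \<kappa> k"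
    by (rule length_changing_cycle_upgrade[OF A l y_in_Rmax sel dom y(1) k(2)]) (use u in simp)
  thus ?thesis using opt u by blast
qed

text \<open>For \<open>k\<close> outside \<open>C\<close> the picked term of row \<open>k\<close> is
  \<open>-\<infinity>\<close>, so the whole row of \<open>b\<close> is. A tropical vector for
  \<open>l' \<noteq> -\<infinity>\<close> below \<open>b\<close> cannot be finite at
  \<open>k\<close>; hence \<open>y\<close> meets \<open>b\<close> there, and backward propagation
  reaches all indices.\<close>

lemma MInf_component:
  fixes A :: "ereal ^ 'n ^ 'n"
  assumes A: "A \<in> Rmax_mat" and C: "permutation_graph C" and b: "b \<in> Rmax_vec"
    and dom: "dominates A (-\<infinity>) (selection_of C) b" "dominates A (-\<infinity>) (selection_of C) y"
    and le: "\<And>i. y $ i \<le> b $ i"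
    and escape: "\<And>i. b $ i \<noteq> -\<infinity> \<Longrightarrow>
       \<exists>k. k \<notin> Field C \<and> (i, k) \<in> (tight A (-\<infinity>) (selection_of C) b)\<^sup>* \<and> b $ k \<noteq> -\<infinity>"
    and cover: "\<And>j. b $ j \<noteq> -\<infinity> \<Longrightarrow> y $ j = b $ j \<or> (\<exists>l' z. l' \<noteq> -\<infinity> \<and>
                  (\<forall>i. z $ i \<le> b $ i) \<and> tropical A l' z \<and> z $ j = b $ j)"
  shows "y = b"
proof -
  have "y $ i = b $ i" for i
  proof (cases "b $ i = -\<infinity>")
    case False
    obtain k where k: "k \<notin> Field C" "(i, k) \<in> (tight A (-\<infinity>) (selection_of C) b)\<^sup>*" "b $ k \<noteq> -\<infinity>"
      using escape[OF False] by blast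
    have "y $ k = b $ k"
    proof (rule ccontr)
      assume "y $ k \<noteq> b $ k"
      then obtain l' z where z: "l' \<noteq> -\<infinity>" "\<And>i. z $ i \<le> b $ i" "tropical A l' z" "z $ k = b $ k"
        using cover[OF k(3)] by blast
      have fin: "l' + z $ k \<noteq> -\<infinity>" using z(1,4) k(3) by simp
      obtain d where "l' + z $ k \<le> A $ k $ d + z $ d" by (rule tropical_row_bound[OF z(3) fin])
      also have "\<dots> \<le> A $ k $ d + b $ d" by (intro add_left_mono z)
      also have "\<dots> = val A (-\<infinity>) b k (Some d)" by (simp add: val_def)
      also have "\<dots> \<le> val A (-\<infinity>) b k (selection_of C k)" using dom(1) by (simp add: dominates_def)
      also have "\<dots> = -\<infinity>"
        using k(1) selection_of_None[of C k] add_MInfty(2)[OF Rmax_vec_not_PInf[OF b]] by (simp add: val_def)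
      finally show False using fin by simp
    qed
    thus ?thesis
      by (intro tight_tail[OF A _ selection_selection_of[OF C] b dom(2) le k(2)]) simp
  qed (use le[of i] in simp)
  thus ?thesis by (simp add: vec_eq_iff)
qed

subsection \<open>Generic directions\<close>

lemma circuit_weight_perturb:
  assumes A: "A \<in> Rmax_mat" and C: "C \<subseteq> graph_edges A"
  shows "circuit_weight (perturb A \<zeta> \<delta>) C =
    ereal ((\<Sum>(i, j)\<in>C. real_of_ereal (A $ i $ j)) - (\<Sum>(i, j)\<in>C. \<zeta> $ i $ j) * \<delta>)"
proof -
  have "perturb A \<zeta> \<delta> $ i $ j = ereal (real_of_ereal (A $ i $ j) - \<zeta> $ i $ j * \<delta>)" if "(i, j) \<in> C" for i j
  proof -
    have "A $ i $ j \<noteq> -\<infinity>" "A $ i $ j \<noteq> \<infinity>"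
      using that C A by (auto simp: graph_edges_def Rmax_mat_def Rmax_def)
    thus ?thesis by (cases "A $ i $ j") (auto simp: perturb_def)
  qed
  hence "circuit_weight (perturb A \<zeta> \<delta>) C = (\<Sum>(i, j)\<in>C. ereal (real_of_ereal (A $ i $ j) - \<zeta> $ i $ j * \<delta>))"
    unfolding circuit_weight_def by (intro sum.cong) auto
  also have "\<dots> = ereal (\<Sum>(i, j)\<in>C. real_of_ereal (A $ i $ j) - \<zeta> $ i $ j * \<delta>)"
    by (simp add: case_prod_beta)
  finally show ?thesis by (simp add: case_prod_beta sum_subtractf sum_distrib_right)
qed

text \<open>Two different edge sets of equal size lose weight at different rates, so they tie at one
  value of \<open>\<delta>\<close> only. There are finitely many pairs, and small positive
  \<open>\<delta>\<close> avoids all of these values.\<close>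

lemma generic_directions_nonempty:
  fixes A :: "ereal ^ 'n ^ 'n"
  assumes A: "A \<in> Rmax_mat"
  obtains \<zeta> where "\<zeta> \<in> generic_directions A"
proof -
  obtain e :: "'n \<times> 'n \<Rightarrow> nat" where e: "inj e"
    using finite_imp_inj_to_nat_seg[of "UNIV :: ('n \<times> 'n) set"] by auto
  define M where "M = Max (range e)"
  have eM: "e p \<le> M" for p by (simp add: M_def)
  \<comment> \<open>With distinct powers of two as entries, different edge sets have different sums.\<close>
  define \<zeta> :: "real ^ 'n ^ 'n" where "\<zeta> = (\<chi> i j. 2 ^ e (i, j) / 2 ^ M)"
  define w where "w C = (\<Sum>(i, j)\<in>C. real_of_ereal (A $ i $ j))" for C
  define z where "z C = (\<Sum>(i, j)\<in>C. \<zeta> $ i $ j)" for C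
  have z: "z C = real (set_encode (e ` C)) / 2 ^ M" for C
  proof -
    have "set_encode (e ` C) = (\<Sum>p\<in>C. 2 ^ e p)"
      unfolding set_encode_def using e by (subst sum.reindex) (auto intro: inj_on_subset)
    thus ?thesis by (simp add: z_def \<zeta>_def case_prod_beta sum_divide_distrib)
  qed
  have z_inj: "C = D" if "z C = z D" for C D
  proof -
    have "set_encode (e ` C) = set_encode (e ` D)" using that z[of C] z[of D] by simp
    hence "e ` C = e ` D" by (simp add: set_encode_eq)
    thus ?thesis using e by (simp add: inj_image_eq_iff)
  qed
  \<comment> \<open>The pairs with \<open>C = D\<close> yield 0 by division by zero and are excluded
    by \<open>0 < s\<close>. Inserting 1 below keeps the minimum defined.\<close>
  define S where "S = {s. 0 < s \<and> (\<exists>C D. s = (w C - w D) / (z C - z D))}"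
  have "S \<subseteq> (\<lambda>(C, D). (w C - w D) / (z C - z D)) ` UNIV" unfolding S_def by auto
  hence fin: "finite S" by (rule finite_subset) simp
  define b where "b = Min (insert 1 S)"
  have b: "b > 0" unfolding b_def using fin by (auto simp: S_def)
  have notS: "\<delta> \<notin> S" if "\<delta> < b" for \<delta> using that fin unfolding b_def by auto
  have "star_condition (perturb A \<zeta> \<delta>)" if \<delta>: "0 < \<delta>" "\<delta> < b" for \<delta>
    unfolding star_condition_def
  proof (intro ballI allI impI notI)
    let ?P = "perturb A \<zeta> \<delta>"
    fix l C D
    assume "maximal_multi_circuit ?P l C \<and> maximal_multi_circuit ?P l D \<and> C \<noteq> D" and card: "card C = card D"
    hence m: "maximal_multi_circuit ?P l C" "maximal_multi_circuit ?P l D" "C \<noteq> D" by auto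
    \<comment> \<open>Also at \<open>-\<infinity>\<close> both sets are maximal at a common real
      \<open>\<mu>\<close>; as the lengths agree, the contributions of \<open>\<mu>\<close> cancel
      below.\<close>
    have "\<exists>\<mu>. real_maximal ?P \<mu> C \<and> real_maximal ?P \<mu> D"
    proof (cases l)
      case (real \<mu>)
      thus ?thesis using m unfolding real maximal_multi_circuit_ereal by blast
    next
      case MInf
      hence "\<forall>\<^sub>F \<mu> in at_bot. real_maximal ?P \<mu> C" "\<forall>\<^sub>F \<mu> in at_bot. real_maximal ?P \<mu> D"
        using m by (auto simp: maximal_multi_circuit_def)
      hence "\<forall>\<^sub>F \<mu> in at_bot. real_maximal ?P \<mu> C \<and> real_maximal ?P \<mu> D" by (rule eventually_conj)
      thus ?thesis using eventually_happens'[OF trivial_limit_at_bot_linorder] by blast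
    qed (use m in \<open>auto simp: maximal_multi_circuit_def\<close>)
    then obtain \<mu> where \<mu>: "real_maximal ?P \<mu> C" "real_maximal ?P \<mu> D" by blast
    have sub: "C \<subseteq> graph_edges A" "D \<subseteq> graph_edges A"
      using multi_circuit_permutation_graph(2)[OF maximal_multi_circuitD[OF m(1)]]
        multi_circuit_permutation_graph(2)[OF maximal_multi_circuitD[OF m(2)]]
      by (auto simp: graph_edges_def perturb_MInf_iff)
    have "circuit_weight ?P C + ereal ((real CARD('n) - real (card C)) * \<mu>) =
          circuit_weight ?P D + ereal ((real CARD('n) - real (card C)) * \<mu>)"
      using \<mu> card unfolding real_maximal_def by simp
    hence "w C - z C * \<delta> = w D - z D * \<delta>"
      unfolding circuit_weight_perturb[OF A sub(1)] circuit_weight_perturb[OF A sub(2)] w_def z_def by simp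
    hence "w C - w D = \<delta> * (z C - z D)" by (simp add: algebra_simps)
    moreover have "z C - z D \<noteq> 0" using z_inj m(3) by auto
    ultimately have "\<delta> = (w C - w D) / (z C - z D)" by (simp add: eq_divide_eq)
    hence "\<delta> \<in> S" using \<delta>(1) unfolding S_def by blast
    thus False using notS[OF \<delta>(2)] by blast
  qed
  moreover have "0 \<le> \<zeta> $ i $ j" "\<zeta> $ i $ j \<le> 1" for i j
    using eM[of "(i, j)"] by (auto simp: \<zeta>_def intro: power_increasing)
  ultimately have "\<zeta> \<in> generic_directions A" unfolding generic_directions_def using b by blast
  thus thesis by (rule that)
qed

subsection \<open>Bases of the sum of the algebraic eigenspaces\<close>

text \<open>This takes the place of linear independence of eigenspaces. One generic direction is
  fixed and used for \<open>b\<close> and for all summands.\<close>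

lemma eigenvector_component:
  fixes A :: "ereal ^ 'n ^ 'n"
  assumes A: "A \<in> Rmax_mat"
    and disj: "\<And>(l::real) C D D'. maximal_multi_circuit A (ereal l) C \<Longrightarrow>
           critical_circuit (B_mat A (ereal l) C) D \<Longrightarrow> critical_circuit (B_mat A (ereal l) C) D' \<Longrightarrow>
           D \<noteq> D' \<Longrightarrow> Field D \<inter> Field D' = {}"
    and F: "finite F" "l \<in> F" "\<And>k. k \<in> F \<Longrightarrow> k \<noteq> \<infinity>" "\<And>k. k \<in> F \<Longrightarrow> x k \<in> alg_eigenspace A k"
    and b: "b \<in> alg_eigenspace A l" "b = mp_sum F x"
  shows "b = x l"
proof -
  obtain \<zeta> where \<zeta>: "\<zeta> \<in> generic_directions A" by (rule generic_directions_nonempty[OF A])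
  have bR: "b \<in> Rmax_vec" by (rule eigenspace_Rmax[OF \<zeta> b(1)])
  have le: "x k $ i \<le> b $ i" if "k \<in> F" for k i
    unfolding b(2) mp_sum_def using that by (auto intro: SUP_upper)
  have cover: "x l $ j = b $ j \<or> (\<exists>l' z. l' \<noteq> l \<and> l' \<noteq> \<infinity> \<and>
                  (\<forall>i. z $ i \<le> b $ i) \<and> tropical A l' z \<and> z $ j = b $ j)" for j
  proof -
    obtain k where k: "k \<in> F" "(SUP k\<in>F. x k $ j) = x k $ j"
      by (rule finite_SUP_attained[of F "\<lambda>k. x k $ j"]) (use F in auto)
    have bj: "b $ j = x k $ j" unfolding b(2) mp_sum_def using k(2) by simp
    show ?thesis
    proof (cases "k = l")
      case False
      obtain z where z: "\<And>i. z $ i \<le> x k $ i" "tropical A k z" "z $ j = x k $ j"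
        using eigenspace_tropical_cover[OF A F(3)[OF k(1)] \<zeta> F(4)[OF k(1)], of j] by blast
      have "z $ i \<le> b $ i" for i using z(1) le[OF k(1)] order_trans by blast
      thus ?thesis using z bj False F(3)[OF k(1)] by metis
    qed (use bj in simp)
  qed
  show ?thesis
  proof (cases l)
    case (real r)
    note b1 = b(1)[unfolded real] and x1 = F(4)[OF F(2), unfolded real]
    obtain \<tau>0 where opt0: "optimal A r \<tau>0" by (rule optimal_exists[OF A])
    have dom: "dominates A r \<tau> b" if "optimal A r \<tau>" for \<tau>
      by (rule eigenspace_dominated[OF A \<zeta> b1 that])
    have "x l = b"
    proof (rule real_component[OF A bR opt0 dom])
      show "unique_circuits A r \<tau> b" if "optimal A r \<tau>" for \<tau>
        by (rule unique_circuits_of_disjoint[OF A that bR dom[OF that] disj])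
      show "\<exists>\<tau> \<kappa> k. optimal A r \<tau> \<and> (i, k) \<in> (tight A r \<tau> b)\<^sup>* \<and> length_changing_cycle A r \<tau> b \<kappa> k"
        if "b $ i \<noteq> -\<infinity>" for i
        by (rule eigenspace_chain[OF A \<zeta> b1 that])
      show "dominates A r \<tau> (x l)" if "optimal A r \<tau>" for \<tau>
        using eigenspace_dominated[OF A \<zeta> x1 that] real by simp
      show "x l $ i \<le> b $ i" for i by (rule le[OF F(2)])
      show "x l $ j = b $ j \<or> (\<exists>l' z. l' \<noteq> ereal r \<and> l' \<noteq> \<infinity> \<and>
                  (\<forall>i. z $ i \<le> b $ i) \<and> tropical A l' z \<and> z $ j = b $ j)" for j
        using cover[of j] real by simp
    qed
    thus ?thesis ..
  next
    case MInf
    obtain C where C: "\<And>x. x \<in> alg_eigenspace A (-\<infinity>) \<Longrightarrow> \<exists>d L Y. approximation A \<zeta> (-\<infinity>) d L C Y x"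
      using MInf_approximation_exists[OF A \<zeta>] by blast
    obtain d L Y where apb: "approximation A \<zeta> (-\<infinity>) d L C Y b" using C b(1) MInf by blast
    obtain d' L' Y' where apx: "approximation A \<zeta> (-\<infinity>) d' L' C Y' (x l)"
      using C[of "x l"] F(4)[OF F(2)] MInf by auto
    interpret b: approximation A \<zeta> "-\<infinity>" d L C Y b by (rule apb)
    interpret x: approximation A \<zeta> "-\<infinity>" d' L' C Y' "x l" by (rule apx)
    have "x l = b"
    proof (rule MInf_component[OF A b.pg bR b.dominates_y x.dominates_y le[OF F(2)]])
      show "\<exists>k. k \<notin> Field C \<and> (i, k) \<in> (tight A (-\<infinity>) (selection_of C) b)\<^sup>* \<and> b $ k \<noteq> -\<infinity>"
        if "b $ i \<noteq> -\<infinity>" for i using b.escape[OF refl that] by blast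
      show "x l $ j = b $ j \<or> (\<exists>l' z. l' \<noteq> -\<infinity> \<and>
                  (\<forall>i. z $ i \<le> b $ i) \<and> tropical A l' z \<and> z $ j = b $ j)" for j
        using cover[of j] unfolding MInf by blast
    qed
    thus ?thesis ..
  qed (use F(2,3) in blast)
qed

section \<open>Spans and sums of subspaces\<close>

lemma space_sumI:
  "finite F \<Longrightarrow> F \<subseteq> K \<Longrightarrow> (\<And>k. k \<in> F \<Longrightarrow> f k \<in> U k) \<Longrightarrow> mp_sum F f \<in> mp_space_sum K U"
  unfolding mp_space_sum_def by blast

lemma space_sumE:
  assumes "x \<in> mp_space_sum K U"
  obtains F f where "finite F" "F \<subseteq> K" "\<And>k. k \<in> F \<Longrightarrow> f k \<in> U k" "x = mp_sum F f"
  using assms unfolding mp_space_sum_def by blast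

lemma spanI: "finite F \<Longrightarrow> F \<subseteq> S \<Longrightarrow> \<forall>v\<in>F. c v \<in> Rmax \<Longrightarrow> mp_sum F (\<lambda>v. mp_scale (c v) v) \<in> mp_span S"
  unfolding mp_span_def by blast

lemma spanE:
  assumes "x \<in> mp_span S"
  obtains F c where "finite F" "F \<subseteq> S" "\<forall>v\<in>F. c v \<in> Rmax" "x = mp_sum F (\<lambda>v. mp_scale (c v) v)"
  using assms unfolding mp_span_def by blast

lemma span_superset:
  assumes "v \<in> S"
  shows "v \<in> mp_span S"
proof -
  have "mp_sum {v} (\<lambda>u. mp_scale 0 u) = v" by (simp add: mp_sum_def mp_scale_def vec_eq_iff)
  thus ?thesis using spanI[of "{v}" S "\<lambda>_. 0"] assms by (simp add: Rmax_def)
qed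

lemma span_mono:
  assumes "S \<subseteq> T"
  shows "mp_span S \<subseteq> mp_span T"
proof
  fix x assume "x \<in> mp_span S"
  then obtain F c where F: "finite F" "F \<subseteq> S" "\<forall>v\<in>F. c v \<in> Rmax" "x = mp_sum F (\<lambda>v. mp_scale (c v) v)"
    by (rule spanE)
  have "F \<subseteq> T" using F(2) assms by blast
  thus "x \<in> mp_span T" unfolding F(4) using spanI F(1,3) by blast
qed

text \<open>A vector may occur in several of the combinations; its coefficients are merged by taking
  their maximum.\<close>

lemma span_sum:
  fixes f :: "'b \<Rightarrow> ereal ^ 'n"
  assumes K: "finite K" and f: "\<And>k. k \<in> K \<Longrightarrow> f k \<in> mp_span S"
  shows "mp_sum K f \<in> mp_span S"
proof -
  have "\<forall>k\<in>K. \<exists>G. \<exists>c. finite G \<and> G \<subseteq> S \<and> (\<forall>v\<in>G. c v \<in> Rmax) \<and> f k = mp_sum G (\<lambda>v. mp_scale (c v) v)"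
    by (intro ballI, rule spanE[OF f], assumption) blast
  from bchoice[OF this] obtain G where
    "\<forall>k\<in>K. \<exists>c. finite (G k) \<and> G k \<subseteq> S \<and> (\<forall>v\<in>G k. c v \<in> Rmax) \<and> f k = mp_sum (G k) (\<lambda>v. mp_scale (c v) v)"
    by (rule exE)
  from bchoice[OF this] obtain c where
    Gc: "\<forall>k\<in>K. finite (G k) \<and> G k \<subseteq> S \<and> (\<forall>v\<in>G k. c k v \<in> Rmax) \<and> f k = mp_sum (G k) (\<lambda>v. mp_scale (c k v) v)"
    by (rule exE)
  have G: "finite (G k)" "G k \<subseteq> S" "v \<in> G k \<Longrightarrow> c k v \<in> Rmax"
    "f k = mp_sum (G k) (\<lambda>v. mp_scale (c k v) v)" if "k \<in> K" for k v
    using Gc that by simp_all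
  define c' where "c' v = (SUP k\<in>{k\<in>K. v \<in> G k}. c k v)" for v
  have c': "\<exists>k\<in>K. v \<in> G k \<and> c' v = c k v" if v: "v \<in> (\<Union>k\<in>K. G k)" for v
  proof -
    obtain k where "k \<in> {k\<in>K. v \<in> G k}" "c' v = c k v"
      unfolding c'_def by (rule finite_SUP_attained[of "{k\<in>K. v \<in> G k}" "\<lambda>k. c k v"]) (use K v in auto)
    thus ?thesis by blast
  qed
  have fk: "f k $ i = (SUP v\<in>G k. c k v + v $ i)" if "k \<in> K" for k i
    using G(4)[OF that] by (simp add: mp_sum_def mp_scale_def)
  have "mp_sum K f = mp_sum (\<Union>k\<in>K. G k) (\<lambda>v. mp_scale (c' v) v)"
  proof (simp add: mp_sum_def mp_scale_def vec_eq_iff, intro allI antisym SUP_least)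
    fix i k assume k: "k \<in> K"
    show "f k $ i \<le> (SUP v\<in>(\<Union>k\<in>K. G k). c' v + v $ i)"
      unfolding fk[OF k]
    proof (rule SUP_mono)
      fix v assume v: "v \<in> G k"
      have "c k v \<le> c' v" unfolding c'_def using k v by (auto intro: SUP_upper)
      thus "\<exists>u\<in>(\<Union>k\<in>K. G k). c k v + v $ i \<le> c' u + u $ i"
        using k v by (intro bexI[of _ v] add_right_mono) auto
    qed
  next
    fix i v assume "v \<in> (\<Union>k\<in>K. G k)"
    then obtain k where k: "k \<in> K" "v \<in> G k" "c' v = c k v" using c' by blast
    have "c' v + v $ i \<le> f k $ i" unfolding fk[OF k(1)] k(3) using k(2) by (auto intro: SUP_upper)
    also have "\<dots> \<le> (SUP k\<in>K. f k $ i)" using k(1) by (rule SUP_upper)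
    finally show "c' v + v $ i \<le> (SUP k\<in>K. f k $ i)" .
  qed
  moreover have "finite (\<Union>k\<in>K. G k)" "(\<Union>k\<in>K. G k) \<subseteq> S" using K G(1,2) by auto
  moreover have "\<forall>v\<in>(\<Union>k\<in>K. G k). c' v \<in> Rmax" using c' G(3) by metis
  ultimately show ?thesis using spanI[of "\<Union>k\<in>K. G k" S c'] by simp
qed

lemma span_scale:
  assumes "a \<in> Rmax" "v \<in> mp_span S"
  shows "mp_scale a v \<in> mp_span S"
proof -
  obtain F c where F: "finite F" "F \<subseteq> S" "\<forall>u\<in>F. c u \<in> Rmax" "v = mp_sum F (\<lambda>u. mp_scale (c u) u)"
    using assms(2) by (rule spanE)
  have a: "a \<noteq> \<infinity>" using assms(1) by (simp add: Rmax_def)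
  have "mp_scale a v = mp_sum F (\<lambda>u. mp_scale (a + c u) u)"
  proof (cases "F = {}")
    case True
    thus ?thesis using F(4) a by (simp add: mp_sum_def mp_scale_def bot_ereal_def add_MInfty)
  next
    case False
    have "a + (SUP u\<in>F. c u + u $ i) = (SUP u\<in>F. a + c u + u $ i)" for i
    proof (rule antisym)
      obtain u where u: "u \<in> F" "(SUP u\<in>F. c u + u $ i) = c u + u $ i"
        by (rule finite_SUP_attained[OF F(1) False])
      have "a + (SUP u\<in>F. c u + u $ i) = a + c u + u $ i" by (simp add: u(2) add.assoc)
      also have "\<dots> \<le> (SUP u\<in>F. a + c u + u $ i)" using u(1) by (rule SUP_upper)
      finally show "a + (SUP u\<in>F. c u + u $ i) \<le> (SUP u\<in>F. a + c u + u $ i)" .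
      show "(SUP u\<in>F. a + c u + u $ i) \<le> a + (SUP u\<in>F. c u + u $ i)"
        by (rule SUP_least) (auto simp: add.assoc intro: add_left_mono SUP_upper)
    qed
    thus ?thesis using F(4) by (simp add: mp_sum_def mp_scale_def vec_eq_iff)
  qed
  moreover have "\<forall>u\<in>F. a + c u \<in> Rmax" using F(3) a by (auto simp: Rmax_def)
  ultimately show ?thesis using spanI[OF F(1,2)] by simp
qed

lemma span_subset:
  assumes "S \<subseteq> mp_span T"
  shows "mp_span S \<subseteq> mp_span T"
proof
  fix v assume "v \<in> mp_span S"
  then obtain F c where F: "finite F" "F \<subseteq> S" "\<forall>u\<in>F. c u \<in> Rmax" "v = mp_sum F (\<lambda>u. mp_scale (c u) u)"
    by (rule spanE)
  show "v \<in> mp_span T" unfolding F(4) using assms F(2,3) by (intro span_sum[OF F(1)] span_scale) auto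
qed

text \<open>Labels that no vector carries contribute the empty sum, which is the zero vector, so
  \<open>K\<close> may exceed the set of labels in use.\<close>

lemma mp_sum_group:
  assumes "lab ` F \<subseteq> K"
  shows "mp_sum F f = mp_sum K (\<lambda>k. mp_sum {v\<in>F. lab v = k} f)"
proof -
  have "(SUP v\<in>F. f v $ i) = (SUP k\<in>K. SUP v\<in>{v\<in>F. lab v = k}. f v $ i)" for i
  proof (rule antisym)
    show "(SUP v\<in>F. f v $ i) \<le> (SUP k\<in>K. SUP v\<in>{v\<in>F. lab v = k}. f v $ i)"
    proof (rule SUP_least)
      fix v assume v: "v \<in> F"
      have "f v $ i \<le> (SUP u\<in>{u\<in>F. lab u = lab v}. f u $ i)" using v by (auto intro: SUP_upper)
      also have "\<dots> \<le> (SUP k\<in>K. SUP v\<in>{v\<in>F. lab v = k}. f v $ i)"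
        by (rule SUP_upper) (use assms v in blast)
      finally show "f v $ i \<le> (SUP k\<in>K. SUP v\<in>{v\<in>F. lab v = k}. f v $ i)" .
    qed
    show "(SUP k\<in>K. SUP v\<in>{v\<in>F. lab v = k}. f v $ i) \<le> (SUP v\<in>F. f v $ i)"
      by (intro SUP_least) (auto intro: SUP_upper)
  qed
  thus ?thesis by (simp add: mp_sum_def vec_eq_iff)
qed

theorem theorem3p3:
  fixes A :: "ereal ^ 'n ^ 'n"
    and \<B> :: "ereal \<Rightarrow> (ereal ^ 'n) set"
  assumes "A \<in> Rmax_mat"
    and "\<And>l. l \<in> alg_eigenvalues A \<Longrightarrow> mp_basis (\<B> l) (alg_eigenspace A l)"
    and "\<And>(l::real) C D D'.
           maximal_multi_circuit A (ereal l) C \<Longrightarrow>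
           critical_circuit (B_mat A (ereal l) C) D \<Longrightarrow>
           critical_circuit (B_mat A (ereal l) C) D' \<Longrightarrow>
           D \<noteq> D' \<Longrightarrow> Field D \<inter> Field D' = {}"
  shows "mp_basis (\<Union>l\<in>alg_eigenvalues A. \<B> l)
           (mp_space_sum (alg_eigenvalues A) (alg_eigenspace A))"
proof -
  define \<Lambda> where "\<Lambda> = alg_eigenvalues A"
  define U where "U = (\<Union>l\<in>\<Lambda>. \<B> l)"
  let ?W = "alg_eigenspace A"
  have fin: "l \<noteq> \<infinity>" if "l \<in> \<Lambda>" for l
    using that unfolding \<Lambda>_def alg_eigenvalues_def Rmax_def by auto
  have span: "mp_span (\<B> l) = ?W l" and sub: "\<B> l \<subseteq> ?W l"
    and minimal: "\<And>B'. B' \<subset> \<B> l \<Longrightarrow> mp_span B' \<noteq> ?W l" if "l \<in> \<Lambda>" for l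
    using assms(2) that unfolding \<Lambda>_def mp_basis_def by auto
  \<comment> \<open>Sorts a combination by eigenvalue. A vector lying in several bases is counted
    for one of them, and \<open>k0\<close> is put into \<open>K\<close> even if nothing is counted
    for it, so that the eigenvalue of interest has a component, possibly zero.\<close>
  have group: "\<exists>K f. finite K \<and> k0 \<in> K \<and> K \<subseteq> \<Lambda> \<and> (\<forall>k\<in>K. f k \<in> mp_span (\<B> k \<inter> B')) \<and> x = mp_sum K f"
    if x: "x \<in> mp_span B'" and B': "B' \<subseteq> U" and k0: "k0 \<in> \<Lambda>" for x B' k0
  proof -
    obtain F c where F: "finite F" "F \<subseteq> B'" "\<forall>v\<in>F. c v \<in> Rmax" "x = mp_sum F (\<lambda>v. mp_scale (c v) v)"
      using x by (rule spanE)
    have "\<forall>v\<in>F. \<exists>l. l \<in> \<Lambda> \<and> v \<in> \<B> l" using F(2) B' unfolding U_def by blast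
    then obtain lab where lab: "\<And>v. v \<in> F \<Longrightarrow> lab v \<in> \<Lambda> \<and> v \<in> \<B> (lab v)" by metis
    let ?K = "insert k0 (lab ` F)"
    let ?f = "\<lambda>k. mp_sum {v\<in>F. lab v = k} (\<lambda>v. mp_scale (c v) v)"
    show ?thesis
    proof (intro exI[of _ ?K] exI[of _ ?f] conjI ballI)
      show "?f k \<in> mp_span (\<B> k \<inter> B')" for k
        by (intro span_sum span_scale span_superset) (use F lab in auto)
      show "x = mp_sum ?K ?f" unfolding F(4) by (rule mp_sum_group) blast
    qed (use F(1) k0 lab in auto)
  qed
  have U_sum: "v \<in> mp_space_sum \<Lambda> ?W" if v: "v \<in> U" for v
  proof -
    obtain l where l: "l \<in> \<Lambda>" "v \<in> ?W l" using v sub unfolding U_def by blast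
    have "v = mp_sum {l} (\<lambda>_. v)" by (simp add: mp_sum_def)
    thus ?thesis using space_sumI[of "{l}" \<Lambda> "\<lambda>_. v" ?W] l by simp
  qed
  have "mp_span U = mp_space_sum \<Lambda> ?W"
  proof
    show "mp_span U \<subseteq> mp_space_sum \<Lambda> ?W"
    proof
      fix x assume x: "x \<in> mp_span U"
      show "x \<in> mp_space_sum \<Lambda> ?W"
      proof (cases "\<Lambda> = {}")
        \<comment> \<open>Without an eigenvalue \<open>group\<close> does not apply; only the zero
          vector, as an empty sum, is left.\<close>
        case True
        obtain F c where "F \<subseteq> U" "x = mp_sum F (\<lambda>v. mp_scale (c v) v)" using x by (rule spanE)
        hence x0: "x = mp_sum {} (\<lambda>_. x)" using True by (simp add: U_def mp_sum_def)
        show ?thesis by (subst x0) (rule space_sumI; simp)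
      next
        case False
        then obtain k0 where "k0 \<in> \<Lambda>" by blast
        from group[OF x order_refl this] obtain K f where K: "finite K" "K \<subseteq> \<Lambda>"
          "\<forall>k\<in>K. f k \<in> mp_span (\<B> k \<inter> U)" "x = mp_sum K f" by (elim exE conjE)
        have "f k \<in> ?W k" if k: "k \<in> K" for k
        proof -
          have "f k \<in> mp_span (\<B> k)" using K(3) k span_mono[of "\<B> k \<inter> U" "\<B> k"] by blast
          thus ?thesis using span K(2) k by blast
        qed
        thus ?thesis unfolding K(4) by (rule space_sumI[OF K(1,2)])
      qed
    qed
    show "mp_space_sum \<Lambda> ?W \<subseteq> mp_span U"
    proof
      fix x assume "x \<in> mp_space_sum \<Lambda> ?W"
      then obtain F f where F: "finite F" "F \<subseteq> \<Lambda>" "\<And>k. k \<in> F \<Longrightarrow> f k \<in> ?W k" "x = mp_sum F f"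
        by (rule space_sumE) blast
      have "f k \<in> mp_span U" if k: "k \<in> F" for k
      proof -
        have "k \<in> \<Lambda>" using F(2) k by blast
        hence "\<B> k \<subseteq> U" "f k \<in> mp_span (\<B> k)" using span F(3)[OF k] unfolding U_def by auto
        thus ?thesis using span_mono by blast
      qed
      thus "x \<in> mp_span U" unfolding F(4) by (intro span_sum[OF F(1)])
    qed
  qed
  moreover have "mp_span B' \<noteq> mp_space_sum \<Lambda> ?W" if B': "B' \<subset> U" for B'
  proof
    assume eq: "mp_span B' = mp_space_sum \<Lambda> ?W"
    obtain b where b: "b \<in> U" "b \<notin> B'" using B' by blast
    obtain l where l: "l \<in> \<Lambda>" "b \<in> \<B> l" using b(1) unfolding U_def by blast
    have "b \<in> mp_span B'" using U_sum[OF b(1)] eq by simp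
    from group[OF this psubset_imp_subset[OF B'] l(1)] obtain K f where K: "finite K" "l \<in> K" "K \<subseteq> \<Lambda>"
      "\<forall>k\<in>K. f k \<in> mp_span (\<B> k \<inter> B')" "b = mp_sum K f" by (elim exE conjE)
    have fW: "f k \<in> ?W k" if k: "k \<in> K" for k
    proof -
      have "f k \<in> mp_span (\<B> k)" using K(4) k span_mono[of "\<B> k \<inter> B'" "\<B> k"] by blast
      thus ?thesis using span K(3) k by blast
    qed
    \<comment> \<open>The component at \<open>l\<close> is all of \<open>b\<close>, and it is built
      from vectors of \<open>\<B> l\<close> in \<open>B'\<close>, hence different from
      \<open>b\<close>; this contradicts minimality of \<open>\<B> l\<close>.\<close>
    have "b = f l"
    proof (rule eigenvector_component[OF assms(1,3) K(1,2) _ fW _ K(5)])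
      show "k \<noteq> \<infinity>" if "k \<in> K" for k using fin K(3) that by blast
      show "b \<in> ?W l" using sub l by blast
    qed
    hence "b \<in> mp_span (\<B> l \<inter> B')" using K(2,4) by blast
    moreover have "\<B> l \<inter> B' \<subseteq> \<B> l - {b}" using b(2) by blast
    ultimately have bs: "b \<in> mp_span (\<B> l - {b})" using span_mono by blast
    have "\<B> l \<subseteq> mp_span (\<B> l - {b})"
    proof
      fix v assume "v \<in> \<B> l"
      thus "v \<in> mp_span (\<B> l - {b})" by (cases "v = b") (auto intro: bs span_superset)
    qed
    hence "mp_span (\<B> l) \<subseteq> mp_span (\<B> l - {b})" by (rule span_subset)
    moreover have "mp_span (\<B> l - {b}) \<subseteq> mp_span (\<B> l)" by (rule span_mono) blast
    ultimately have "mp_span (\<B> l - {b}) = ?W l" using span[OF l(1)] by blast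
    thus False using minimal[OF l(1), of "\<B> l - {b}"] l(2) by blast
  qed
  ultimately show ?thesis
    using U_sum unfolding mp_basis_def U_def \<Lambda>_def by blast
qed

end
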